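(* Let $\mathbb{K}$ be either $\mathbb{Q}$ or an imaginary quadratic field and let $\beta_{1}$ be an algebraic integer with $[\mathbb{K}(\beta_{1}):\mathbb{K}] \leq 2$. If $\mathbb{K}=\mathbb{Q}$ or $\mathbb{K}(\beta_{1})=\mathbb{K}$, let $\tau=1$; otherwise let $\tau$ be an algebraic integer in $\mathbb{K}$ such that $\mathbb{K}(\beta_{1})=\mathbb{K}(\sqrt{\tau})$. If $\beta_{1}\in\mathbb{K}$, let $\beta_{2},\gamma_{1},\gamma_{2}\in\mathbb{K}$ with $\gamma_1,\gamma_2$ non-zero, $\beta_{2}\neq\beta_{1}$ and $\beta_{2}$ an algebraic integer. If $[\mathbb{K}(\beta_{1}):\mathbb{K}]=2$, let $\beta_{2}$ be the algebraic conjugate of $\beta_{1}$ over $\mathbb{K}$, let $\gamma_{1}\in\mathbb{K}(\beta_{1})$ and let $\gamma_{2}$ be the algebraic conjugate of $\gamma_{1}$ over $\mathbb{K}$ (so $\gamma_1=\gamma_2$ if they are elements of $\mathbb{K}$). For an algebraic integer $x\in\mathbb{K}$ and a rational integer $n\geq 3$, put $$U(x)=-\gamma_{2}(x-\beta_{2})^{n},\quad Z(x)=\gamma_{1}(x-\beta_{1})^{n},\quad W(x)=\frac{Z(x)}{U(x)},$$ $$\mathcal{A}(x)=\frac{\beta_{1}(x-\beta_{2})W(x)^{1/n}-\beta_{2}(x-\beta_{1})}{(x-\beta_{2})W(x)^{1/n}-(x-\beta_{1})}.$$ Let $g$ be an algebraic number such that $U(x)/g$ and $Z(x)/g$ are algebraic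 integers (not necessarily in $\mathbb{K}(\beta_{1})$). For each non-negative integer $r$, let $h_{r}$ be a non-zero algebraic integer with $h_{r}/g^{r}\in\mathbb{K}$ and $|h_{r}|\leq h$ for some fixed positive real number $h$. Let $d$ be the largest positive rational integer such that $(U(x)-Z(x))/(dg)$ is an algebraic integer, and let $\mathcal{C}_{n}$ and $\mathcal{D}_{n}$ be positive real numbers such that $$\max\left(1,\frac{\Gamma(1-1/n)\,r!}{\Gamma(r+1-1/n)},\frac{n\Gamma(r+1+1/n)}{\Gamma(1/n)\,r!}\right)\frac{D_{n,r}}{N_{d,n,r}}<\mathcal{C}_{n}\left(\frac{\mathcal{D}_{n}}{\mathcal{N}_{d,n}}\right)^{r}$$ holds for all non-negative integers $r$. Put $$E=\frac{|g|\mathcal{N}_{d,n}}{\mathcal{D}_{n}}\left\{\min\left(\left|\sqrt{U(x)}-\sqrt{Z(x)}\right|,\left|\sqrt{U(x)}+\sqrt{Z(x)}\right|\right)\right\}^{-2},$$ $$Q=\frac{\mathcal{D}_{n}}{|g|\mathcal{N}_{d,n}}\left\{\max\left(\left|\sqrt{U(x)}-\sqrt{Z(x)}\right|,\left|\sqrt{U(x)}+\sqrt{Z(x)}\right|\right)\right\}^{2},$$ $$\kappa=\frac{\log Q}{\log E},$$ $$c=4h|\sqrt{\tau}|\left(|x-\beta_{1}|+|x-\beta_{2}|\right)\mathcal{C}_{n}Q\,\max\left(1,\,5h|\sqrt{\tau}|\left|1-W(x)^{1/n}\right||x-\beta_{2}|\left|\mathcal{A}(x)-\beta_{1}\right|\mathcal{C}_{n}E\right)^{\kappa}.$$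 If $E>1$ and either $0<W(x)<1$ or $|W(x)|=1$ with $W(x)\neq-1$, then $$\left|\mathcal{A}(x)-\frac{p}{q}\right|>\frac{1}{c|q|^{\kappa+1}}$$ for all algebraic integers $p$ and $q$ in $\mathbb{K}$ with $q\neq0$.
   Context: All fields are subfields of $\mathbb{C}$. For a complex number $w=se^{i\varphi}$ with $s\geq0$, $-\pi<\varphi\leq\pi$ (and $\varphi=0$ if $s=0$), $w^{1/n}$ denotes $s^{1/n}e^{i\varphi/n}$, where $s^{1/n}$ is the non-negative real $n$-th root; $\sqrt{w}=w^{1/2}$. For a positive integer $n\ge 2$ and a non-negative integer $r$, $X_{n,r}(x)={}_2F_1(-r,-r-1/n;1-1/n;x)$, a polynomial of degree $r$ with rational coefficients (${}_2F_1$ is the classical Gauss hypergeometric function). $D_{n,r}$ is the smallest positive integer such that $D_{n,r}X_{n,r}(x)$ has rational integer coefficients. For a positive integer $d$, $N_{d,n,r}$ is the greatest common divisor of the numerators (in lowest terms) of the coefficients of the polynomial $X_{n,r}(1-dx)$. With $v_p$ the $p$-adic valuation, $\mathcal{N}_{d,n}=\prod_{p\mid n}p^{\min(v_p(d),\,v_p(n)+1/(p-1))}$, the product over primes $p$ dividing $n$. It is understood that $g\neq0$, $U(x)\neq 0$, $U(x)\neq Z(x)$ (so that $W(x)$ and $d$ are defined) and that the denominator of $\mathcal{A}(x)$ is non-zero. *)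

theory Defs
  imports
    "HOL-Algebra.Generated_Fields"
    "HOL-Algebra.Algebraic_Closure_Type"
    "HOL-Analysis.Analysis"
    "HOL-Computational_Algebra.Computational_Algebra"
begin

section \<open>Subfields of the complex numbers\<close>

abbreviation complex_field :: "complex ring" where
  "complex_field \<equiv> ring_of_type_algebra"

definition adjoin :: "complex set \<Rightarrow> complex \<Rightarrow> complex set" where
  "adjoin K z = generate_field complex_field (insert z K)"

definition ext_degree :: "complex set \<Rightarrow> complex set \<Rightarrow> nat \<Rightarrow> bool" where
  "ext_degree K L m \<longleftrightarrow> ring.dimension complex_field m K L"

definition imaginary_quadratic :: "complex set \<Rightarrow> bool" where
  "imaginary_quadratic K \<longleftrightarrow>
     subfield K complex_field \<and> ext_degree \<rat> K 2 \<and> \<not> K \<subseteq> \<real>"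

text \<open>
  \<open>w\<close> is a root of the minimal polynomial of \<open>z\<close> over \<open>K\<close>, and is the root other than \<open>z\<close>
  unless \<open>z \<in> K\<close>. If \<open>z\<close> has degree at most 2 over \<open>K\<close>, this determines \<open>w\<close>, and
  \<open>w = z\<close> if \<open>z \<in> K\<close>.
\<close>
definition conjugate_over :: "complex set \<Rightarrow> complex \<Rightarrow> complex \<Rightarrow> bool" where
  "conjugate_over K z w \<longleftrightarrow>
     ring.eval complex_field (ring.Irr complex_field K z) w = 0 \<and> (z \<notin> K \<longrightarrow> w \<noteq> z)"

section \<open>Principal roots\<close>

text \<open>The library's \<^const>\<open>Arg\<close> takes values in \<open>]-\<pi>, \<pi>]\<close> and is \<open>0\<close> at \<open>0\<close>.\<close>
definition croot :: "nat \<Rightarrow> complex \<Rightarrow> complex" where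
  "croot n w = rcis (root n (cmod w)) (Arg w / real n)"

lemma croot_eq_powr:
  assumes "n > 0"
  shows "croot n w = w powr (1 / of_nat n)"
proof (cases "w = 0")
  case True
  then show ?thesis by (simp add: croot_def)
next
  case False
  have "Ln w / of_nat n = complex_of_real (ln (cmod w) / n) + \<i> * of_real (Arg w / n)"
    using False by (simp add: Arg_eq_Im_Ln complex_eq_iff)
  then have "w powr (1 / of_nat n) = exp (complex_of_real (ln (cmod w) / n) + \<i> * of_real (Arg w / n))"
    using False by (simp only: powr_def) simp
  also have "\<dots> = complex_of_real (exp (ln (cmod w) / n)) * cis (Arg w / n)"
    by (simp only: exp_add exp_of_real cis_conv_exp)
  also have "exp (ln (cmod w) / n) = root n (cmod w)"
    using False assms by (simp add: root_powr_inverse powr_def field_simps)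
  finally show ?thesis by (simp add: croot_def rcis_def)
qed

lemma croot_2: "croot 2 w = csqrt w"
proof (cases "w = 0")
  case False
  then show ?thesis by (simp add: croot_eq_powr powr_def csqrt_exp_Ln)
qed (simp add: croot_def)

section \<open>The hypergeometric polynomials\<close>

definition X_poly :: "nat \<Rightarrow> nat \<Rightarrow> rat poly" where
  "X_poly n r = truncate_fps (Suc r)
     (fps_hypergeo [- of_nat r, - of_nat r - 1 / of_nat n] [1 - 1 / of_nat n] 1)"

text \<open>The truncation only changes the type: the series terminates.\<close>
lemma fps_of_poly_X_poly:
  "fps_of_poly (X_poly n r) =
     fps_hypergeo [- of_nat r, - of_nat r - 1 / of_nat n] [1 - 1 / of_nat n] 1"
  by (rule fps_ext)
     (auto simp: X_poly_def coeff_truncate_fps pochhammer_of_nat_eq_0_lemma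
           simp del: of_nat_Suc)

definition D_num :: "nat \<Rightarrow> nat \<Rightarrow> nat" where
  "D_num n r = (LEAST D. D > 0 \<and> (\<forall>i. coeff (smult (of_nat D) (X_poly n r)) i \<in> \<int>))"

definition N_num :: "nat \<Rightarrow> nat \<Rightarrow> nat \<Rightarrow> int" where
  "N_num d n r = (let P = pcompose (X_poly n r) [:1, - of_nat d:]
     in Gcd ((\<lambda>i. fst (quotient_of (coeff P i))) ` {..degree P}))"

definition N_cal :: "nat \<Rightarrow> nat \<Rightarrow> real" where
  "N_cal d n = (\<Prod>p\<in>prime_factors n. real p powr
     min (real (multiplicity p d)) (real (multiplicity p n) + 1 / (real p - 1)))"

end

theory Submission
  imports Defs "Jordan_Normal_Form.Char_Poly" "HOL-Complex_Analysis.Complex_Analysis"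
begin

text \<open>
  Let \<open>X\<^sub>r\<close> be the hypergeometric polynomial and \<open>Y\<^sub>r(z) = z\<^sup>r X\<^sub>r(1/z)\<close>. Then \<open>X\<^sub>r(W) / Y\<^sub>r(W)\<close> is a
  Pade approximation of \<open>W\<^bsup>1/n\<^esup>\<close>, and replacing \<open>W\<^bsup>1/n\<^esup>\<close> by it in the definition of \<open>A\<close> gives, after scaling by
  \<open>h\<^sub>r (D\<^sub>r / N\<^sub>r) (U / g)\<^sup>r\<close>, algebraic integers \<open>p\<^sub>r\<close>, \<open>q\<^sub>r\<close> such that \<open>|q\<^sub>r|\<close> grows like \<open>Q\<^sup>r\<close> and
  \<open>|q\<^sub>r A - p\<^sub>r|\<close> decays like \<open>E\<^bsup>-r\<^esup>\<close>. Conjugation over \<open>K\<close> interchanges \<open>Z\<close> and \<open>-U\<close>, hence sends a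
  \<open>K\<close>-combination \<open>v\<close> of \<open>p\<^sub>r\<close>, \<open>q\<^sub>r\<close> to \<open>v\<close> or \<open>-v\<close>; so \<open>v\<^sup>2\<close> is an algebraic integer in \<open>K\<close>, and \<open>|v| \<ge> 1\<close>
  unless \<open>v = 0\<close>. For given \<open>p, q\<close> this applies to \<open>v = q p\<^sub>r - p q\<^sub>r\<close>, which is non-zero for one of any two
  consecutive \<open>r\<close> because the determinants \<open>p\<^sub>r q\<^sub>r\<^sub>+\<^sub>1 - p\<^sub>r\<^sub>+\<^sub>1 q\<^sub>r\<close> do not vanish; choosing \<open>r\<close> minimal with
  \<open>|q| |q\<^sub>r A - p\<^sub>r| \<le> 1/2\<close> gives the bound. Since \<open>|\<tau>| \<ge> 1\<close>, the factor \<open>|\<surd>\<tau>|\<close> in \<open>c\<close> only weakens it.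
\<close>

section \<open>Algebraic integers\<close>

text \<open>For \<open>\<beta>\<^sub>1\<close> in \<open>K\<close> no automorphism over
  \<open>K\<close> exchanges \<open>\<beta>\<^sub>1\<close> and \<open>\<beta>\<^sub>2\<close>;
  conjugation is therefore treated as a relation, so that one algebraic argument serves both
  degrees. Powers of W are written through L = Ln W, which turns them into entire exponentials, so
  no branch cut meets the path of integration. On the segment from 0 to L the base of the r-th power
  in the integrand is largest in modulus at L/2: this is how the square roots of U and Z enter E and
  Q. The obstacle is the real case with W near 0, where both the bound for \<open>hypY\<close> and
  the comparison of |log W| with |1 - W^(1/n)| break down. A bound W \<ge> 1/36 is extracted from
  the arithmetic hypotheses. The 4 in \<open>c\<close> is 2 times 2: one factor bounds
  \<open>hypX\<close> and \<open>hypY\<close>, the other comes from keeping the remainder below half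
  of a quantity of modulus at least 1. The 5 is 2 times 5/2, where 5/2 compares |log W| / n with |1
  - W^(1/n)|.\<close>

lemma algebraic_int_if_int_eigenvector:
  fixes x :: complex and v :: "nat \<Rightarrow> complex" and M :: "nat \<Rightarrow> nat \<Rightarrow> int"
  assumes eq: "\<And>i. i < N \<Longrightarrow> x * v i = (\<Sum>j<N. of_int (M i j) * v j)"
    and nz: "k < N" "v k \<noteq> 0"
  shows "algebraic_int x"
proof -
  define A where "A = mat N N (\<lambda>(i,j). M i j)"
  have A: "A \<in> carrier_mat N N" by (simp add: A_def)
  let ?A = "map_mat (of_int :: int \<Rightarrow> complex) A"
  have A': "?A \<in> carrier_mat N N" using A by simp
  have "eigenvector ?A (vec N v) x"
    unfolding eigenvector_def
  proof (intro conjI)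
    show "vec N v \<in> carrier_vec (dim_row ?A)" using A' by simp
    have "vec N v $ k \<noteq> 0\<^sub>v N $ k" using nz by simp
    then show "vec N v \<noteq> 0\<^sub>v (dim_row ?A)" using A' by auto
    show "?A *\<^sub>v vec N v = x \<cdot>\<^sub>v vec N v"
      by (rule eq_vecI) (auto simp: A_def scalar_prod_def eq lessThan_atLeast0)
  qed
  then have "eigenvalue ?A x" by (auto simp: eigenvalue_def)
  then have "poly (char_poly ?A) x = 0" using eigenvalue_root_char_poly[OF A'] by simp
  then have "poly (map_poly of_int (char_poly A)) x = 0"
    by (simp add: of_int_hom.char_poly_hom[OF A])
  moreover have "lead_coeff (char_poly A) = 1" using degree_monic_char_poly[OF A] by simp
  ultimately show ?thesis unfolding algebraic_int_altdef_ipoly by blast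
qed

lemma algebraic_int_power_recurrence:
  fixes x :: complex
  assumes "algebraic_int x"
  obtains m c where "m > 0" "x ^ m = (\<Sum>i<m. of_int (c i) * x ^ i)"
proof -
  obtain p where p: "poly (map_poly of_int p) x = 0" "lead_coeff p = 1"
    using assms unfolding algebraic_int_altdef_ipoly by blast
  have deg: "degree p > 0"
  proof (rule ccontr)
    assume "\<not> degree p > 0"
    then obtain a where "p = [:a:]" by (auto elim: degree_eq_zeroE)
    then show False using p by simp
  qed
  have "poly (map_poly of_int p) x = (\<Sum>i\<le>degree p. of_int (coeff p i) * x ^ i)"
    by (simp add: poly_altdef)
  also have "\<dots> = x ^ degree p + (\<Sum>i<degree p. of_int (coeff p i) * x ^ i)"
    using p(2) by (simp add: lessThan_Suc_atMost[symmetric])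
  finally have "x ^ degree p = (\<Sum>i<degree p. of_int (- coeff p i) * x ^ i)"
    using p(1) by (simp add: sum_negf eq_neg_iff_add_eq_0)
  with deg show ?thesis by (rule that)
qed

lemma sum_nat_pairs: "(\<Sum>t<m*k. f (t div k) (t mod k)) = (\<Sum>i<m. \<Sum>j<(k::nat). f i j)"
proof (cases "k = 0")
  case False
  have "(\<Sum>t<m*k. f (t div k) (t mod k)) = (\<Sum>(i,j)\<in>{..<m}\<times>{..<k}. f i j)"
    by (rule sum.reindex_bij_witness[of _ "\<lambda>(i,j). i * k + j" "\<lambda>t. (t div k, t mod k)"])
       (use False in \<open>auto simp: less_mult_imp_div_less intro: less_mult_imp_div_less
          , metis (no_types, lifting) add.commute add_less_cancel_left less_le_trans mult.commute mult_Suc mult_le_mono1 Suc_leI\<close>)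
  then show ?thesis by (simp add: sum.cartesian_product)
qed auto

text \<open>The monomials \<open>x\<^sup>i y\<^sup>j\<close> with \<open>i < m\<close>, \<open>j < k\<close> span a module over the integers that is stable
  under multiplication by \<open>x\<close> and by \<open>y\<close>, hence by \<open>x + y\<close> and \<open>x y\<close>.\<close>

lemma algebraic_int_if_stable:
  fixes x y z :: complex
  assumes m: "m > 0" and k: "k > 0"
    and M: "\<And>i j. i < m \<Longrightarrow> j < k \<Longrightarrow>
       \<exists>M. z * (x ^ i * y ^ j) = (\<Sum>a<m. \<Sum>b<k. of_int (M a b) * (x ^ a * y ^ b))"
  shows "algebraic_int z"
proof -
  define v where "v t = x ^ (t div k) * y ^ (t mod k)" for t
  define M' where "M' t = (SOME M. z * v t = (\<Sum>a<m. \<Sum>b<k. of_int (M a b) * (x ^ a * y ^ b)))" for t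
  show ?thesis
  proof (rule algebraic_int_if_int_eigenvector[of "m * k" z v "\<lambda>t s. M' t (s div k) (s mod k)" 0])
    fix t assume t: "t < m * k"
    have "\<exists>M. z * v t = (\<Sum>a<m. \<Sum>b<k. of_int (M a b) * (x ^ a * y ^ b))"
      unfolding v_def by (rule M) (use t k in \<open>auto simp: less_mult_imp_div_less\<close>)
    from someI_ex[OF this]
    have "z * v t = (\<Sum>a<m. \<Sum>b<k. of_int (M' t a b) * (x ^ a * y ^ b))"
      unfolding M'_def .
    also have "\<dots> = (\<Sum>s<m*k. of_int (M' t (s div k) (s mod k)) * v s)"
      unfolding v_def by (rule sum_nat_pairs[symmetric])
    finally show "z * v t = (\<Sum>s<m*k. of_int (M' t (s div k) (s mod k)) * v s)" .
  qed (use m k in \<open>auto simp: v_def\<close>)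
qed

context
  fixes x y :: complex and m k :: nat and c e :: "nat \<Rightarrow> int"
  assumes m: "m > 0" "x ^ m = (\<Sum>i<m. of_int (c i) * x ^ i)"
    and k: "k > 0" "y ^ k = (\<Sum>i<k. of_int (e i) * y ^ i)"
begin

definition int_span :: "complex set" where
  "int_span = {z. \<exists>M. z = (\<Sum>a<m. \<Sum>b<k. of_int (M a b) * (x ^ a * y ^ b))}"

lemma int_span_add: "u \<in> int_span \<Longrightarrow> v \<in> int_span \<Longrightarrow> u + v \<in> int_span"
proof -
  assume "u \<in> int_span" "v \<in> int_span"
  then obtain M M' where "u = (\<Sum>a<m. \<Sum>b<k. of_int (M a b) * (x ^ a * y ^ b))"
     "v = (\<Sum>a<m. \<Sum>b<k. of_int (M' a b) * (x ^ a * y ^ b))" unfolding int_span_def by blast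
  then have "u + v = (\<Sum>a<m. \<Sum>b<k. of_int (M a b + M' a b) * (x ^ a * y ^ b))"
    by (simp add: sum.distrib ring_distribs)
  then show ?thesis unfolding int_span_def by (intro CollectI exI)
qed

lemma int_span_scale: "u \<in> int_span \<Longrightarrow> of_int q * u \<in> int_span"
proof -
  assume "u \<in> int_span"
  then obtain M where "u = (\<Sum>a<m. \<Sum>b<k. of_int (M a b) * (x ^ a * y ^ b))"
    unfolding int_span_def by blast
  then have "of_int q * u = (\<Sum>a<m. \<Sum>b<k. of_int (q * M a b) * (x ^ a * y ^ b))"
    by (simp add: sum_distrib_left mult_ac)
  then show ?thesis unfolding int_span_def by (intro CollectI exI)
qed

lemma int_span_sum: "(\<And>i. i \<in> I \<Longrightarrow> f i \<in> int_span) \<Longrightarrow> sum f I \<in> int_span"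
proof (induction I rule: infinite_finite_induct)
  case (insert i I) then show ?case by (simp add: int_span_add)
qed (auto simp: int_span_def intro!: exI[of _ "\<lambda>_ _. 0"])

lemma int_span_mono: assumes "a < m" "b < k" shows "x ^ a * y ^ b \<in> int_span"
proof -
  have "(\<Sum>i<m. \<Sum>j<k. of_int (if i = a \<and> j = b then 1 else 0) * (x ^ i * y ^ j))
      = (\<Sum>i<m. \<Sum>j<k. if i = a then if j = b then x ^ a * y ^ b else 0 else 0)"
    by (intro sum.cong refl) simp
  also have "\<dots> = (\<Sum>i<m. if i = a then \<Sum>j<k. if j = b then x ^ a * y ^ b else 0 else 0)"
    by (intro sum.cong refl) simp
  also have "\<dots> = x ^ a * y ^ b" using assms by simp
  finally show ?thesis unfolding int_span_def mem_Collect_eq by (intro exI) (erule sym)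
qed

lemma int_span_mult_x: assumes "u \<in> int_span" shows "x * u \<in> int_span"
proof -
  from assms obtain M where u: "u = (\<Sum>a<m. \<Sum>b<k. of_int (M a b) * (x ^ a * y ^ b))"
    unfolding int_span_def by blast
  have "x * u = (\<Sum>a<m. \<Sum>b<k. of_int (M a b) * (x ^ Suc a * y ^ b))"
    by (simp add: u sum_distrib_left mult_ac)
  also have "\<dots> \<in> int_span"
  proof (intro int_span_sum int_span_scale)
    fix a b assume ab: "a \<in> {..<m}" "b \<in> {..<k}"
    show "x ^ Suc a * y ^ b \<in> int_span"
    proof (cases "Suc a < m")
      case True then show ?thesis using ab by (auto intro!: int_span_mono simp del: power_Suc)
    next
      case False
      then have "Suc a = m" using ab by simp
      \<comment> \<open>The exponent has left the range below \<open>m\<close>; the monic relation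
        for \<open>x ^ m\<close> brings it back with integer coefficients.\<close>
      then have "x ^ Suc a * y ^ b = (\<Sum>i<m. of_int (c i) * (x ^ i * y ^ b))"
        by (simp only: m(2) sum_distrib_right mult.assoc)
      then show ?thesis using ab by (auto intro!: int_span_sum int_span_scale int_span_mono)
    qed
  qed
  finally show ?thesis .
qed

lemma int_span_mult_y: assumes "u \<in> int_span" shows "y * u \<in> int_span"
proof -
  from assms obtain M where u: "u = (\<Sum>a<m. \<Sum>b<k. of_int (M a b) * (x ^ a * y ^ b))"
    unfolding int_span_def by blast
  have "y * u = (\<Sum>a<m. \<Sum>b<k. of_int (M a b) * (x ^ a * y ^ Suc b))"
    by (simp add: u sum_distrib_left mult_ac)
  also have "\<dots> \<in> int_span"
  proof (intro int_span_sum int_span_scale)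
    fix a b assume ab: "a \<in> {..<m}" "b \<in> {..<k}"
    show "x ^ a * y ^ Suc b \<in> int_span"
    proof (cases "Suc b < k")
      case True then show ?thesis using ab by (auto intro!: int_span_mono simp del: power_Suc)
    next
      case False
      then have "Suc b = k" using ab by simp
      then have "x ^ a * y ^ Suc b = (\<Sum>i<k. of_int (e i) * (x ^ a * y ^ i))"
        by (simp only: k(2) sum_distrib_left) (simp add: mult_ac)
      then show ?thesis using ab by (auto intro!: int_span_sum int_span_scale int_span_mono)
    qed
  qed
  finally show ?thesis .
qed

lemma algebraic_int_add_mult_aux: "algebraic_int (x + y)" "algebraic_int (x * y)"
proof -
  have "(x + y) * (x ^ i * y ^ j) \<in> int_span" "(x * y) * (x ^ i * y ^ j) \<in> int_span"
    if "i < m" "j < k" for i j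
    using int_span_mono[OF that] by (simp_all add: ring_distribs int_span_add int_span_mult_x int_span_mult_y mult.assoc)
  then show "algebraic_int (x + y)" "algebraic_int (x * y)"
    unfolding int_span_def by (intro algebraic_int_if_stable[OF m(1) k(1)]; blast)+
qed

end

lemma algebraic_int_add:
  fixes x y :: complex
  assumes "algebraic_int x" "algebraic_int y"
  shows "algebraic_int (x + y)"
  proof -
  obtain m c where m: "m > 0" "x ^ m = (\<Sum>i<m. of_int (c i) * x ^ i)"
    by (rule algebraic_int_power_recurrence[OF assms(1)])
  obtain k e where k: "k > 0" "y ^ k = (\<Sum>i<k. of_int (e i) * y ^ i)"
    by (rule algebraic_int_power_recurrence[OF assms(2)])
  show ?thesis by (rule algebraic_int_add_mult_aux(1)[OF m k])
qed

lemma algebraic_int_mult: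
  fixes x y :: complex
  assumes "algebraic_int x" "algebraic_int y"
  shows "algebraic_int (x * y)"
  proof -
  obtain m c where m: "m > 0" "x ^ m = (\<Sum>i<m. of_int (c i) * x ^ i)"
    by (rule algebraic_int_power_recurrence[OF assms(1)])
  obtain k e where k: "k > 0" "y ^ k = (\<Sum>i<k. of_int (e i) * y ^ i)"
    by (rule algebraic_int_power_recurrence[OF assms(2)])
  show ?thesis by (rule algebraic_int_add_mult_aux(2)[OF m k])
qed

lemma algebraic_int_diff:
  fixes x y :: complex
  shows "algebraic_int x \<Longrightarrow> algebraic_int y \<Longrightarrow> algebraic_int (x - y)"
  using algebraic_int_add[of x "- y"] by simp

lemma algebraic_int_power:
  fixes x :: complex
  shows "algebraic_int x \<Longrightarrow> algebraic_int (x ^ k)"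
  by (induction k) (auto intro: algebraic_int_mult int_imp_algebraic_int)

lemma algebraic_int_sum:
  fixes f :: "'a \<Rightarrow> complex"
  shows "(\<And>i. i \<in> I \<Longrightarrow> algebraic_int (f i)) \<Longrightarrow> algebraic_int (sum f I)"
  by (induction I rule: infinite_finite_induct) (auto intro: algebraic_int_add)

section \<open>Quadratic extensions of subfields of the complex numbers\<close>

interpretation cf: domain complex_field
  by (rule field.axioms(1), rule field_from_type_algebra)

lemma complex_field_simps [simp]:
  "carrier complex_field = UNIV" "\<zero>\<^bsub>complex_field\<^esub> = 0" "\<one>\<^bsub>complex_field\<^esub> = 1"
  "x \<otimes>\<^bsub>complex_field\<^esub> y = x * y" "x \<oplus>\<^bsub>complex_field\<^esub> y = x + y"
  by (simp_all add: ring_of_type_algebra_def)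

lemma a_inv_complex_field [simp]: "\<ominus>\<^bsub>complex_field\<^esub> x = - x"
proof -
  have "\<ominus>\<^bsub>complex_field\<^esub> x \<oplus>\<^bsub>complex_field\<^esub> x = \<zero>\<^bsub>complex_field\<^esub>"
    by (rule cf.l_neg) simp
  then show ?thesis by (simp add: eq_neg_iff_add_eq_0)
qed

lemma m_inv_complex_field: "x \<noteq> 0 \<Longrightarrow> inv\<^bsub>complex_field\<^esub> x = inverse x"
  by (rule cf.comm_inv_char) auto

lemma subfield_complexD:
  assumes "subfield K complex_field"
  shows "0 \<in> K" "1 \<in> K" "u \<in> K \<Longrightarrow> v \<in> K \<Longrightarrow> u + v \<in> K" "u \<in> K \<Longrightarrow> v \<in> K \<Longrightarrow> u * v \<in> K"
    "u \<in> K \<Longrightarrow> - u \<in> K" "u \<in> K \<Longrightarrow> v \<in> K \<Longrightarrow> u - v \<in> K" "u \<in> K \<Longrightarrow> inverse u \<in> K"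
    "u \<in> K \<Longrightarrow> v \<in> K \<Longrightarrow> u / v \<in> K"
proof -
  have sr: "subring K complex_field" using assms by (simp add: subfieldE)
  show z: "0 \<in> K" using subringE(2)[OF sr] by simp
  show "1 \<in> K" using subringE(3)[OF sr] by simp
  show "u \<in> K \<Longrightarrow> v \<in> K \<Longrightarrow> u + v \<in> K" for u v using subringE(7)[OF sr, of u v] by simp
  show m: "u \<in> K \<Longrightarrow> v \<in> K \<Longrightarrow> u * v \<in> K" for u v using subringE(6)[OF sr, of u v] by simp
  show "u \<in> K \<Longrightarrow> - u \<in> K" for u using subringE(5)[OF sr, of u] by simp
  then show "u \<in> K \<Longrightarrow> v \<in> K \<Longrightarrow> u - v \<in> K" for u v
    using subringE(7)[OF sr, of u "- v"] by simp
  show i: "u \<in> K \<Longrightarrow> inverse u \<in> K" for u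
    using cf.subfield_m_inv(1)[OF assms, of u] z m_inv_complex_field[of u] by (cases "u = 0") auto
  show "u \<in> K \<Longrightarrow> v \<in> K \<Longrightarrow> u / v \<in> K" for u v
    using i m by (simp add: divide_inverse)
qed

lemma subfield_complexI:
  assumes "0 \<in> K" "1 \<in> K" "\<And>u v. u \<in> K \<Longrightarrow> v \<in> K \<Longrightarrow> u + v \<in> K" "\<And>u v. u \<in> K \<Longrightarrow> v \<in> K \<Longrightarrow> u * v \<in> K"
    "\<And>u. u \<in> K \<Longrightarrow> - u \<in> K" "\<And>u. u \<in> K \<Longrightarrow> inverse u \<in> K"
  shows "subfield K complex_field"
proof (rule field.subfieldI'[OF field_from_type_algebra])
  show "subring K complex_field"
    by (rule cf.subringI) (use assms in auto)
  show "inv\<^bsub>complex_field\<^esub> k \<in> K" if "k \<in> K - {\<zero>\<^bsub>complex_field\<^esub>}" for k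
    using that assms m_inv_complex_field[of k] by simp
qed

lemma subfield_Rats: "subfield (\<rat> :: complex set) complex_field"
  by (rule subfield_complexI) auto

lemma Rats_subset_subfield:
  assumes "subfield K complex_field"
  shows "\<rat> \<subseteq> K"
proof
  note K = subfield_complexD[OF assms]
  have nat: "of_nat m \<in> K" for m by (induction m) (auto intro: K)
  have int: "of_int m \<in> K" for m by (cases m rule: int_cases2) (auto intro: K nat)
  fix q :: complex assume "q \<in> \<rat>"
  then obtain a b where "q = of_int a / of_int b" by (metis Rats_cases')
  then show "q \<in> K" using int by (auto intro: K)
qed

lemma subfield_adjoin: "subfield (adjoin K z) complex_field" "K \<subseteq> adjoin K z" "z \<in> adjoin K z"
  using field.generate_field_is_subfield[OF field_from_type_algebra, of "insert z K"] field.generate_field_incl[OF field_from_type_algebra, of "insert z K"]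
  by (auto simp: adjoin_def intro: generate_field.incl)

lemma adjoin_minimal:
  assumes "subfield F complex_field" "K \<subseteq> F" "z \<in> F"
  shows "adjoin K z \<subseteq> F"
  using field.generate_field_min_subfield1[OF field_from_type_algebra _ assms(1), of "insert z K"] assms by (auto simp: adjoin_def)

lemma line_extension_complex:
  "v \<in> cf.line_extension K u E \<longleftrightarrow> (\<exists>k\<in>K. \<exists>e\<in>E. v = k * u + e)"
  using cf.line_extension_mem_iff[of v K u E] by simp

section \<open>Extensions of degree two and their conjugates\<close>

lemma ext_degree_2_basis:
  assumes K: "subfield K complex_field" and L: "subfield L complex_field" "K \<subseteq> L"
    and deg: "ext_degree K L 2" and u: "u \<in> L" "u \<notin> K" and v: "v \<in> L"
  obtains a b where "a \<in> K" "b \<in> K" "v = a + b * u"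
proof -
  have S1: "w \<in> cf.Span K [1] \<longleftrightarrow> w \<in> K" for w
    by (auto simp: line_extension_complex subfield_complexD[OF K])
  have ind: "cf.independent K [u, 1]"
    by (intro cf.li_Cons cf.li_Nil) (use u S1 in auto)
  have "cf.Span K [u, 1] = L"
    using cf.independent_length_eq_dimension[OF K deg[unfolded ext_degree_def] ind] u
      subfield_complexD[OF L(1)] by auto
  then have "v \<in> cf.line_extension K u (cf.Span K [1])" using v by simp
  then obtain k e where "k \<in> K" "e \<in> K" "v = k * u + e"
    unfolding line_extension_complex by (auto simp: S1 simp del: cf.Span.simps)
  then show ?thesis using that[of e k] by (simp add: add.commute)
qed

text \<open>Dimension 0 would give \<open>L = {0}\<close>, and in dimension 1 the vector 1 already
  spans, which would give \<open>L = K\<close>.\<close>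

lemma ext_degree_le_2:
  assumes K: "subfield K complex_field" and L: "subfield L complex_field" "K \<subseteq> L"
    and deg: "ext_degree K L m" "m \<le> 2" and u: "u \<in> L" "u \<notin> K"
  shows "m = 2"
proof -
  consider "m = 0" | "m = 1" | "m = 2" using deg(2) by linarith
  then show ?thesis
  proof cases
    case 1
    then have "L = {0}" using cf.dimension_zero[OF K, of L] deg by (simp add: ext_degree_def)
    then show ?thesis using subfield_complexD(2)[OF L(1)] by simp
  next
    case 2
    have "cf.independent K [1]"
      by (intro cf.li_Cons cf.li_Nil) auto
    then have "cf.Span K [1] = L"
      using cf.independent_length_eq_dimension[OF K deg(1)[unfolded ext_degree_def], of "[1]"] 2
        subfield_complexD[OF L(1)] by simp
    moreover have "w \<in> cf.Span K [1] \<longleftrightarrow> w \<in> K" for w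
      by (auto simp: line_extension_complex subfield_complexD[OF K])
    ultimately show ?thesis using u by blast
  qed
qed

text \<open>The minimal polynomial of \<open>z\<close> divides \<open>p\<close>, and evaluation at
  \<open>w\<close> is a ring homomorphism. Polynomials are coefficient lists with the leading
  coefficient first, hence the condition on \<open>hd p\<close>.\<close>

lemma conjugate_over_root:
  assumes K: "subfield K complex_field" and p: "p \<noteq> []" "set p \<subseteq> K" "hd p \<noteq> 0"
    and z: "cf.eval p z = 0" and w: "conjugate_over K z w"
  shows "cf.eval p w = 0"
proof -
  have pK: "p \<in> carrier (univ_poly complex_field K)"
    using p by (simp add: univ_poly_def polynomial_def)
  have alg: "(cf.algebraic over K) z"
    using cf.algebraicI[OF pK p(1), of z] z by simp
  have "(cf.Irr K z) divides\<^bsub>univ_poly complex_field (carrier complex_field)\<^esub> p"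
    using cf.Irr_minimal[OF K _ alg pK] z by (simp add: pdivides_def)
  then obtain q where q: "q \<in> carrier (univ_poly complex_field (carrier complex_field))"
    "p = cf.Irr K z \<otimes>\<^bsub>univ_poly complex_field (carrier complex_field)\<^esub> q"
    unfolding factor_def by auto
  have I: "cf.Irr K z \<in> carrier (univ_poly complex_field (carrier complex_field))"
    using cf.carrier_polynomial_shell[OF subfieldE(1)[OF K] cf.IrrE(1)[OF K _ alg]] by simp
  interpret h: ring_hom_ring "univ_poly complex_field (carrier complex_field)" complex_field "\<lambda>p. cf.eval p w"
    using cf.eval_ring_hom[OF cf.carrier_is_subring, of w] by simp
  have "cf.eval p w = cf.eval (cf.Irr K z) w * cf.eval q w"
    using h.hom_mult[OF I q(1)] q(2) by simp
  then show ?thesis using w by (simp add: conjugate_over_def)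
qed

text \<open>Both \<open>z\<close> and \<open>w\<close> are roots of X^2 - s X + t and they differ,
  so their sum is the trace \<open>s\<close>.\<close>

lemma conjugate_over_quadratic:
  assumes K: "subfield K complex_field" and st: "s \<in> K" "t \<in> K" "z * z = s * z - t" "z \<notin> K"
    and w: "conjugate_over K z w"
  shows "w = s - z"
proof -
  have "cf.eval [1, - s, t] w = 0"
    by (rule conjugate_over_root[OF K _ _ _ _ w])
       (use st subfield_complexD[OF K] in \<open>auto simp: numeral_2_eq_2 algebra_simps\<close>)
  then have "w * w - s * w + t = 0" by (simp add: numeral_2_eq_2 algebra_simps)
  moreover have "(w - z) * (w + z - s) = (w * w - s * w + t) - (z * z - (s * z - t))"
    by (simp add: algebra_simps)
  ultimately have "(w - z) * (w + z - s) = 0" using st(3) by simp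
  moreover have "w \<noteq> z" using w st by (auto simp: conjugate_over_def)
  ultimately have "w + z - s = 0" by simp
  then show ?thesis by (simp add: algebra_simps)
qed

lemma conjugate_over_self:
  assumes K: "subfield K complex_field" and z: "z \<in> K" and w: "conjugate_over K z w"
  shows "w = z"
proof -
  have "cf.eval [1, - z] w = 0"
    by (rule conjugate_over_root[OF K _ _ _ _ w])
       (use z subfield_complexD[OF K] in auto)
  then show ?thesis by simp
qed

text \<open>Any non-real \<open>u\<close> in \<open>K\<close> generates \<open>K\<close> over the
  rationals and satisfies a rational quadratic equation, whose other root is the complex conjugate
  of \<open>u\<close>. Complex conjugation is thus the non-trivial automorphism of \<open>K\<close>,
  and \<open>z * cnj z\<close> is the norm.\<close>

lemma imaginary_quadratic_norm:
  assumes "imaginary_quadratic K" "z \<in> K"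
  shows "z * cnj z \<in> \<rat>"
proof -
  have K: "subfield K complex_field" "ext_degree \<rat> K 2" "\<not> K \<subseteq> \<real>"
    using assms(1) by (auto simp: imaginary_quadratic_def)
  obtain u where u: "u \<in> K" "u \<notin> \<real>" using K(3) by blast
  have uQ: "u \<notin> \<rat>"
    using u(2) by (auto elim!: Rats_cases')
  note basis = ext_degree_2_basis[OF subfield_Rats K(1) Rats_subset_subfield[OF K(1)] K(2) u(1) uQ]
  obtain a b where ab: "a \<in> \<rat>" "b \<in> \<rat>" "u * u = a + b * u"
    using basis[of "u * u"] subfield_complexD(4)[OF K(1) u(1) u(1)] by blast
  obtain c d where cd: "c \<in> \<rat>" "d \<in> \<rat>" "z = c + d * u"
    using basis[OF assms(2)] by blast
  have real: "cnj q = q" if "q \<in> \<rat>" for q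
    using that by (auto elim!: Rats_cases')
  have cu: "cnj u * cnj u = a + b * cnj u"
    using arg_cong[OF ab(3), of cnj] by (simp add: real[OF ab(1)] real[OF ab(2)])
  have "(u - cnj u) * (u + cnj u - b) = (u * u - b * u) - (cnj u * cnj u - b * cnj u)"
    by (simp add: algebra_simps)
  also have "\<dots> = 0" by (simp add: ab(3) cu)
  finally have "u + cnj u - b = 0" using u(2) by (auto simp: Reals_cnj_iff)
  then have cnju: "cnj u = b - u" by (simp add: algebra_simps)
  have "z * cnj z = (c + d * u) * (c + d * (b - u))"
    using cd by (simp add: real cnju)
  also have "\<dots> = c * c + c * d * b + d * d * (b * u - u * u)" by (simp add: algebra_simps)
  also have "\<dots> = c * c + c * d * b - d * d * a" by (simp add: ab(3))
  also have "\<dots> \<in> \<rat>" using ab cd by auto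
  finally show ?thesis .
qed

text \<open>The squared modulus is a rational algebraic integer, hence a positive rational integer.
  This discreteness is what the choice of \<open>K\<close> provides.\<close>

lemma algebraic_int_norm_ge_1:
  assumes K: "K = \<rat> \<or> imaginary_quadratic K" and z: "algebraic_int z" "z \<in> K" "z \<noteq> 0"
  shows "cmod z \<ge> 1"
proof -
  have "z * cnj z \<in> \<rat>"
  proof (cases "K = \<rat>")
    case True
    then have "cnj z = z" using z(2) by (auto elim!: Rats_cases')
    then show ?thesis using True z by simp
  qed (use K z imaginary_quadratic_norm in auto)
  moreover have "algebraic_int (z * cnj z)" using z by (intro algebraic_int_mult) auto
  ultimately have "z * cnj z \<in> \<int>" by (rule rational_algebraic_int_is_int[rotated])
  then obtain k where "z * cnj z = of_int k" by (auto elim: Ints_cases)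
  then have "complex_of_real ((cmod z)\<^sup>2) = complex_of_real (of_int k)"
    by (simp only: complex_norm_square) simp
  then have k: "(cmod z)\<^sup>2 = of_int k" by (simp only: of_real_eq_iff)
  with z(3) have "k > 0" by (metis of_int_0_less_iff zero_less_norm_iff zero_less_power)
  then have "(cmod z)\<^sup>2 \<ge> 1" by (simp add: k)
  then show ?thesis by (simp add: power2_nonneg_ge_1_iff)
qed

text \<open>Meant for the combinations of the approximants and for \<open>csqrt \<tau>\<close>:
  these need not lie in \<open>K\<close>, but their squares do.\<close>

lemma algebraic_int_norm_ge_1_square:
  assumes K: "K = \<rat> \<or> imaginary_quadratic K" and z: "algebraic_int z" "z * z \<in> K" "z \<noteq> 0"
  shows "cmod z \<ge> 1"
proof -
  have "cmod (z * z) \<ge> 1"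
    using algebraic_int_norm_ge_1[OF K algebraic_int_mult[OF z(1) z(1)] z(2)] z by simp
  then have "(cmod z)\<^sup>2 \<ge> 1" by (simp add: norm_mult power2_eq_square)
  then show ?thesis by (simp add: power2_nonneg_ge_1_iff)
qed

text \<open>For \<open>b\<close> outside \<open>K\<close> with \<open>b * b = s * b - t\<close> this
  is the graph of the automorphism of K(b) over \<open>K\<close> that takes \<open>b\<close> to the
  other root \<open>s - b\<close>. Stated as a relation it requires no choice of coordinates
  \<open>u\<close>, \<open>v\<close>.\<close>

definition conj_pair :: "complex set \<Rightarrow> complex \<Rightarrow> complex \<Rightarrow> complex \<Rightarrow> complex \<Rightarrow> bool" where
  "conj_pair K s b z z' \<longleftrightarrow> (\<exists>u\<in>K. \<exists>v\<in>K. z = u + v * b \<and> z' = u + v * (s - b))"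

lemma conj_pairI:
  "u \<in> K \<Longrightarrow> v \<in> K \<Longrightarrow> z = u + v * b \<Longrightarrow> z' = u + v * (s - b) \<Longrightarrow> conj_pair K s b z z'"
  by (auto simp: conj_pair_def)

context
  fixes K :: "complex set" and s t b :: complex
  assumes K: "subfield K complex_field" and st: "s \<in> K" "t \<in> K" "b * b = s * b - t"
begin

lemma conj_pair_const: "k \<in> K \<Longrightarrow> conj_pair K s b k k"
  
    by (rule conj_pairI[of k _ 0]) (use subfield_complexD(1)[OF K] in \<open>auto\<close>)

lemma conj_pair_gen: "conj_pair K s b b (s - b)"
  
    by (rule conj_pairI[of 0 _ 1]) (use subfield_complexD(1,2)[OF K] in \<open>auto\<close>)

lemma conj_pair_sym:
  assumes "conj_pair K s b z z'" shows "conj_pair K s b z' z"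
proof -
  obtain u v where *: "u \<in> K" "v \<in> K" "z = u + v * b" "z' = u + v * (s - b)"
    using assms by (auto simp: conj_pair_def)
  show ?thesis 
    \<comment> \<open>The witnesses are the coordinates of \<open>z'\<close> with respect to 1 and
      \<open>b\<close>: u + v (s - b) = (u + v s) - v b.\<close>
    by (rule conj_pairI[of "u + v * s" _ "- v"]) (use * st subfield_complexD[OF K] in \<open>auto simp: algebra_simps\<close>)
qed

lemma conj_pair_add:
  assumes "conj_pair K s b z z'" "conj_pair K s b w w'" shows "conj_pair K s b (z + w) (z' + w')"
proof -
  obtain u v u' v' where *: "u \<in> K" "v \<in> K" "z = u + v * b" "z' = u + v * (s - b)"
    "u' \<in> K" "v' \<in> K" "w = u' + v' * b" "w' = u' + v' * (s - b)"
    using assms by (auto simp: conj_pair_def)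
  show ?thesis 
    by (rule conj_pairI[of "u + u'" _ "v + v'"]) (simp_all add: * subfield_complexD(3)[OF K] ring_distribs)
qed

lemma conj_pair_mult:
  assumes "conj_pair K s b z z'" "conj_pair K s b w w'" shows "conj_pair K s b (z * w) (z' * w')"
proof -
  obtain u v u' v' where *: "u \<in> K" "v \<in> K" "z = u + v * b" "z' = u + v * (s - b)"
    "u' \<in> K" "v' \<in> K" "w = u' + v' * b" "w' = u' + v' * (s - b)"
    using assms by (auto simp: conj_pair_def)
  have "z * w = u * u' + (u * v' + u' * v) * b + v * v' * (b * b)"
    by (simp add: * algebra_simps)
  also have "\<dots> = (u * u' - v * v' * t) + (u * v' + u' * v + v * v' * s) * b"
    by (simp add: st algebra_simps)
  finally have 1: "z * w = (u * u' - v * v' * t) + (u * v' + u' * v + v * v' * s) * b" .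
  have "z' * w' = u * u' + (u * v' + u' * v) * (s - b) + v * v' * (s * s - 2 * (s * b) + b * b)"
    by (simp add: * algebra_simps)
  also have "\<dots> = (u * u' - v * v' * t) + (u * v' + u' * v + v * v' * s) * (s - b)"
    by (simp add: st algebra_simps)
  finally have 2: "z' * w' = (u * u' - v * v' * t) + (u * v' + u' * v + v * v' * s) * (s - b)" .
  show ?thesis 
    by (rule conj_pairI[of "u * u' - v * v' * t" _ "u * v' + u' * v + v * v' * s"]) (use st subfield_complexD[OF K] * 1 2 in \<open>auto\<close>)
qed

lemma conj_pair_norm:
  assumes "conj_pair K s b z z'" shows "z * z' \<in> K"
proof -
  obtain u v where *: "u \<in> K" "v \<in> K" "z = u + v * b" "z' = u + v * (s - b)"
    using assms by (auto simp: conj_pair_def)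
  have "z * z' = u * u + u * v * s + v * v * (s * b - b * b)" by (simp add: * algebra_simps)
  also have "\<dots> = u * u + u * v * s + v * v * t" by (simp add: st)
  also have "\<dots> \<in> K" using * st subfield_complexD[OF K] by auto
  finally show ?thesis .
qed

text \<open>Since \<open>b\<close> is not in \<open>K\<close>, the coordinates of 0 are unique. This
  is what carries a root of an integer polynomial to its conjugate.\<close>

lemma conj_pair_0:
  assumes "b \<notin> K" "conj_pair K s b 0 z'" shows "z' = 0"
proof -
  obtain u v where *: "u \<in> K" "v \<in> K" "0 = u + v * b" "z' = u + v * (s - b)"
    using assms by (auto simp: conj_pair_def)
  have "v = 0"
  proof (rule ccontr)
    assume "v \<noteq> 0"
    then have "b = - u / v" using *(3) by (simp add: field_simps eq_neg_iff_add_eq_0)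
    then show False using assms(1) * subfield_complexD[OF K] by auto
  qed
  then show ?thesis using * by simp
qed

lemma conj_pair_poly:
  assumes "conj_pair K s b z z'"
  shows "conj_pair K s b (poly (map_poly of_int p) z) (poly (map_poly of_int p) z')"
proof (induction p)
  case (pCons a p)
  have "of_int a \<in> K" using Rats_subset_subfield[OF K] by auto
  with pCons show ?case
    by (auto simp: map_poly_pCons intro!: conj_pair_add conj_pair_mult assms conj_pair_const)
qed (simp add: conj_pair_const subfield_complexD(1)[OF K])

end

text \<open>The properties of conjugation that the approximants require, without asking that
  \<open>R\<close> be functional. Besides compatibility with the field operations only
  \<open>R_norm\<close> matters: it is the one axiom that puts a product back into
  \<open>K\<close>.\<close>

locale conj_relation =
  fixes K :: "complex set" and R :: "complex \<Rightarrow> complex \<Rightarrow> bool"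
  assumes subfield_K: "subfield K complex_field"
    and R_const: "k \<in> K \<Longrightarrow> R k k"
    and R_add: "R z z' \<Longrightarrow> R w w' \<Longrightarrow> R (z + w) (z' + w')"
    and R_mult: "R z z' \<Longrightarrow> R w w' \<Longrightarrow> R (z * w) (z' * w')"
    and R_norm: "R z z' \<Longrightarrow> z * z' \<in> K"
begin

lemma R_minus: "R z z' \<Longrightarrow> R (- z) (- z')"
  using R_mult[OF R_const[of "-1"], of z z'] subfield_complexD(2,5)[OF subfield_K] by simp

lemma R_diff: "R z z' \<Longrightarrow> R w w' \<Longrightarrow> R (z - w) (z' - w')"
  using R_add[of z z' "- w" "- w'"] R_minus[of w w'] by simp

lemma R_power: "R z z' \<Longrightarrow> R (z ^ k) (z' ^ k)"
  by (induction k) (auto intro: R_mult R_const subfield_complexD(2)[OF subfield_K])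

lemma R_sum: "(\<And>i. i \<in> I \<Longrightarrow> R (f i) (f' i)) \<Longrightarrow> R (sum f I) (sum f' I)"
  by (induction I rule: infinite_finite_induct)
     (auto intro: R_add R_const subfield_complexD(1)[OF subfield_K])

end

lemma conjugation_relation:
  fixes K :: "complex set" and b1 b2 c1 c2 :: complex
  assumes K: "subfield K complex_field"
    and b1: "algebraic_int b1" "\<exists>m\<le>2. ext_degree K (adjoin K b1) m"
    and deg1: "b1 \<in> K \<Longrightarrow> b2 \<in> K \<and> c1 \<in> K \<and> c2 \<in> K \<and> c1 \<noteq> 0 \<and> c2 \<noteq> 0 \<and> b2 \<noteq> b1 \<and> algebraic_int b2"
    and deg2: "ext_degree K (adjoin K b1) 2 \<Longrightarrow>
            conjugate_over K b1 b2 \<and> c1 \<in> adjoin K b1 \<and> conjugate_over K c1 c2"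
  obtains R where "conj_relation K R" "algebraic_int b2" "b2 \<noteq> b1"
    "R b1 b2" "R b2 b1" "R c1 c2" "R c2 c1"
proof (cases "b1 \<in> K")
  case True
  \<comment> \<open>Here \<open>R\<close> relates any two elements of \<open>K\<close>; all axioms
    hold trivially, and \<open>\<beta>\<^sub>1\<close>, \<open>\<beta>\<^sub>2\<close> count as
    conjugate although no automorphism links them.\<close>
  show ?thesis
    by (rule that[of "\<lambda>z z'. z \<in> K \<and> z' \<in> K"])
       (use deg1[OF True] True subfield_complexD[OF K] K in \<open>auto intro!: conj_relation.intro\<close>)
next
  case False
  let ?L = "adjoin K b1"
  have L: "subfield ?L complex_field" "K \<subseteq> ?L" "b1 \<in> ?L" by (rule subfield_adjoin)+
  have e2: "ext_degree K ?L 2" using b1(2) ext_degree_le_2[OF K L(1,2) _ _ L(3) False] by blast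
  note deg2 = deg2[OF e2]
  obtain u s where us: "u \<in> K" "s \<in> K" "b1 * b1 = u + s * b1"
    using ext_degree_2_basis[OF K L(1,2) e2 L(3) False subfield_complexD(4)[OF L(1) L(3) L(3)]] .
  define t where "t = - u"
  have st: "s \<in> K" "t \<in> K" "b1 * b1 = s * b1 - t"
    using us subfield_complexD[OF K] by (auto simp: t_def)
  have b2: "b2 = s - b1" using conjugate_over_quadratic[OF K st False] deg2 by blast
  let ?R = "conj_pair K s b1"
  note pair = conj_pair_add[OF K st] conj_pair_mult[OF K st] conj_pair_const[OF K st]
    conj_pair_norm[OF K st] conj_pair_sym[OF K st] conj_pair_gen[OF K st]
  obtain v w where vw: "v \<in> K" "w \<in> K" "c1 = v + w * b1"
    using ext_degree_2_basis[OF K L(1,2) e2 L(3) False, of c1] deg2 by blast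
  have Rc: "?R c1 c2"
  proof (cases "w = 0")
    case True
    then have "c2 = c1" using conjugate_over_self[OF K, of c1] vw deg2 by simp
    then show ?thesis using True vw pair by simp
  next
    case w: False
    have "c1 \<notin> K"
    proof
      assume "c1 \<in> K"
      then have "(c1 - v) / w \<in> K" using vw(1,2) subfield_complexD(6,8)[OF K] by blast
      moreover have "(c1 - v) / w = b1" using vw w by simp
      ultimately show False using False by simp
    qed
    \<comment> \<open>The coefficients are the trace and the norm of
      \<open>v + w * b1\<close>.\<close>
    moreover have "c1 * c1 = (2 * v + w * s) * c1 - (v * v + v * w * s + w * w * t)"
    proof -
      have "c1 * c1 = v * v + 2 * v * w * b1 + w * w * (b1 * b1)" by (simp add: vw algebra_simps)
      also have "\<dots> = v * v + 2 * v * w * b1 + w * w * (s * b1 - t)" by (simp only: st(3))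
      also have "\<dots> = (2 * v + w * s) * c1 - (v * v + v * w * s + w * w * t)"
        by (simp add: vw algebra_simps)
      finally show ?thesis .
    qed
    moreover have "2 * v \<in> K" using vw(1) subfield_complexD(3)[OF K, of v v] by simp
    then have "2 * v + w * s \<in> K" "v * v + v * w * s + w * w * t \<in> K"
      using vw st subfield_complexD[OF K] by auto
    ultimately have "c2 = (2 * v + w * s) - c1"
      using conjugate_over_quadratic[OF K] deg2 by blast
    then have "c2 = v + w * (s - b1)" by (simp add: vw algebra_simps)
    then show ?thesis using vw by (auto simp: conj_pair_def)
  qed
  \<comment> \<open>A monic integer polynomial that annihilates \<open>b1\<close> also annihilates
    its conjugate.\<close>
  have "algebraic_int b2"
  proof -
    obtain p where p: "poly (map_poly of_int p) b1 = 0" "lead_coeff p = 1"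
      using b1(1) unfolding algebraic_int_altdef_ipoly by blast
    have "poly (map_poly of_int p) b2 = 0"
      using conj_pair_0[OF K st False] conj_pair_poly[OF K st pair(6), of p] p b2 by simp
    with p(2) show ?thesis unfolding algebraic_int_altdef_ipoly by blast
  qed
  moreover have "b2 \<noteq> b1" using deg2 False by (auto simp: conjugate_over_def)
  moreover have "conj_relation K ?R" by (rule conj_relation.intro) (use K pair in auto)
  ultimately show ?thesis
    by (intro that[of ?R]) (use pair Rc b2 in auto)
qed

section \<open>The Pade remainder\<close>

definition hyp_coeff :: "real \<Rightarrow> nat \<Rightarrow> nat \<Rightarrow> real" where
  "hyp_coeff \<nu> r k =
     pochhammer (- real r) k * pochhammer (- real r - \<nu>) k / (pochhammer (1 - \<nu>) k * fact k)"

definition hypX :: "real \<Rightarrow> nat \<Rightarrow> complex \<Rightarrow> complex" where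
  "hypX \<nu> r z = (\<Sum>k\<le>r. of_real (hyp_coeff \<nu> r k) * z ^ k)"

definition hypY :: "real \<Rightarrow> nat \<Rightarrow> complex \<Rightarrow> complex" where
  "hypY \<nu> r z = (\<Sum>k\<le>r. of_real (hyp_coeff \<nu> r (r - k)) * z ^ k)"

lemma pochhammer_neg_of_nat: "k \<le> r \<Longrightarrow> pochhammer (- real r) k = (-1) ^ k * fact k * real (r choose k)"
proof -
  have "real (r choose k) = (-1) ^ k * pochhammer (- real r) k / fact k"
    using gbinomial_pochhammer[of "real r" k] by (simp add: binomial_gbinomial)
  then have "(-1) ^ k * fact k * real (r choose k) = ((-1) ^ k * (-1) ^ k) * pochhammer (- real r) k"
    by simp
  also have "(-1 :: real) ^ k * (-1) ^ k = 1" by (simp add: power_mult_distrib[symmetric])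
  finally show ?thesis by simp
qed

lemma pochhammer_pos_1: "\<nu> < 1 \<Longrightarrow> pochhammer (1 - \<nu>) k > (0::real)"
  by (rule pochhammer_pos) simp

text \<open>In this form \<open>hypX \<nu> r z\<close> is visibly a multiple of the coefficient of
  t^r in (1 + z t)^(r + \<nu>) (1 + t)^(r - \<nu>), and signs and sizes of the coefficients can be
  read off from binomials.\<close>

lemma hyp_coeff_gbinomial:
  assumes "0 < \<nu>" "\<nu> < 1" "k \<le> r"
  shows "hyp_coeff \<nu> r k = fact r / pochhammer (1 - \<nu>) r *
           ((real r + \<nu>) gchoose k) * ((real r - \<nu>) gchoose (r - k))"
proof -
  have 1: "(real r + \<nu>) gchoose k = (-1) ^ k * pochhammer (- real r - \<nu>) k / fact k"
    using gbinomial_pochhammer[of "real r + \<nu>" k] by simp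
  have 2: "(real r - \<nu>) gchoose (r - k) = pochhammer (1 - \<nu> + real k) (r - k) / fact (r - k)"
    using gbinomial_pochhammer'[of "real r - \<nu>" "r - k"] assms(3) by (simp add: of_nat_diff algebra_simps)
  have 3: "pochhammer (1 - \<nu>) r = pochhammer (1 - \<nu>) k * pochhammer (1 - \<nu> + real k) (r - k)"
    by (rule pochhammer_product[OF assms(3)])
  have 4: "real (r choose k) = fact r / (fact k * fact (r - k))"
    by (rule binomial_fact[OF assms(3)])
  have nz: "pochhammer (1 - \<nu>) k > 0" "pochhammer (1 - \<nu> + real k) (r - k) > 0"
    using assms by (auto intro!: pochhammer_pos)
  show ?thesis using nz
    unfolding hyp_coeff_def 1 2 3 pochhammer_neg_of_nat[OF assms(3)] 4
    by (simp add: field_simps)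
qed

text \<open>This is a partial fraction expansion in \<open>a\<close>. By Pascal's rule the sum for
  \<open>r + 1\<close> at \<open>a\<close> is the difference of the sums for \<open>r\<close> at
  \<open>a\<close> and at \<open>a + 1\<close>.\<close>

lemma alternating_binomial_partial_fractions:
  fixes a :: real
  assumes "\<And>i. i \<le> r \<Longrightarrow> a + real i \<noteq> 0"
  shows "(\<Sum>i\<le>r. (-1) ^ i * real (r choose i) / (a + real i)) = fact r / pochhammer a (Suc r)"
  using assms
proof (induction r arbitrary: a)
  case (Suc r)
  have nz: "a + real i \<noteq> 0" if "i \<le> Suc r" for i using Suc.prems that by blast
  have nz1: "a + 1 + real i \<noteq> 0" if "i \<le> r" for i using nz[of "Suc i"] that by (simp add: algebra_simps)
  let ?f = "\<lambda>n i. (-1) ^ i * real (n choose i) / (a + real i)"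
  have "(\<Sum>i\<le>Suc r. ?f (Suc r) i) = ?f (Suc r) 0 + (\<Sum>i\<le>r. ?f (Suc r) (Suc i))"
    by (rule sum.atMost_Suc_shift)
  also have "(\<Sum>i\<le>r. ?f (Suc r) (Suc i)) =
      (\<Sum>i\<le>r. ?f r (Suc i)) - (\<Sum>i\<le>r. (-1) ^ i * real (r choose i) / (a + 1 + real i))"
    unfolding sum_subtractf[symmetric]
    by (intro sum.cong refl) (simp add: diff_divide_distrib add_divide_distrib algebra_simps)
  also have "?f (Suc r) 0 + ((\<Sum>i\<le>r. ?f r (Suc i)) - (\<Sum>i\<le>r. (-1) ^ i * real (r choose i) / (a + 1 + real i)))
      = (\<Sum>i\<le>Suc r. ?f r i) - (\<Sum>i\<le>r. (-1) ^ i * real (r choose i) / (a + 1 + real i))"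
    by (simp add: sum.atMost_Suc_shift del: sum.atMost_Suc)
  also have "(\<Sum>i\<le>Suc r. ?f r i) = (\<Sum>i\<le>r. ?f r i)" by simp
  also have "\<dots> = fact r / pochhammer a (Suc r)" by (rule Suc.IH) (use nz in auto)
  also have "(\<Sum>i\<le>r. (-1) ^ i * real (r choose i) / (a + 1 + real i)) = fact r / pochhammer (a + 1) (Suc r)"
    by (rule Suc.IH) (use nz1 in auto)
  also have "fact r / pochhammer a (Suc r) - fact r / pochhammer (a + 1) (Suc r)
      = fact (Suc r) / pochhammer a (Suc (Suc r))"
  proof -
    define P where "P = pochhammer (a + 1) r"
    have P: "P \<noteq> 0" unfolding P_def using nz1 by (auto simp: pochhammer_eq_0_iff algebra_simps eq_neg_iff_add_eq_0)
    have a: "a \<noteq> 0" using nz[of 0] by simp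
    have b: "a + 1 + real r \<noteq> 0" using nz1[of r] by simp
    have "pochhammer a (Suc r) = a * P" "pochhammer (a + 1) (Suc r) = P * (a + 1 + real r)"
      "pochhammer a (Suc (Suc r)) = a * (P * (a + 1 + real r))"
      unfolding P_def by (simp_all add: pochhammer_rec[of a] pochhammer_Suc[of "a + 1"])
    moreover have "fact r / (a * P) - fact r / (P * (a + 1 + real r)) = fact (Suc r) / (a * (P * (a + 1 + real r)))"
      using P a b by (simp add: divide_simps) (simp add: algebra_simps)
    ultimately show ?thesis by (simp only:)
  qed
  finally show ?case .
qed (simp add: pochhammer_Suc)

text \<open>No exponent \<nu> - m + i of the expanded integrand vanishes, so the antiderivative
  contains no logarithm.\<close>

lemma nonint_plus_nonzero:
  assumes "0 < \<nu>" "\<nu> < (1::real)"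
  shows "\<nu> - real m + real i \<noteq> 0"
proof
  assume "\<nu> - real m + real i = 0"
  then have "\<nu> = real_of_int (int m - int i)" by simp
  with assms have "0 < int m - int i" "int m - int i < 1" by linarith+
  then show False by linarith
qed

text \<open>The reciprocal of the Beta integral of t^(\<nu>-1) (1 - t)^r over [0, 1], which
  normalises the remainder integral so that \<open>hypX\<close> has constant term 1.\<close>

definition rem_const :: "real \<Rightarrow> nat \<Rightarrow> real" where
  "rem_const \<nu> r = pochhammer \<nu> (Suc r) / fact r"

lemma hyp_coeff_partial_fractions:
  assumes "0 < \<nu>" "\<nu> < 1" "m \<le> r"
  shows "hyp_coeff \<nu> r m = rem_const \<nu> r * ((-1) ^ m * real (r choose m)) *
     (\<Sum>i\<le>r. (-1) ^ i * real (r choose i) / (\<nu> - real m + real i))"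
proof -
  have S: "(\<Sum>i\<le>r. (-1) ^ i * real (r choose i) / (\<nu> - real m + real i)) = fact r / pochhammer (\<nu> - real m) (Suc r)"
    by (rule alternating_binomial_partial_fractions) (use nonint_plus_nonzero[OF assms(1,2)] in auto)
  have nz: "pochhammer (\<nu> - real m) (Suc r) \<noteq> 0"
    using nonint_plus_nonzero[OF assms(1,2)] by (auto simp: pochhammer_eq_0_iff eq_neg_iff_add_eq_0)
  have P: "pochhammer (- real r - \<nu>) m = (-1) ^ m * pochhammer (\<nu> - real m + real (Suc r)) m"
  proof -
    have "- real r - \<nu> = - (real r + \<nu>)" "real r + \<nu> - real m + 1 = \<nu> - real m + real (Suc r)" by simp_all
    then show ?thesis using pochhammer_minus[of "real r + \<nu>" m] by metis
  qed
  have Q: "pochhammer (\<nu> - real m) m = (-1) ^ m * pochhammer (1 - \<nu>) m"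
    using pochhammer_minus[of "real m - \<nu>" m] by (simp add: algebra_simps)
  \<comment> \<open>The rising product of length \<open>m + Suc r\<close> from
    \<open>\<nu> - m\<close> is cut once after \<open>m\<close> factors and once after
    \<open>Suc r\<close> factors; comparing the two gives the shifted product in
    \<open>R\<close>.\<close>
  have "pochhammer (\<nu> - real m) (m + Suc r) = pochhammer (\<nu> - real m) m * pochhammer \<nu> (Suc r)"
    using pochhammer_product'[of "\<nu> - real m" m "Suc r"] by simp
  moreover have "pochhammer (\<nu> - real m) (Suc r + m) = pochhammer (\<nu> - real m) (Suc r) * pochhammer (\<nu> - real m + real (Suc r)) m"
    by (rule pochhammer_product')
  ultimately have "pochhammer (\<nu> - real m) (Suc r) * pochhammer (\<nu> - real m + real (Suc r)) m
      = (-1) ^ m * pochhammer (1 - \<nu>) m * pochhammer \<nu> (Suc r)"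
    by (simp add: Q add.commute)
  then have R: "pochhammer (\<nu> - real m + real (Suc r)) m
      = (-1) ^ m * pochhammer (1 - \<nu>) m * pochhammer \<nu> (Suc r) / pochhammer (\<nu> - real m) (Suc r)"
    using nz by (simp add: field_simps del: of_nat_Suc pochhammer_Suc)
  have nz1: "pochhammer (1 - \<nu>) m > 0" using assms by (intro pochhammer_pos_1)
  show ?thesis
    unfolding hyp_coeff_def P R S pochhammer_neg_of_nat[OF assms(3)] rem_const_def
    using nz1 nz by (simp add: field_simps del: of_nat_Suc pochhammer_Suc)
qed

text \<open>With \<open>z = e\<^sup>L\<close>, the difference \<open>hypX - z\<^sup>\<nu> hypY\<close> is a multiple of the integral of
  \<open>((1 - t) (t - z) / t)\<^sup>r t\<^sup>\<nu>\<^sup>-\<^sup>1\<close> from \<open>z\<close> to \<open>1\<close>; substituting \<open>t = e\<^sup>l\<close>, this is an explicit antiderivative.\<close>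

definition pade_antideriv :: "real \<Rightarrow> nat \<Rightarrow> complex \<Rightarrow> complex \<Rightarrow> complex" where
  "pade_antideriv \<nu> r z l = of_real (rem_const \<nu> r) * (\<Sum>m\<le>r. \<Sum>i\<le>r.
     of_real (((-1) ^ m * real (r choose m)) * ((-1) ^ i * real (r choose i)) / (\<nu> - real m + real i))
       * z ^ m * exp (of_real (\<nu> - real m + real i) * l))"

lemma pade_antideriv_0:
  assumes "0 < \<nu>" "\<nu> < 1"
  shows "pade_antideriv \<nu> r z 0 = hypX \<nu> r z"
  unfolding pade_antideriv_def hypX_def sum_distrib_left
proof (rule sum.cong)
  fix m assume "m \<in> {..r}"
  then have "m \<le> r" by simp
  show "(\<Sum>i\<le>r. of_real (rem_const \<nu> r) * (of_real ((-1) ^ m * real (r choose m) * ((-1) ^ i * real (r choose i)) /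
           (\<nu> - real m + real i)) * z ^ m * exp (of_real (\<nu> - real m + real i) * 0))) =
       of_real (hyp_coeff \<nu> r m) * z ^ m"
    unfolding hyp_coeff_partial_fractions[OF assms \<open>m \<le> r\<close>]
    by (simp add: sum_distrib_left sum_distrib_right mult_ac)
qed simp

text \<open>At the endpoint z^m e^((\<nu> - m + i) L) equals z^\<nu> z^i, which no longer involves
  \<open>m\<close>. Summing over \<open>m\<close> first and reflecting \<open>m\<close> to
  \<open>r - m\<close> gives the partial fraction sum of the coefficient with index
  \<open>r - i\<close>.\<close>

lemma pade_antideriv_L:
  assumes "0 < \<nu>" "\<nu> < 1"
  shows "pade_antideriv \<nu> r (exp L) L = exp (of_real \<nu> * L) * hypY \<nu> r (exp L)"
proof -
  have c: "hyp_coeff \<nu> r (r - i) = rem_const \<nu> r * (\<Sum>m\<le>r. ((-1) ^ m * real (r choose m)) *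
       ((-1) ^ i * real (r choose i)) / (\<nu> - real m + real i))" if i: "i \<le> r" for i
  proof -
    have "(\<Sum>j\<le>r. (-1) ^ j * real (r choose j) / (\<nu> - real (r - i) + real j))
       = (\<Sum>m\<le>r. (-1) ^ (r - m) * real (r choose m) / (\<nu> - real m + real i))"
      by (rule sum.reindex_bij_witness[of _ "\<lambda>m. r - m" "\<lambda>m. r - m"])
         (use i in \<open>auto simp: of_nat_diff binomial_symmetric[symmetric] algebra_simps\<close>)
    then have "hyp_coeff \<nu> r (r - i) = rem_const \<nu> r * ((-1) ^ (r - i) * real (r choose i)) *
       (\<Sum>m\<le>r. (-1) ^ (r - m) * real (r choose m) / (\<nu> - real m + real i))"
      using hyp_coeff_partial_fractions[OF assms, of "r - i" r] i by (simp add: binomial_symmetric[symmetric])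
    also have "\<dots> = rem_const \<nu> r * (\<Sum>m\<le>r. ((-1) ^ (r - i) * (-1) ^ (r - m)) * (real (r choose m) *
        real (r choose i) / (\<nu> - real m + real i)))"
      by (simp add: sum_distrib_left mult_ac)
    also have "(\<Sum>m\<le>r. ((-1) ^ (r - i) * (-1) ^ (r - m)) * (real (r choose m) *
        real (r choose i) / (\<nu> - real m + real i))) =
       (\<Sum>m\<le>r. ((-1) ^ m * (-1) ^ i) * (real (r choose m) * real (r choose i) / (\<nu> - real m + real i)))"
    proof (rule sum.cong)
      fix m assume "m \<in> {..r}"
      then have "(-1 :: real) ^ (r - i) * (-1) ^ (r - m) = (-1) ^ m * (-1) ^ i"
        using i by (auto simp: minus_one_power_iff)
      then show "((-1) ^ (r - i) * (-1) ^ (r - m)) * (real (r choose m) * real (r choose i) / (\<nu> - real m + real i))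
        = ((-1) ^ m * (-1) ^ i) * (real (r choose m) * real (r choose i) / (\<nu> - real m + real i))" by simp
    qed simp
    finally show ?thesis by (simp add: mult_ac)
  qed
  have e: "exp L ^ m * exp (of_real (\<nu> - real m + real i) * L) = exp (of_real \<nu> * L) * exp L ^ i" for m i
    by (simp add: exp_of_nat_mult[symmetric] exp_add[symmetric] algebra_simps)
  have "pade_antideriv \<nu> r (exp L) L = of_real (rem_const \<nu> r) * (\<Sum>m\<le>r. \<Sum>i\<le>r.
     of_real (((-1) ^ m * real (r choose m)) * ((-1) ^ i * real (r choose i)) / (\<nu> - real m + real i))
       * (exp (of_real \<nu> * L) * exp L ^ i))"
    unfolding pade_antideriv_def by (simp only: mult.assoc e)
  also have "\<dots> = of_real (rem_const \<nu> r) * (\<Sum>i\<le>r. \<Sum>m\<le>r.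
     of_real (((-1) ^ m * real (r choose m)) * ((-1) ^ i * real (r choose i)) / (\<nu> - real m + real i))
       * (exp (of_real \<nu> * L) * exp L ^ i))"
    by (subst sum.swap) (rule refl)
  also have "\<dots> = exp (of_real \<nu> * L) * (\<Sum>i\<le>r. of_real (hyp_coeff \<nu> r (r - i)) * exp L ^ i)"
    by (simp add: c sum_distrib_left sum_distrib_right mult_ac)
  finally show ?thesis by (simp add: hypY_def)
qed

text \<open>Differentiation cancels the denominators, and the double sum then factors into two
  binomial expansions.\<close>

lemma pade_antideriv_has_derivative:
  assumes "0 < \<nu>" "\<nu> < 1"
  shows "(pade_antideriv \<nu> r z has_field_derivative of_real (rem_const \<nu> r) *
     (exp (of_real \<nu> * l) * ((1 - exp l) * (1 - z * exp (- l))) ^ r)) (at l within S)"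
proof -
  define c where "c m = complex_of_real ((-1) ^ m * real (r choose m))" for m
  have nz: "complex_of_real (\<nu> - real m + real i) \<noteq> 0" for m i
    using nonint_plus_nonzero[OF assms] by (simp only: of_real_eq_0_iff) simp
  have alt: "(\<Sum>m\<le>r. c m * w ^ m) = (1 - w) ^ r" for w
  proof -
    have "(1 - w) ^ r = (- w + 1) ^ r" by simp
    also have "\<dots> = (\<Sum>m\<le>r. of_nat (r choose m) * (- w) ^ m * 1 ^ (r - m))" by (rule binomial_ring)
    also have "\<dots> = (\<Sum>m\<le>r. c m * w ^ m)"
      unfolding c_def by (intro sum.cong refl) (simp add: power_minus[of w] mult_ac)
    finally show ?thesis by simp
  qed
  have "(pade_antideriv \<nu> r z has_field_derivative of_real (rem_const \<nu> r) * (\<Sum>m\<le>r. \<Sum>i\<le>r.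
     of_real (((-1) ^ m * real (r choose m)) * ((-1) ^ i * real (r choose i)) / (\<nu> - real m + real i))
       * z ^ m * (exp (of_real (\<nu> - real m + real i) * l) * of_real (\<nu> - real m + real i)))) (at l within S)"
    unfolding pade_antideriv_def[abs_def]
    by (intro DERIV_cmult DERIV_sum) (auto intro!: derivative_eq_intros)
  also have "(\<Sum>m\<le>r. \<Sum>i\<le>r.
     of_real (((-1) ^ m * real (r choose m)) * ((-1) ^ i * real (r choose i)) / (\<nu> - real m + real i))
       * z ^ m * (exp (of_real (\<nu> - real m + real i) * l) * of_real (\<nu> - real m + real i)))
     = (\<Sum>m\<le>r. \<Sum>i\<le>r. exp (of_real \<nu> * l) * ((c m * (z * exp (- l)) ^ m) * (c i * exp l ^ i)))"
  proof (intro sum.cong refl)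
    fix m i
    have e: "exp (of_real (\<nu> - real m + real i) * l) = exp (of_real \<nu> * l) * (exp (- l) ^ m * exp l ^ i)"
      by (simp add: exp_of_nat_mult[symmetric] exp_add[symmetric] algebra_simps)
    have d: "of_real (((-1) ^ m * real (r choose m)) * ((-1) ^ i * real (r choose i)) / (\<nu> - real m + real i))
      = c m * c i / of_real (\<nu> - real m + real i)"
      unfolding c_def by (simp only: of_real_mult of_real_divide)
    show "of_real (((-1) ^ m * real (r choose m)) * ((-1) ^ i * real (r choose i)) / (\<nu> - real m + real i))
       * z ^ m * (exp (of_real (\<nu> - real m + real i) * l) * of_real (\<nu> - real m + real i))
      = exp (of_real \<nu> * l) * ((c m * (z * exp (- l)) ^ m) * (c i * exp l ^ i))"
      unfolding e d power_mult_distrib using nz[of m i] by (simp add: mult_ac del: of_real_add of_real_diff)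
  qed
  also have "\<dots> = exp (of_real \<nu> * l) * ((\<Sum>m\<le>r. c m * (z * exp (- l)) ^ m) * (\<Sum>i\<le>r. c i * exp l ^ i))"
    unfolding sum_product by (simp only: sum_distrib_left)
  also have "\<dots> = exp (of_real \<nu> * l) * ((1 - exp l) * (1 - z * exp (- l))) ^ r"
    unfolding alt by (simp only: power_mult_distrib mult_ac)
  finally show ?thesis .
qed

text \<open>Here e^L ranges over (0, 1] and the unit circle. The segment from 0 to \<open>L\<close>,
  along which the remainder is integrated, stays on the half-line or on the imaginary axis.\<close>

definition admissible_log :: "complex \<Rightarrow> bool" where
  "admissible_log L \<longleftrightarrow> (Im L = 0 \<and> Re L \<le> 0) \<or> (Re L = 0 \<and> \<bar>Im L\<bar> \<le> pi)"

lemma norm_one_minus_cis: "cmod (1 - cis (2 * a)) = 2 * \<bar>sin a\<bar>"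
proof -
  have "1 - cis (2 * a) = - 2 * \<i> * of_real (sin a) * cis a"
    by (simp add: complex_eq_iff sin_double cos_double_sin power2_eq_square)
  then show ?thesis by (simp add: norm_mult)
qed

text \<open>The two exponents \<open>l\<close> and \<open>L - l\<close> have a fixed sum, and the
  product is largest when they are equal. On the half-line this is (1 - P^2)(1 - Q^2) \<le> (1 - P
  Q)^2, that is (P - Q)^2 \<ge> 0; on the circle it is the product formula for sines with cos(a - b)
  \<le> 1.\<close>

lemma norm_pade_integrand_le:
  assumes L: "admissible_log L" and l: "l \<in> closed_segment 0 L"
  shows "cmod ((1 - exp l) * (1 - exp L * exp (- l))) \<le> cmod (1 - exp (L / 2)) ^ 2"
    and "\<nu> > 0 \<Longrightarrow> cmod (exp (of_real \<nu> * l)) \<le> 1"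
proof -
  obtain u where u: "0 \<le> u" "u \<le> 1" "l = of_real u * L"
    using l by (auto simp: closed_segment_def scaleR_conv_of_real)
  have "Re L \<le> 0" using L by (auto simp: admissible_log_def)
  then show "\<nu> > 0 \<Longrightarrow> cmod (exp (of_real \<nu> * l)) \<le> 1"
    using u by (simp add: mult_nonneg_nonpos)
  have m: "exp L * exp (- l) = exp (L - l)" by (simp add: exp_diff exp_minus field_simps)
  show "cmod ((1 - exp l) * (1 - exp L * exp (- l))) \<le> cmod (1 - exp (L / 2)) ^ 2"
    using L unfolding admissible_log_def
  proof
    assume L: "Im L = 0 \<and> Re L \<le> 0"
    define x where "x = Re L"
    have Lx: "L = of_real x" using L by (simp add: complex_eq_iff x_def)
    have x: "x \<le> 0" using L by (simp add: x_def)
    define P Q where "P = exp (u * x / 2)" and "Q = exp ((1 - u) * x / 2)"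
    have P2: "exp (u * x) = P * P" "exp (x - u * x) = Q * Q" "exp (x / 2) = P * Q"
      unfolding P_def Q_def by (simp_all add: exp_add[symmetric] algebra_simps)
    have le: "u * x \<le> 0" "x - u * x \<le> 0"
      using u x mult_nonneg_nonpos[of u x] mult_nonneg_nonpos[of "1 - u" x] by (auto simp: algebra_simps)
    have "cmod ((1 - exp l) * (1 - exp (L - l))) = \<bar>1 - exp (u * x)\<bar> * \<bar>1 - exp (x - u * x)\<bar>"
    proof -
      have "l = of_real (u * x)" "L - l = of_real (x - u * x)" by (simp_all add: Lx u(3))
      then have "exp l = of_real (exp (u * x))" "exp (L - l) = of_real (exp (x - u * x))"
        by (simp_all only: exp_of_real)
      then have "1 - exp l = of_real (1 - exp (u * x))" "1 - exp (L - l) = of_real (1 - exp (x - u * x))"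
        by simp_all
      then show ?thesis by (simp only: norm_mult norm_of_real)
    qed
    also have "\<dots> = (1 - P * P) * (1 - Q * Q)"
      using le by (simp add: P2[symmetric])
    also have "\<dots> \<le> (1 - P * Q)\<^sup>2"
      using zero_le_power2[of "P - Q"] by (simp add: power2_eq_square algebra_simps)
    also have "\<dots> = \<bar>1 - exp (x / 2)\<bar> ^ 2" by (simp add: P2)
    also have "\<bar>1 - exp (x / 2)\<bar> = cmod (1 - exp (L / 2))"
    proof -
      have "1 - exp (L / 2) = of_real (1 - exp (x / 2))" by (simp add: Lx exp_of_real[symmetric])
      then show ?thesis by (simp only: norm_of_real)
    qed
    finally show ?thesis by (simp only: m)
  next
    assume L: "Re L = 0 \<and> \<bar>Im L\<bar> \<le> pi"
    define x where "x = Im L"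
    have Lx: "L = \<i> * of_real x" using L by (simp add: complex_eq_iff x_def)
    have x: "\<bar>x\<bar> \<le> pi" using L by (simp add: x_def)
    define a b where "a = u * x / 2" and "b = (1 - u) * x / 2"
    have e: "exp l = cis (2 * a)" "exp (L - l) = cis (2 * b)" "exp (L / 2) = cis (2 * ((a + b) / 2))"
      unfolding a_def b_def cis_conv_exp by (simp_all add: Lx u(3) algebra_simps diff_divide_distrib)
    have ab: "a + b = x / 2" "a - b = (2 * u - 1) * (x / 2)"
      by (simp_all add: a_def b_def field_simps)
    have "\<bar>a - b\<bar> \<le> \<bar>a + b\<bar>"
      unfolding ab abs_mult using u by (intro mult_left_le_one_le) auto
    then have "cos \<bar>a + b\<bar> \<le> cos \<bar>a - b\<bar>"
      using ab x by (intro cos_monotone_0_pi_le) auto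
    then have s0: "sin a * sin b \<ge> 0" by (simp add: sin_times_sin)
    have "cmod ((1 - exp l) * (1 - exp (L - l))) = 4 * \<bar>sin a * sin b\<bar>"
      by (simp add: norm_mult e norm_one_minus_cis abs_mult)
    also have "\<dots> = 2 * (cos (a - b) - cos (a + b))" using s0 by (simp add: sin_times_sin)
    also have "\<dots> \<le> 2 * (1 - cos (2 * ((a + b) / 2)))" using cos_le_one[of "a - b"] by simp
    also have "\<dots> = 4 * (sin ((a + b) / 2))\<^sup>2" unfolding cos_double_sin by simp
    also have "\<dots> = (cmod (1 - exp (L / 2)))\<^sup>2"
      unfolding e(3) norm_one_minus_cis power_mult_distrib by simp
    finally show ?thesis by (simp only: m)
  qed
qed

text \<open>Mean value inequality for the antiderivative along the segment; its length is the factor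
  \<open>cmod L\<close>.\<close>

lemma pade_remainder_le:
  assumes \<nu>: "0 < \<nu>" "\<nu> < 1" and L: "admissible_log L"
  shows "cmod (hypX \<nu> r (exp L) - exp (of_real \<nu> * L) * hypY \<nu> r (exp L))
     \<le> rem_const \<nu> r * cmod (1 - exp (L / 2)) ^ (2 * r) * cmod L"
proof -
  have B: "rem_const \<nu> r \<ge> 0" using \<nu> by (auto simp: rem_const_def intro!: divide_nonneg_pos pochhammer_nonneg)
  have "cmod (pade_antideriv \<nu> r (exp L) 0 - pade_antideriv \<nu> r (exp L) L)
     \<le> rem_const \<nu> r * cmod (1 - exp (L / 2)) ^ (2 * r) * cmod (0 - L)"
  proof (rule field_differentiable_bound[where S = "closed_segment 0 L"])
    fix l assume l: "l \<in> closed_segment 0 L"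
    show "(pade_antideriv \<nu> r (exp L) has_field_derivative of_real (rem_const \<nu> r) *
     (exp (of_real \<nu> * l) * ((1 - exp l) * (1 - exp L * exp (- l))) ^ r)) (at l within closed_segment 0 L)"
      by (rule pade_antideriv_has_derivative[OF \<nu>])
    have "cmod (exp (of_real \<nu> * l) * ((1 - exp l) * (1 - exp L * exp (- l))) ^ r)
      \<le> 1 * (cmod (1 - exp (L / 2)) ^ 2) ^ r"
      unfolding norm_mult[of "exp (of_real \<nu> * l)"] norm_power[of _ r]
      by (intro mult_mono power_mono norm_pade_integrand_le[OF L l] \<nu>) auto
    then show "cmod (of_real (rem_const \<nu> r) * (exp (of_real \<nu> * l) * ((1 - exp l) * (1 - exp L * exp (- l))) ^ r))
      \<le> rem_const \<nu> r * cmod (1 - exp (L / 2)) ^ (2 * r)"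
      using B unfolding norm_mult[of "of_real (rem_const \<nu> r)"] by (simp add: mult_left_mono power_mult)
  qed auto
  then show ?thesis by (simp add: pade_antideriv_0[OF \<nu>] pade_antideriv_L[OF \<nu>])
qed

section \<open>Size of the hypergeometric polynomials\<close>

definition lead_const :: "real \<Rightarrow> nat \<Rightarrow> real" where
  "lead_const \<nu> r = fact r / pochhammer (1 - \<nu>) r"

lemma lead_const_pos: "0 < \<nu> \<Longrightarrow> \<nu> < 1 \<Longrightarrow> lead_const \<nu> r > 0"
  by (simp add: lead_const_def pochhammer_pos_1)

text \<open>The product is a polynomial in \<nu> with non-negative coefficients, hence convex on
  [0, 1], and so lies below the chord between its values at 0 and 1.\<close>

lemma prod_shift_convex:
  fixes a :: "'a \<Rightarrow> real"
  assumes "finite A" "\<And>i. i \<in> A \<Longrightarrow> a i \<ge> 0" "0 \<le> \<nu>" "\<nu> \<le> 1"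
  shows "(\<Prod>i\<in>A. a i + \<nu>) \<le> (1 - \<nu>) * (\<Prod>i\<in>A. a i) + \<nu> * (\<Prod>i\<in>A. a i + 1)"
  using assms(1,2)
proof (induction A rule: finite_induct)
  case (insert x A)
  define f0 f1 where "f0 = (\<Prod>i\<in>A. a i)" and "f1 = (\<Prod>i\<in>A. a i + 1)"
  have "f0 \<le> f1" unfolding f0_def f1_def using insert.prems by (intro prod_mono) auto
  then have c: "\<nu> * (1 - \<nu>) * (f1 - f0) \<ge> 0" using assms(3,4) by auto
  have "(\<Prod>i\<in>insert x A. a i + \<nu>) = (a x + \<nu>) * (\<Prod>i\<in>A. a i + \<nu>)" using insert by simp
  also have "\<dots> \<le> (a x + \<nu>) * ((1 - \<nu>) * f0 + \<nu> * f1)"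
    unfolding f0_def f1_def using insert assms(3) by (intro mult_left_mono) auto
  also have "\<dots> = (1 - \<nu>) * (a x * f0) + \<nu> * ((a x + 1) * f1) - \<nu> * (1 - \<nu>) * (f1 - f0)"
    by (simp add: algebra_simps)
  also have "\<dots> \<le> (1 - \<nu>) * (a x * f0) + \<nu> * ((a x + 1) * f1)" using c by linarith
  finally show ?case using insert by (simp add: f0_def f1_def)
qed simp

lemma gbinomial_shift_le:
  assumes "m \<le> r" "0 \<le> \<nu>" "\<nu> \<le> 1"
  shows "(real r + \<nu>) gchoose m \<le> (1 - \<nu>) * real (r choose m) + \<nu> * real (Suc r choose m)"
    and "(real r + \<nu>) gchoose m \<ge> 0"
proof -
  have "(\<Prod>i<m. real r - real i + \<nu>) \<le> (1 - \<nu>) * (\<Prod>i<m. real r - real i) + \<nu> * (\<Prod>i<m. real r - real i + 1)"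
    by (rule prod_shift_convex) (use assms in auto)
  then have "(\<Prod>i<m. real r - real i + \<nu>) / fact m \<le>
     ((1 - \<nu>) * (\<Prod>i<m. real r - real i) + \<nu> * (\<Prod>i<m. real r - real i + 1)) / fact m"
    by (rule divide_right_mono) simp
  moreover have "(real r + \<nu>) gchoose m = (\<Prod>i<m. real r - real i + \<nu>) / fact m"
    "real (r choose m) = (\<Prod>i<m. real r - real i) / fact m"
    "real (Suc r choose m) = (\<Prod>i<m. real r - real i + 1) / fact m"
    by (simp_all add: binomial_gbinomial gbinomial_prod_rev atLeast0LessThan algebra_simps)
  ultimately show "(real r + \<nu>) gchoose m \<le> (1 - \<nu>) * real (r choose m) + \<nu> * real (Suc r choose m)"
    by (simp only: add_divide_distrib times_divide_eq_right)
  show "(real r + \<nu>) gchoose m \<ge> 0"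
    unfolding gbinomial_prod_rev using assms by (intro divide_nonneg_pos prod_nonneg) auto
qed

lemma gbinomial_minus_le:
  assumes "m \<le> r" "0 \<le> \<nu>" "\<nu> \<le> 1"
  shows "(real r - \<nu>) gchoose m \<le> real (r choose m)" and "(real r - \<nu>) gchoose m \<ge> 0"
proof -
  have "(\<Prod>i = 0..<m. real r - \<nu> - real i) \<le> (\<Prod>i = 0..<m. real r - real i)"
    using assms by (intro prod_mono) auto
  then show "(real r - \<nu>) gchoose m \<le> real (r choose m)"
    unfolding binomial_gbinomial gbinomial_prod_rev by (intro divide_right_mono) auto
  show "(real r - \<nu>) gchoose m \<ge> 0"
    unfolding gbinomial_prod_rev using assms by (intro divide_nonneg_pos prod_nonneg) auto
qed

lemma choose_mult_le: "(a choose k) * (b choose l) \<le> (a + b) choose (k + l)"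
proof -
  have "(a choose k) * (b choose (k + l - k)) \<le> (\<Sum>i\<le>k + l. (a choose i) * (b choose (k + l - i)))"
    by (rule member_le_sum) auto
  then show ?thesis by (simp add: vandermonde)
qed

lemma power_one_plus_even_odd:
  fixes s :: real
  assumes "N \<le> 2 * r + 1"
  shows "(1 + s) ^ N = (\<Sum>k\<le>r. real (N choose (2 * k)) * s ^ (2 * k)) +
    (\<Sum>k\<le>r. real (N choose (2 * k + 1)) * s ^ (2 * k + 1))"
proof -
  have "(1 + s) ^ N = (\<Sum>k\<le>N. real (N choose k) * s ^ k)"
    using binomial_ring[of s 1 N] by (simp add: add.commute)
  also have "\<dots> = (\<Sum>k\<le>Suc (2 * r). real (N choose k) * s ^ k)"
    by (rule sum.mono_neutral_left) (use assms in auto)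
  also have "\<dots> = (\<Sum>k=2 * 0..Suc (2 * r). real (N choose k) * s ^ k)" by (simp add: atLeast0AtMost)
  also have "\<dots> = (\<Sum>k=0..r. real (N choose (2 * k)) * s ^ (2 * k) + real (N choose (Suc (2 * k))) * s ^ (Suc (2 * k)))"
    by (rule sum.in_pairs)
  finally show ?thesis by (simp add: sum.distrib atLeast0AtMost)
qed

lemma even_part:
  fixes s :: real
  assumes "N \<le> 2 * r + 1"
  shows "(\<Sum>k\<le>r. real (N choose (2 * k)) * s ^ (2 * k)) = ((1 + s) ^ N + (1 - s) ^ N) / 2"
proof -
  have e: "(\<Sum>k\<le>r. real (N choose (2 * k)) * (- s) ^ (2 * k)) = (\<Sum>k\<le>r. real (N choose (2 * k)) * s ^ (2 * k))"
    by simp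
  have o: "(\<Sum>k\<le>r. real (N choose (2 * k + 1)) * (- s) ^ (2 * k + 1)) = - (\<Sum>k\<le>r. real (N choose (2 * k + 1)) * s ^ (2 * k + 1))"
    by (simp add: sum_negf)
  note P = power_one_plus_even_odd[OF assms, of s] power_one_plus_even_odd[OF assms, of "- s", unfolded e o]
  show "(\<Sum>k\<le>r. real (N choose (2 * k)) * s ^ (2 * k)) = ((1 + s) ^ N + (1 - s) ^ N) / 2"
    using P by simp
qed

lemma hyp_coeff_lead:
  assumes "0 < \<nu>" "\<nu> < 1" "k \<le> r"
  shows "hyp_coeff \<nu> r k = lead_const \<nu> r * (((real r + \<nu>) gchoose k) * ((real r - \<nu>) gchoose (r - k)))"
  using hyp_coeff_gbinomial[OF assms] by (simp add: lead_const_def)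

text \<open>Up to \<open>lead_const\<close> the coefficient is at most C(r+1, k) C(r, k) \<le>
  C(2r+1, 2k). The sum is thus bounded by the even part of (1 + s)^(2r+1), which is at most (1 +
  s)^(2r) because (1 - s)^(2r) \<le> (1 + s)^(2r).\<close>

lemma hypX_real_le:
  assumes \<nu>: "0 < \<nu>" "\<nu> < 1" and s: "0 \<le> s" "s \<le> 1"
  shows "(\<Sum>k\<le>r. \<bar>hyp_coeff \<nu> r k\<bar> * s ^ (2 * k)) \<le> lead_const \<nu> r * (1 + s) ^ (2 * r)"
proof -
  have le: "\<bar>hyp_coeff \<nu> r k\<bar> \<le> lead_const \<nu> r * real ((2 * r + 1) choose (2 * k))" if k: "k \<le> r" for k
  proof -
    have 1: "(real r + \<nu>) gchoose k \<le> real (Suc r choose k)" "(real r + \<nu>) gchoose k \<ge> 0"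
    proof -
      have "real (r choose k) \<le> real (Suc r choose k)" by (cases k) auto
      then have "(1 - \<nu>) * real (r choose k) \<le> (1 - \<nu>) * real (Suc r choose k)"
        using \<nu> by (intro mult_left_mono) auto
      then show "(real r + \<nu>) gchoose k \<le> real (Suc r choose k)" "(real r + \<nu>) gchoose k \<ge> 0"
        using gbinomial_shift_le[OF k, of \<nu>] \<nu> by (auto simp: algebra_simps)
    qed
    have 2: "(real r - \<nu>) gchoose (r - k) \<le> real (r choose k)" "(real r - \<nu>) gchoose (r - k) \<ge> 0"
      using gbinomial_minus_le[of "r - k" r \<nu>] \<nu> k by (auto simp: binomial_symmetric[symmetric])
    have "((real r + \<nu>) gchoose k) * ((real r - \<nu>) gchoose (r - k)) \<le> real (Suc r choose k) * real (r choose k)"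
      using 1 2 by (intro mult_mono) auto
    also have "\<dots> \<le> real ((2 * r + 1) choose (2 * k))"
      using choose_mult_le[of "Suc r" k r k] by (simp add: mult_2 flip: of_nat_mult del: binomial_Suc_Suc)
    finally show ?thesis
      unfolding hyp_coeff_lead[OF \<nu> k] using lead_const_pos[OF \<nu>, of r] 1 2
      by (simp add: abs_mult mult_left_mono)
  qed
  have "(\<Sum>k\<le>r. \<bar>hyp_coeff \<nu> r k\<bar> * s ^ (2 * k)) \<le> (\<Sum>k\<le>r. lead_const \<nu> r * real ((2 * r + 1) choose (2 * k)) * s ^ (2 * k))"
    by (intro sum_mono mult_right_mono le) (use s in auto)
  also have "\<dots> = lead_const \<nu> r * (\<Sum>k\<le>r. real ((2 * r + 1) choose (2 * k)) * s ^ (2 * k))"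
    by (simp add: sum_distrib_left mult_ac)
  also have "\<dots> \<le> lead_const \<nu> r * (1 + s) ^ (2 * r)"
  proof (rule mult_left_mono)
    have "(1 - s) ^ (2 * r) \<le> (1 + s) ^ (2 * r)" using s by (intro power_mono) auto
    then have "(1 - s) * (1 - s) ^ (2 * r) \<le> (1 - s) * (1 + s) ^ (2 * r)" using s by (intro mult_left_mono) auto
    then show "(\<Sum>k\<le>r. real ((2 * r + 1) choose (2 * k)) * s ^ (2 * k)) \<le> (1 + s) ^ (2 * r)"
      by (subst even_part) (auto simp: algebra_simps)
  qed (use lead_const_pos[OF \<nu>] in \<open>simp add: less_imp_le\<close>)
  finally show ?thesis .
qed

text \<open>The reversed coefficients produce C(2r, 2k) + \<nu> C(2r, 2k+1). The odd binomials come
  with the even power s^(2k) and cost a factor 1/s when matched with (1 + s)^(2r); the chord bound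
  supplies the compensating \<nu>, so that \<nu> \<le> 2 s suffices.\<close>

lemma hypY_real_le:
  assumes \<nu>: "0 < \<nu>" "\<nu> < 1" and s: "0 < s" "s \<le> 1" "\<nu> \<le> 2 * s"
  shows "(\<Sum>k\<le>r. \<bar>hyp_coeff \<nu> r (r - k)\<bar> * s ^ (2 * k)) \<le> 2 * lead_const \<nu> r * (1 + s) ^ (2 * r)"
proof -
  have le: "\<bar>hyp_coeff \<nu> r (r - k)\<bar> \<le> lead_const \<nu> r *
     (real ((2 * r) choose (2 * k)) + \<nu> * real ((2 * r) choose (2 * k + 1)))" if k: "k \<le> r" for k
  proof -
    have 1: "(real r + \<nu>) gchoose (r - k) \<le> (1 - \<nu>) * real (r choose k) + \<nu> * real (Suc r choose (k + 1))"
      "(real r + \<nu>) gchoose (r - k) \<ge> 0"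
      using gbinomial_shift_le[of "r - k" r \<nu>] \<nu> k binomial_symmetric[of "Suc k" "Suc r"]
      by (auto simp: binomial_symmetric[symmetric] simp del: binomial_Suc_Suc)
    have 2: "(real r - \<nu>) gchoose k \<le> real (r choose k)" "(real r - \<nu>) gchoose k \<ge> 0"
      using gbinomial_minus_le[of k r \<nu>] \<nu> k by auto
    have "((real r + \<nu>) gchoose (r - k)) * ((real r - \<nu>) gchoose k) \<le>
       ((1 - \<nu>) * real (r choose k) + \<nu> * real (Suc r choose (k + 1))) * real (r choose k)"
      using 1 2 by (intro mult_mono) auto
    also have "\<dots> = (1 - \<nu>) * real ((r choose k) * (r choose k)) + \<nu> * real ((Suc r choose (k + 1)) * (r choose k))"
      by (simp add: algebra_simps del: binomial_Suc_Suc)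
    also have "\<dots> \<le> (1 - \<nu>) * real ((r + r) choose (k + k)) + \<nu> * real ((Suc r + r) choose (k + 1 + k))"
      using \<nu> by (intro add_mono mult_left_mono of_nat_mono choose_mult_le) auto
    also have "\<dots> = real ((2 * r) choose (2 * k)) + \<nu> * real ((2 * r) choose (2 * k + 1))"
      by (simp add: algebra_simps mult_2[symmetric])
    finally show ?thesis
      using lead_const_pos[OF \<nu>, of r] 1 2 k hyp_coeff_lead[OF \<nu>, of "r - k" r]
      by (simp add: abs_mult mult_left_mono)
  qed
  let ?e = "\<Sum>k\<le>r. real ((2 * r) choose (2 * k)) * s ^ (2 * k)"
  let ?o = "\<Sum>k\<le>r. real ((2 * r) choose (2 * k + 1)) * s ^ (2 * k + 1)"
  have "(\<Sum>k\<le>r. \<bar>hyp_coeff \<nu> r (r - k)\<bar> * s ^ (2 * k)) \<le> (\<Sum>k\<le>r. lead_const \<nu> r *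
     (real ((2 * r) choose (2 * k)) + \<nu> * real ((2 * r) choose (2 * k + 1))) * s ^ (2 * k))"
    by (intro sum_mono mult_right_mono le) (use s in auto)
  also have "\<dots> = lead_const \<nu> r * (?e + \<nu> / s * ?o)"
    using s by (simp add: sum_distrib_left sum.distrib ring_distribs mult_ac)
  also have "\<dots> \<le> lead_const \<nu> r * (2 * ?e + 2 * ?o)"
  proof (intro mult_left_mono add_mono mult_right_mono)
    show "\<nu> / s \<le> 2" using s by (simp add: field_simps)
    have "?e \<ge> 0" using s by (intro sum_nonneg) auto
    then show "?e \<le> 2 * ?e" by simp
    show "?o \<ge> 0" using s by (intro sum_nonneg) auto
  qed (use lead_const_pos[OF \<nu>] in \<open>simp add: less_imp_le\<close>)
  also have "2 * ?e + 2 * ?o = 2 * (1 + s) ^ (2 * r)"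
    using power_one_plus_even_odd[of "2 * r" r s] by simp
  finally show ?thesis by (simp add: mult_ac)
qed

text \<open>The coefficients are real and 1/z is the conjugate of \<open>z\<close>, so
  \<open>hypY\<close> is z^r times the conjugate of \<open>hypX\<close>.\<close>

lemma norm_hypY_circle:
  assumes "cmod z = 1"
  shows "cmod (hypY \<nu> r z) = cmod (hypX \<nu> r z)"
proof -
  have zz: "z * cnj z = 1" using assms by (simp add: complex_norm_square[symmetric])
  have "hypY \<nu> r z = (\<Sum>k\<le>r. of_real (hyp_coeff \<nu> r k) * z ^ (r - k))"
    unfolding hypY_def by (rule sum.reindex_bij_witness[of _ "\<lambda>k. r - k" "\<lambda>k. r - k"]) auto
  also have "\<dots> = (\<Sum>k\<le>r. z ^ r * cnj (of_real (hyp_coeff \<nu> r k) * z ^ k))"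
  proof (rule sum.cong)
    fix k assume "k \<in> {..r}"
    then have "z ^ r = z ^ (r - k) * z ^ k" by (simp add: power_add[symmetric])
    moreover have "z ^ k * cnj z ^ k = 1" by (simp add: power_mult_distrib[symmetric] zz)
    ultimately have "z ^ r * cnj z ^ k = z ^ (r - k)" by (simp add: mult.assoc)
    then show "of_real (hyp_coeff \<nu> r k) * z ^ (r - k) = z ^ r * cnj (of_real (hyp_coeff \<nu> r k) * z ^ k)"
      by (simp add: mult_ac)
  qed simp
  also have "\<dots> = z ^ r * cnj (hypX \<nu> r z)" by (simp add: hypX_def sum_distrib_left)
  finally show ?thesis using assms by (simp add: norm_mult norm_power)
qed

text \<open>On the unit circle, \<open>hypX\<close> is up to a factor the \<open>r\<close>-th Taylor coefficient of
  \<open>(1 + z t)\<^sup>r\<^sup>+\<^sup>\<nu> (1 + t)\<^sup>r\<^sup>-\<^sup>\<nu>\<close>, which Cauchy's inequality bounds: both \<open>|1 + z t|\<close> and \<open>|1 + t|\<close> are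
  at most \<open>2\<close>, and their product is at most \<open>|1 + y|\<^sup>2\<close>, where \<open>y\<^sup>2 = z\<close>.\<close>

lemma hypX_circle_le:
  assumes \<nu>: "0 < \<nu>" "\<nu> < 1" and y: "cmod y = 1" "Re y \<ge> 0"
  shows "cmod (hypX \<nu> r (y\<^sup>2)) \<le> 2 * lead_const \<nu> r * cmod (1 + y) ^ (2 * r)"
proof (cases "r = 0")
  case True
  then show ?thesis by (simp add: hypX_def hyp_coeff_def lead_const_def)
next
  case False
  define z where "z = y\<^sup>2"
  have z: "cmod z = 1" using y by (simp add: z_def norm_power)
  define M where "M = (cmod (1 + y))\<^sup>2"
  have yy: "(Re y)\<^sup>2 + (Im y)\<^sup>2 = 1" using y(1) by (simp add: cmod_def)
  have M: "M = 2 + 2 * Re y"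
    unfolding M_def cmod_power2 using yy by (simp add: power2_eq_square algebra_simps)
  have one_z: "cmod (1 + z) = 2 * Re y"
  proof -
    have "1 + z = y * cnj y + y * y"
      using y(1) by (simp add: z_def power2_eq_square complex_norm_square[symmetric])
    also have "\<dots> = y * of_real (2 * Re y)" by (simp add: complex_eq_iff algebra_simps)
    finally show ?thesis using y by (simp only: norm_mult norm_of_real)
  qed
  define f where "f t = (1 + z * t) powr of_real (real r + \<nu>) * (1 + t) powr of_real (real r - \<nu>)" for t
  define F where "F = fps_compose (fps_binomial (of_real (real r + \<nu>))) (fps_const z * fps_X)
     * fps_binomial (complex_of_real (real r - \<nu>))"
  have pos: "1 + u \<notin> \<real>\<^sub>\<le>\<^sub>0" if "cmod u < 1" for u :: complex
  proof
    assume "1 + u \<in> \<real>\<^sub>\<le>\<^sub>0"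
    then have "Re u \<le> -1" by (simp add: complex_nonpos_Reals_iff)
    then show False using abs_Re_le_cmod[of u] that by linarith
  qed
  have fF: "f has_fps_expansion F"
  proof -
    have "(\<lambda>t. z * t) has_fps_expansion fps_const z * fps_X" by (intro fps_expansion_intros)
    then have "((\<lambda>x. (1 + x) powr of_real (real r + \<nu>)) \<circ> (\<lambda>t. z * t)) has_fps_expansion
       fps_compose (fps_binomial (of_real (real r + \<nu>))) (fps_const z * fps_X)"
      by (intro has_fps_expansion_compose has_fps_expansion_binomial_complex) simp_all
    then show ?thesis
      unfolding f_def[abs_def] F_def o_def
      by (intro has_fps_expansion_mult has_fps_expansion_binomial_complex)
  qed
  have Fr: "lead_const \<nu> r * fps_nth F r = hypX \<nu> r z"
  proof -
    have "fps_nth F r = (\<Sum>k\<le>r. z ^ k * of_real ((real r + \<nu>) gchoose k) * of_real ((real r - \<nu>) gchoose (r - k)))"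
      unfolding F_def fps_mult_nth fps_compose_linear
      by (simp add: atLeast0AtMost gbinomial_prod_rev)
    then have "lead_const \<nu> r * fps_nth F r = (\<Sum>k\<le>r. of_real (lead_const \<nu> r *
        (((real r + \<nu>) gchoose k) * ((real r - \<nu>) gchoose (r - k)))) * z ^ k)"
      by (simp add: sum_distrib_left mult_ac)
    also have "\<dots> = hypX \<nu> r z"
      unfolding hypX_def by (intro sum.cong refl) (simp only: hyp_coeff_lead[OF \<nu>] atMost_iff)
    finally show ?thesis .
  qed
  \<comment> \<open>The principal powers have their branch points on the unit circle, at t = -1 and
    t = -1/z; hence radius \<rho> < 1, with \<rho> tending to 1 afterwards.\<close>
  have bound: "cmod (fps_nth F r) * \<rho> ^ r \<le> 2 * M ^ r" if \<rho>: "0 < \<rho>" "\<rho> < 1" for \<rho>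
  proof -
    have "cmod ((deriv ^^ r) f 0) \<le> fact r * (2 * M ^ r) / \<rho> ^ r"
    proof (rule Cauchy_inequality)
      have hol: "f holomorphic_on cball 0 \<rho>"
        unfolding f_def using \<rho> z
        by (intro holomorphic_intros pos) (auto simp: norm_mult)
      then show "continuous_on (cball 0 \<rho>) f" by (rule holomorphic_on_imp_continuous_on)
      show "f holomorphic_on ball 0 \<rho>" using hol by (rule holomorphic_on_subset) auto
      fix t assume "cmod (0 - t) = \<rho>"
      then have t: "cmod t = \<rho>" by simp
      define a b where "a = cmod (1 + z * t)" and "b = cmod (1 + t)"
      have ab0: "a > 0" "b > 0"
        using pos[of "z * t"] pos[of t] t \<rho> z by (auto simp: a_def b_def norm_mult)
      have a2: "a \<le> 2" using norm_triangle_ineq[of 1 "z * t"] t \<rho> z by (simp add: a_def norm_mult)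
      have "a * b = cmod (1 + z * t\<^sup>2 + (1 + z) * t)"
        by (simp add: a_def b_def norm_mult[symmetric] algebra_simps power2_eq_square)
      also have "\<dots> \<le> cmod 1 + cmod (z * t\<^sup>2) + cmod ((1 + z) * t)"
        by (intro order_trans[OF norm_triangle_ineq] add_mono norm_triangle_ineq order_refl)
      also have "\<dots> \<le> 1 + 1 + 2 * Re y"
        using t \<rho> z y one_z by (intro add_mono) (auto simp: norm_mult norm_power power_le_one mult_left_le)
      finally have abM: "a * b \<le> M" using M by simp
      have M2: "M \<ge> 2" using M y by simp
      \<comment> \<open>The case \<open>r = 0\<close> was split off for this: monotonicity of
        \<open>powr\<close> in its base needs a non-negative exponent.\<close>
      have r1: "real r - \<nu> \<ge> 0" using False \<nu> by (cases r) auto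
      have "cmod (f t) = a powr (real r + \<nu>) * b powr (real r - \<nu>)"
        by (simp add: f_def a_def b_def norm_mult norm_powr_real_powr')
      also have "\<dots> = (a * b) powr (real r - \<nu>) * (a powr \<nu> * a powr \<nu>)"
      proof -
        have "a powr (real r + \<nu>) = a powr ((real r - \<nu>) + (\<nu> + \<nu>))"
          by (rule arg_cong[where f = "(powr) a"]) simp
        also have "\<dots> = a powr (real r - \<nu>) * (a powr \<nu> * a powr \<nu>)" by (simp only: powr_add)
        finally show ?thesis using ab0 by (simp add: powr_mult)
      qed
      also have "\<dots> \<le> M powr (real r - \<nu>) * (2 powr \<nu> * 2 powr \<nu>)"
        using ab0 abM a2 r1 \<nu> by (intro mult_mono powr_mono2) auto
      \<comment> \<open>As M \<ge> 2, one factor 2^\<nu> completes the exponent of M to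
        \<open>r\<close>; the other is the source of the constant 2.\<close>
      also have "\<dots> \<le> M powr (real r - \<nu>) * (M powr \<nu> * 2 powr 1)"
        using M2 \<nu> by (intro mult_left_mono mult_mono powr_mono2 powr_mono) auto
      also have "\<dots> = 2 * M powr (real r)"
      proof -
        have "M powr (real r - \<nu>) * M powr \<nu> = M powr real r" by (simp flip: powr_add)
        then show ?thesis using M2 by simp
      qed
      also have "\<dots> = 2 * M ^ r" using M2 by (simp add: powr_realpow)
      finally show "cmod (f t) \<le> 2 * M ^ r" .
    qed (use \<rho> in auto)
    then show ?thesis
      using \<rho> by (simp add: fps_nth_fps_expansion[OF fF] norm_divide field_simps)
  qed
  have "cmod (fps_nth F r) \<le> 2 * M ^ r"
  proof (rule tendsto_upperbound)
    show "((\<lambda>\<rho>. cmod (fps_nth F r) * \<rho> ^ r) \<longlongrightarrow> cmod (fps_nth F r)) (at_left 1)"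
      by (auto intro!: tendsto_eq_intros)
    show "\<forall>\<^sub>F \<rho> in at_left 1. cmod (fps_nth F r) * \<rho> ^ r \<le> 2 * M ^ r"
      by (rule eventually_mono[OF eventually_at_left_real[of 0 1]]) (auto intro: bound)
  qed simp
  then have "lead_const \<nu> r * cmod (fps_nth F r) \<le> lead_const \<nu> r * (2 * M ^ r)"
    using lead_const_pos[OF \<nu>, of r] by (intro mult_left_mono) auto
  moreover have "cmod (hypX \<nu> r z) = lead_const \<nu> r * cmod (fps_nth F r)"
    using lead_const_pos[OF \<nu>, of r] unfolding Fr[symmetric] by (simp add: norm_mult)
  ultimately show ?thesis by (simp add: z_def M_def power_mult)
qed

lemma hyp_norm_le:
  assumes \<nu>: "0 < \<nu>" "\<nu> < 1" and L: "admissible_log L" "Im L = 0 \<Longrightarrow> \<nu> \<le> 2 * exp (Re L / 2)"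
  shows "cmod (hypX \<nu> r (exp L)) \<le> 2 * lead_const \<nu> r * cmod (1 + exp (L / 2)) ^ (2 * r)"
    and "cmod (hypY \<nu> r (exp L)) \<le> 2 * lead_const \<nu> r * cmod (1 + exp (L / 2)) ^ (2 * r)"
proof -
  have "cmod (hypX \<nu> r (exp L)) \<le> 2 * lead_const \<nu> r * cmod (1 + exp (L / 2)) ^ (2 * r) \<and>
    cmod (hypY \<nu> r (exp L)) \<le> 2 * lead_const \<nu> r * cmod (1 + exp (L / 2)) ^ (2 * r)"
  proof (cases "Im L = 0")
    case True
    define s where "s = exp (Re L / 2)"
    have s: "0 < s" "s \<le> 1" "\<nu> \<le> 2 * s"
      using L True by (auto simp: s_def admissible_log_def)
    have L2: "exp (L / 2) = of_real s"
      using True by (simp add: s_def exp_of_real[symmetric] complex_eq_iff Re_exp Im_exp)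
    have eL: "exp (Re L) = s\<^sup>2"
      by (simp add: s_def power2_eq_square exp_add[symmetric])
    have n: "cmod (1 + exp (L / 2)) = 1 + s"
      unfolding L2 using s by (metis abs_of_nonneg add_nonneg_nonneg less_imp_le norm_of_real of_real_1 of_real_add zero_le_one)
    have "cmod (hypX \<nu> r (exp L)) \<le> (\<Sum>k\<le>r. \<bar>hyp_coeff \<nu> r k\<bar> * s ^ (2 * k))"
      unfolding hypX_def by (intro order_trans[OF norm_sum]) (simp add: norm_mult norm_power eL power_mult)
    also have "\<dots> \<le> lead_const \<nu> r * (1 + s) ^ (2 * r)" using hypX_real_le[OF \<nu>, of s r] s by simp
    also have "\<dots> \<le> 2 * lead_const \<nu> r * (1 + s) ^ (2 * r)"
      using lead_const_pos[OF \<nu>, of r] s by simp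
    finally have 1: "cmod (hypX \<nu> r (exp L)) \<le> 2 * lead_const \<nu> r * (1 + s) ^ (2 * r)" .
    have "cmod (hypY \<nu> r (exp L)) \<le> (\<Sum>k\<le>r. \<bar>hyp_coeff \<nu> r (r - k)\<bar> * s ^ (2 * k))"
      unfolding hypY_def by (intro order_trans[OF norm_sum]) (simp add: norm_mult norm_power eL power_mult)
    also have "\<dots> \<le> 2 * lead_const \<nu> r * (1 + s) ^ (2 * r)" by (rule hypY_real_le[OF \<nu> s])
    finally show ?thesis using 1 by (simp add: n)
  next
    case False
    then have R: "Re L = 0" "\<bar>Im L\<bar> \<le> pi" using L(1) by (auto simp: admissible_log_def)
    have "(exp (L / 2))\<^sup>2 = exp L" by (simp add: power2_eq_square exp_add[symmetric])
    moreover have "Re (exp (L / 2)) \<ge> 0"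
      using R by (auto simp: Re_exp intro!: cos_ge_zero)
    ultimately have "cmod (hypX \<nu> r (exp L)) \<le> 2 * lead_const \<nu> r * cmod (1 + exp (L / 2)) ^ (2 * r)"
      using hypX_circle_le[OF \<nu>, of "exp (L / 2)" r] R by simp
    moreover have "cmod (exp L) = 1" using R by simp
    ultimately show ?thesis by (simp add: norm_hypY_circle)
  qed
  then show "cmod (hypX \<nu> r (exp L)) \<le> 2 * lead_const \<nu> r * cmod (1 + exp (L / 2)) ^ (2 * r)"
    "cmod (hypY \<nu> r (exp L)) \<le> 2 * lead_const \<nu> r * cmod (1 + exp (L / 2)) ^ (2 * r)" by auto
qed

section \<open>Comparison of the logarithm with 1 - W^(1/n)\<close>

lemma half_le_sin: assumes "0 \<le> x" "x \<le> pi / 3" shows "x / 2 \<le> sin x"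
proof -
  have "sin 0 - 0 / 2 \<le> sin x - x / 2"
  proof (rule DERIV_nonneg_imp_nondecreasing[OF assms(1)])
    fix t assume t: "0 \<le> t" "t \<le> x"
    have "cos t \<ge> cos (pi / 3)" using t assms by (intro cos_monotone_0_pi_le) auto
    then have "cos t - 1 / 2 \<ge> 0" by (simp add: cos_60)
    moreover have "((\<lambda>x. sin x - x / 2) has_real_derivative cos t - 1 / 2) (at t)"
      by (auto intro!: derivative_eq_intros)
    ultimately show "\<exists>y. ((\<lambda>x. sin x - x / 2) has_real_derivative y) (at t) \<and> 0 \<le> y" by blast
  qed
  then show ?thesis by simp
qed

text \<open>Replaces the length |L| in the remainder by the factor |1 - W^(1/n)| that occurs in
  \<open>c\<close>. In the real case, with v = -\<nu> Re L, one has v \<le> (1 + v)(1 - e^(-v)), and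
  v \<le> 3/2 makes 1 + v \<le> 5/2; on the circle |t| \<le> 2 |sin t| is enough.\<close>

lemma norm_log_le:
  assumes \<nu>: "0 < \<nu>" "\<nu> \<le> 1 / 3" and L: "admissible_log L" "Im L = 0 \<Longrightarrow> 1 / 6 \<le> exp (Re L / 2)"
  shows "\<nu> * cmod L \<le> 5 / 2 * cmod (1 - exp (of_real \<nu> * L))"
proof (cases "Im L = 0")
  case True
  define v where "v = - \<nu> * Re L"
  have R: "Re L \<le> 0" using L(1) True by (auto simp: admissible_log_def)
  have v0: "v \<ge> 0" using R \<nu> by (simp add: v_def mult_nonneg_nonpos)
  \<comment> \<open>Squaring e^(9/8) \<ge> 5/2 gives e^(9/4) \<ge> 6, so the lower bound 1/6 for
    e^(Re L / 2) becomes Re L \<ge> -9/2, and \<nu> \<le> 1/3 gives v \<le> 3/2.\<close>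
  have "exp (9 / 8 :: real) \<ge> 1 + 9 / 8 + (9 / 8)\<^sup>2 / 2" by (rule exp_lower_Taylor_quadratic) simp
  then have e: "exp (9 / 8 :: real) \<ge> 5 / 2" by (simp add: power2_eq_square)
  have "(5 / 2) * (5 / 2) \<le> exp (9 / 8) * exp (9 / 8 :: real)" by (intro mult_mono e) auto
  also have "\<dots> = exp (9 / 4)" by (simp add: exp_add[symmetric])
  finally have "6 \<le> exp (9 / 4 :: real)" by simp
  then have "exp (- (9 / 4)) \<le> (1 / 6 :: real)" by (simp add: exp_minus field_simps)
  also have "\<dots> \<le> exp (Re L / 2)" using L(2) True by simp
  finally have "- (9 / 2) \<le> Re L" by simp
  then have "v \<le> (1 / 3) * (9 / 2)" unfolding v_def using R \<nu> mult_mono[of \<nu> "1/3" "- Re L" "9/2"] by simp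
  then have v1: "v \<le> 3 / 2" by simp
  have "exp (- v) \<le> 1 / (1 + v)"
    using exp_ge_add_one_self[of v] v0 by (simp add: exp_minus field_simps)
  then have "v / (1 + v) \<le> 1 - exp (- v)" using v0 by (simp add: field_simps)
  moreover have "v / (5 / 2) \<le> v / (1 + v)" using v0 v1 by (intro divide_left_mono) auto
  ultimately have "v / (5 / 2) \<le> 1 - exp (- v)" by (rule order_trans[rotated])
  then have 1: "v \<le> 5 / 2 * (1 - exp (- v))" by simp
  have "exp (of_real \<nu> * L) = of_real (exp (- v))"
    using True by (simp add: v_def exp_of_real[symmetric] complex_eq_iff Re_exp Im_exp)
  then have "1 - exp (of_real \<nu> * L) = of_real (1 - exp (- v))" by simp
  then have "cmod (1 - exp (of_real \<nu> * L)) = 1 - exp (- v)" using v0 by (simp only: norm_of_real) simp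
  moreover have "\<nu> * cmod L = v" using True R by (simp add: v_def cmod_eq_Re)
  ultimately show ?thesis using 1 by simp
next
  case False
  then have R: "Re L = 0" "\<bar>Im L\<bar> \<le> pi" using L(1) by (auto simp: admissible_log_def)
  define t where "t = \<nu> * Im L / 2"
  have "\<bar>t\<bar> = \<nu> * \<bar>Im L\<bar> / 2" using \<nu> by (simp add: t_def abs_mult)
  also have "\<dots> \<le> (1 / 3) * pi / 2" using \<nu> R by (intro divide_right_mono mult_mono) auto
  finally have t: "\<bar>t\<bar> \<le> pi / 3" using pi_gt_zero by linarith
  have "\<bar>t\<bar> / 2 \<le> sin \<bar>t\<bar>" by (rule half_le_sin) (use t in auto)
  also have "\<dots> \<le> \<bar>sin t\<bar>" by (auto simp: abs_if)
  finally have 1: "\<bar>t\<bar> / 2 \<le> \<bar>sin t\<bar>" .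
  have "exp (of_real \<nu> * L) = cis (2 * t)"
    using R by (simp add: t_def complex_eq_iff Re_exp Im_exp)
  then have "cmod (1 - exp (of_real \<nu> * L)) = 2 * \<bar>sin t\<bar>" by (simp add: norm_one_minus_cis)
  moreover have "\<nu> * cmod L = 2 * \<bar>t\<bar>" using R \<nu> by (simp add: t_def cmod_eq_Im abs_mult)
  ultimately show ?thesis using 1 by simp
qed

lemma hyp_remainder_le:
  assumes \<nu>: "0 < \<nu>" "\<nu> \<le> 1 / 3" and L: "admissible_log L" "Im L = 0 \<Longrightarrow> 1 / 6 \<le> exp (Re L / 2)"
  shows "cmod (hypX \<nu> r (exp L) - exp (of_real \<nu> * L) * hypY \<nu> r (exp L))
     \<le> 5 / 2 * (rem_const \<nu> r / \<nu>) * cmod (1 - exp (of_real \<nu> * L)) * cmod (1 - exp (L / 2)) ^ (2 * r)"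
proof -
  have B: "rem_const \<nu> r \<ge> 0" using \<nu> by (auto simp: rem_const_def intro!: divide_nonneg_pos pochhammer_nonneg)
  have "cmod (hypX \<nu> r (exp L) - exp (of_real \<nu> * L) * hypY \<nu> r (exp L))
     \<le> rem_const \<nu> r * cmod (1 - exp (L / 2)) ^ (2 * r) * cmod L"
    by (rule pade_remainder_le) (use \<nu> L in auto)
  also have "\<dots> = rem_const \<nu> r / \<nu> * cmod (1 - exp (L / 2)) ^ (2 * r) * (\<nu> * cmod L)"
    using \<nu> by simp
  also have "\<dots> \<le> rem_const \<nu> r / \<nu> * cmod (1 - exp (L / 2)) ^ (2 * r) * (5 / 2 * cmod (1 - exp (of_real \<nu> * L)))"
    using B \<nu> by (intro mult_left_mono norm_log_le L) auto
  finally show ?thesis by (simp add: mult_ac)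
qed

section \<open>Non-vanishing of the determinants of consecutive approximants\<close>

lemma hyp_coeff_0 [simp]: "hyp_coeff \<nu> r 0 = 1"
  by (simp add: hyp_coeff_def)

lemma hyp_coeff_nonneg:
  assumes "0 < \<nu>" "\<nu> < 1" "k \<le> r"
  shows "hyp_coeff \<nu> r k \<ge> 0"
  unfolding hyp_coeff_lead[OF assms] using assms lead_const_pos[of \<nu> r]
    gbinomial_shift_le(2)[of k r \<nu>] gbinomial_minus_le(2)[of "r - k" r \<nu>] by simp

lemma hyp_coeff_last:
  assumes "0 < \<nu>" "\<nu> < 1"
  shows "hyp_coeff \<nu> r r = pochhammer (1 + \<nu>) r / pochhammer (1 - \<nu>) r"
  using hyp_coeff_lead[OF assms, of r r] gbinomial_pochhammer'[of "real r + \<nu>" r]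
  by (simp add: lead_const_def add.commute)

text \<open>The difference of these two leading coefficients is the value at 0 of the determinant of
  consecutive approximants.\<close>

lemma hyp_coeff_last_less:
  assumes "0 < \<nu>" "\<nu> < 1"
  shows "hyp_coeff \<nu> r r < hyp_coeff \<nu> (Suc r) (Suc r)"
proof -
  define p where "p = hyp_coeff \<nu> r r"
  have p: "p > 0" using assms by (simp add: p_def hyp_coeff_last pochhammer_pos_1 pochhammer_pos)
  define q where "q = (1 + \<nu> + real r) / (1 - \<nu> + real r)"
  have "hyp_coeff \<nu> (Suc r) (Suc r) = p * q"
    using assms unfolding p_def q_def by (simp add: hyp_coeff_last pochhammer_Suc)
  moreover have "q > 1" using assms by (simp add: q_def)
  ultimately show ?thesis using p unfolding p_def[symmetric] by simp
qed

text \<open>The sum is the value of \<open>hypX\<close> at 1, which is also the constant term of the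
  polynomial in 1 - d x.\<close>

lemma sum_hyp_coeff:
  assumes "0 < \<nu>" "\<nu> < 1"
  shows "1 \<le> (\<Sum>k\<le>r. hyp_coeff \<nu> r k)" "(\<Sum>k\<le>r. hyp_coeff \<nu> r k) \<le> lead_const \<nu> r * 4 ^ r"
proof -
  have "hyp_coeff \<nu> r 0 \<le> (\<Sum>k\<le>r. hyp_coeff \<nu> r k)"
    by (rule member_le_sum) (use hyp_coeff_nonneg[OF assms] in auto)
  then show "1 \<le> (\<Sum>k\<le>r. hyp_coeff \<nu> r k)" by simp
  have "(\<Sum>k\<le>r. hyp_coeff \<nu> r k) = (\<Sum>k\<le>r. \<bar>hyp_coeff \<nu> r k\<bar> * 1 ^ (2 * k))"
    using hyp_coeff_nonneg[OF assms] by (intro sum.cong) auto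
  also have "\<dots> \<le> lead_const \<nu> r * (1 + 1) ^ (2 * r)" by (rule hypX_real_le[OF assms]) auto
  finally show "(\<Sum>k\<le>r. hyp_coeff \<nu> r k) \<le> lead_const \<nu> r * 4 ^ r" by (simp add: power_mult)
qed

text \<open>The bound near 1 forces a zero of order at least \<open>m\<close> there, and the degree
  leaves room only for a constant cofactor.\<close>

lemma poly_eq_const_times_power:
  fixes p :: "complex poly"
  assumes deg: "degree p \<le> m"
    and bound: "\<And>z::real. 1 / 2 < z \<Longrightarrow> z < 1 \<Longrightarrow> cmod (poly p (of_real z)) \<le> C * (1 - z) ^ m"
  shows "\<exists>c. p = smult c ([:-1, 1:] ^ m)"
proof (cases "p = 0")
  case True
  then show ?thesis by (intro exI[of _ 0]) simp
next
  case False
  define k where "k = order 1 p"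
  obtain q where q: "p = [:-1, 1:] ^ k * q" "\<not> [:-1, 1:] dvd q"
    using order_decomp[OF False, of 1] unfolding k_def by auto
  have q1: "poly q 1 \<noteq> 0" using q(2) by (simp add: poly_eq_0_iff_dvd)
  have q0: "q \<noteq> 0" using q1 by auto
  have dp: "degree p = k + degree q"
    using q0 unfolding q(1) by (subst degree_mult_eq) (auto simp: degree_linear_power)
  have "m \<le> k"
  proof (rule ccontr)
    assume "\<not> m \<le> k"
    then have mk: "m = k + (m - k)" "m - k > 0" by auto
    have le: "cmod (poly q (of_real z)) \<le> C * (1 - z) ^ (m - k)" if z: "1 / 2 < z" "z < 1" for z :: real
    proof -
      have "cmod (of_real z - 1) = 1 - z"
      proof -
        have "complex_of_real z - 1 = of_real (z - 1)" by simp
        then show ?thesis using z by (simp only: norm_of_real)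
      qed
      then have "(1 - z) ^ k * cmod (poly q (of_real z)) = cmod (poly p (of_real z))"
        by (simp add: q(1) norm_mult norm_power)
      also have "\<dots> \<le> C * (1 - z) ^ (k + (m - k))" using bound[OF z] mk(1) by simp
      also have "\<dots> = (1 - z) ^ k * (C * (1 - z) ^ (m - k))" by (simp only: power_add mult_ac)
      finally show ?thesis using z by simp
    qed
    have "cmod (poly q (of_real 1)) \<le> 0"
    proof (rule tendsto_le)
      show "((\<lambda>z. cmod (poly q (of_real z))) \<longlongrightarrow> cmod (poly q (of_real 1))) (at_left 1)"
        by (intro tendsto_intros)
      show "((\<lambda>z. C * (1 - z) ^ (m - k)) \<longlongrightarrow> 0) (at_left 1)"
        using mk(2) by (auto intro!: tendsto_eq_intros)
      show "\<forall>\<^sub>F z in at_left 1. cmod (poly q (of_real z)) \<le> C * (1 - z) ^ (m - k)"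
        by (rule eventually_mono[OF eventually_at_left_real[of "1/2" 1]]) (auto intro: le)
    qed simp
    then show False using q1 by simp
  qed
  then have *: "degree q = 0" "k = m" using dp deg by auto
  then obtain c where "q = [:c:]" by (auto elim: degree_eq_zeroE)
  with q(1) * have "p = smult c ([:-1, 1:] ^ m)" by (simp add: mult.commute)
  then show ?thesis by blast
qed

text \<open>The determinant is a polynomial of degree at most \<open>2 r + 1\<close>, it vanishes at \<open>1\<close> to this order by the
  bound for \<open>hypX - z\<^sup>\<nu> hypY\<close>, and it does not vanish at \<open>0\<close>.\<close>

lemma hyp_det_nonzero:
  assumes \<nu>: "0 < \<nu>" "\<nu> < 1" and z: "z \<noteq> 1"
  shows "hypX \<nu> r z * hypY \<nu> (Suc r) z \<noteq> hypX \<nu> (Suc r) z * hypY \<nu> r z"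
proof -
  define PX where "PX r = (\<Sum>k\<le>r. monom (complex_of_real (hyp_coeff \<nu> r k)) k)" for r
  define PY where "PY r = (\<Sum>k\<le>r. monom (complex_of_real (hyp_coeff \<nu> r (r - k))) k)" for r
  define P where "P = PX r * PY (Suc r) - PX (Suc r) * PY r"
  have degX: "degree (PX s) \<le> s" and degY: "degree (PY s) \<le> s" for s
    unfolding PX_def PY_def by (intro degree_sum_le; force intro: order_trans[OF degree_monom_le])+
  have dP: "degree P \<le> 2 * r + 1"
  proof -
    have "degree (PX r * PY (Suc r)) \<le> r + Suc r"
      by (rule order_trans[OF degree_mult_le]) (intro add_mono degX degY)
    moreover have "degree (PX (Suc r) * PY r) \<le> Suc r + r"
      by (rule order_trans[OF degree_mult_le]) (intro add_mono degX degY)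
    ultimately show ?thesis unfolding P_def by (intro degree_diff_le) auto
  qed
  have cX: "poly (PX s) u = hypX \<nu> s u" and cY: "poly (PY s) u = hypY \<nu> s u" for s u
    unfolding PX_def PY_def hypX_def hypY_def by (simp_all add: poly_sum poly_monom)
  define S where "S s = (\<Sum>k\<le>s. \<bar>hyp_coeff \<nu> s (s - k)\<bar>)" for s
  have Yle: "cmod (hypY \<nu> s (of_real u)) \<le> S s" if "0 \<le> u" "u \<le> 1" for s u
    unfolding hypY_def S_def using that
    by (intro order_trans[OF norm_sum] sum_mono) (simp add: norm_mult norm_power power_le_one mult_left_le)
  have S0: "S s \<ge> 0" for s by (simp add: S_def sum_nonneg)
  have B: "rem_const \<nu> s \<ge> 0" for s using \<nu> by (auto simp: rem_const_def intro!: divide_nonneg_pos pochhammer_nonneg)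
  have rem: "cmod (hypX \<nu> s (of_real u) - of_real (u powr \<nu>) * hypY \<nu> s (of_real u)) \<le> rem_const \<nu> s * (1 - u) ^ (2 * s) * (2 * (1 - u))"
    if u: "1 / 2 < u" "u < 1" for s u
  proof -
    define L where "L = complex_of_real (ln u)"
    have "admissible_log L" using u by (simp add: admissible_log_def L_def)
    note R = pade_remainder_le[OF \<nu> this, of s]
    have 1: "exp L = of_real u" using u by (simp add: L_def exp_of_real)
    have 2: "exp (of_real \<nu> * L) = of_real (u powr \<nu>)"
      using u by (simp add: L_def powr_def exp_of_real[symmetric])
    have 3: "exp (L / 2) = of_real (sqrt u)"
    proof -
      have "L / 2 = of_real (ln (sqrt u))" using u by (simp add: L_def ln_sqrt)
      then show ?thesis using u by (simp only: exp_of_real exp_ln real_sqrt_gt_0_iff)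
    qed
    have s: "u \<le> sqrt u" "sqrt u \<le> 1" using u by (auto intro!: real_le_rsqrt simp: power2_eq_square mult_left_le)
    have 4: "cmod (1 - exp (L / 2)) = 1 - sqrt u"
    proof -
      have "1 - exp (L / 2) = of_real (1 - sqrt u)" by (simp add: 3)
      then show ?thesis using s by (simp only: norm_of_real)
    qed
    have 5: "cmod L \<le> 2 * (1 - u)"
    proof -
      have "ln (1 / u) \<le> 1 / u - 1" using u by (intro ln_le_minus_one) auto
      then have "- ln u \<le> (1 - u) / u" using u by (simp add: ln_div field_simps)
      also have "\<dots> \<le> (1 - u) / (1 / 2)" using u by (intro divide_left_mono) auto
      finally show ?thesis using u by (simp add: L_def)
    qed
    have "cmod (hypX \<nu> s (of_real u) - of_real (u powr \<nu>) * hypY \<nu> s (of_real u))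
        \<le> rem_const \<nu> s * (1 - sqrt u) ^ (2 * s) * cmod L" using R by (simp only: 1 2 4)
    also have "\<dots> \<le> rem_const \<nu> s * (1 - u) ^ (2 * s) * (2 * (1 - u))"
      using s u 5 B by (intro mult_mono power_mono) auto
    finally show ?thesis .
  qed
  have "cmod (poly P (of_real u)) \<le> (2 * rem_const \<nu> r * S (Suc r) + 2 * rem_const \<nu> (Suc r) * S r) * (1 - u) ^ (2 * r + 1)"
    if u: "1 / 2 < u" "u < 1" for u
  proof -
    define e where "e s = hypX \<nu> s (of_real u) - of_real (u powr \<nu>) * hypY \<nu> s (of_real u)" for s
    \<comment> \<open>In this combination the terms with u^\<nu> cancel, so the determinant inherits
      the smallness of the two remainders.\<close>
    have "poly P (of_real u) = e r * hypY \<nu> (Suc r) (of_real u) - e (Suc r) * hypY \<nu> r (of_real u)"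
      by (simp add: P_def e_def cX cY algebra_simps)
    also have "cmod \<dots> \<le> cmod (e r) * cmod (hypY \<nu> (Suc r) (of_real u)) + cmod (e (Suc r)) * cmod (hypY \<nu> r (of_real u))"
      unfolding norm_mult[symmetric] by (rule norm_triangle_ineq4)
    also have "\<dots> \<le> rem_const \<nu> r * (1 - u) ^ (2 * r) * (2 * (1 - u)) * S (Suc r)
        + rem_const \<nu> (Suc r) * (1 - u) ^ (2 * r) * (2 * (1 - u)) * S r"
    proof (intro add_mono mult_mono)
      show "cmod (e r) \<le> rem_const \<nu> r * (1 - u) ^ (2 * r) * (2 * (1 - u))" unfolding e_def by (rule rem[OF u])
      have "cmod (e (Suc r)) \<le> rem_const \<nu> (Suc r) * (1 - u) ^ (2 * Suc r) * (2 * (1 - u))"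
        unfolding e_def by (rule rem[OF u])
      also have "\<dots> \<le> rem_const \<nu> (Suc r) * (1 - u) ^ (2 * r) * (2 * (1 - u))"
        using u B by (intro mult_mono power_decreasing) auto
      finally show "cmod (e (Suc r)) \<le> rem_const \<nu> (Suc r) * (1 - u) ^ (2 * r) * (2 * (1 - u))" .
    qed (use Yle u B S0 in \<open>auto intro!: mult_nonneg_nonneg\<close>)
    finally show ?thesis by (simp add: algebra_simps)
  qed
  from poly_eq_const_times_power[OF dP this] obtain c where c: "P = smult c ([:-1, 1:] ^ (2 * r + 1))"
    by blast
  have at0: "poly (PX s) 0 = 1" "poly (PY s) 0 = of_real (hyp_coeff \<nu> s s)" for s
  proof -
    have "poly (PX s) 0 = (\<Sum>k\<le>s. if k = 0 then of_real (hyp_coeff \<nu> s k) else 0)"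
      unfolding PX_def poly_sum poly_monom by (intro sum.cong) auto
    then show "poly (PX s) 0 = 1" by simp
    have "poly (PY s) 0 = (\<Sum>k\<le>s. if k = 0 then of_real (hyp_coeff \<nu> s (s - k)) else 0)"
      unfolding PY_def poly_sum poly_monom by (intro sum.cong) auto
    then show "poly (PY s) 0 = of_real (hyp_coeff \<nu> s s)" by simp
  qed
  have "poly P 0 \<noteq> 0"
    using hyp_coeff_last_less[OF \<nu>, of r] by (simp add: P_def at0)
  then have c0: "c \<noteq> 0" by (auto simp: c)
  have "hypX \<nu> r z * hypY \<nu> (Suc r) z - hypX \<nu> (Suc r) z * hypY \<nu> r z = poly P z"
    by (simp add: P_def cX cY)
  also have "\<dots> = c * (z - 1) ^ (2 * r + 1)"
    by (simp add: c algebra_simps)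
  finally show ?thesis using c0 z by auto
qed

section \<open>Denominators and common factors of the coefficients\<close>

lemma of_rat_pochhammer: "of_rat (pochhammer a k) = pochhammer (of_rat a :: 'a :: field_char_0) k"
  by (induction k) (simp_all add: pochhammer_Suc of_rat_mult of_rat_add)

lemma of_rat_fact: "of_rat (fact k) = (fact k :: 'a :: field_char_0)"
  by (metis of_nat_fact of_rat_of_nat_eq)

lemma poly_altdef_le:
  fixes p :: "'a :: comm_semiring_1 poly"
  assumes "degree p \<le> r"
  shows "poly p x = (\<Sum>i\<le>r. coeff p i * x ^ i)"
  unfolding poly_altdef by (rule sum.mono_neutral_left) (use assms in \<open>auto simp: coeff_eq_0\<close>)

lemma of_rat_coeff_X_poly:
  "(of_rat (coeff (X_poly n r) k) :: real) = (if k \<le> r then hyp_coeff (1 / real n) r k else 0)"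
  by (simp add: X_poly_def coeff_truncate_fps hyp_coeff_def of_rat_divide of_rat_mult of_rat_pochhammer
      of_rat_diff of_rat_minus of_rat_fact less_Suc_eq_le)

lemma of_rat_coeff_X_poly_complex:
  "(of_rat (coeff (X_poly n r) k) :: complex) = (if k \<le> r then of_real (hyp_coeff (1 / real n) r k) else 0)"
proof -
  have "(of_rat q :: complex) = of_real (of_rat q)" for q
    by (cases q) (simp add: of_rat_rat)
  then show ?thesis by (simp add: of_rat_coeff_X_poly)
qed

lemma degree_X_poly: "degree (X_poly n r) \<le> r"
  unfolding X_poly_def using degree_truncate_fps[of "Suc r"] by (simp add: less_Suc_eq_le)

lemma poly_X_poly:
  "poly (map_poly of_rat (X_poly n r)) z = hypX (1 / real n) r z"
proof -
  have "poly (map_poly of_rat (X_poly n r)) z = (\<Sum>i\<le>r. coeff (map_poly of_rat (X_poly n r)) i * z ^ i)"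
    by (rule poly_altdef_le) (use degree_X_poly order_trans[OF degree_map_poly_le] in blast)
  then show ?thesis
    by (simp add: hypX_def coeff_map_poly of_rat_coeff_X_poly_complex)
qed

lemma ex_common_denominator:
  fixes f :: "'a \<Rightarrow> rat"
  assumes "finite A"
  shows "\<exists>D::nat. D > 0 \<and> (\<forall>i\<in>A. of_nat D * f i \<in> \<int>)"
  using assms
proof (induction A rule: finite_induct)
  case (insert x A)
  then obtain D :: nat where D: "D > 0" "\<forall>i\<in>A. of_nat D * f i \<in> \<int>" by blast
  obtain a b where ab: "f x = of_int a / of_int b" "b > 0" 
    by (metis quotient_of_div quotient_of_denom_pos surj_pair)
  have "of_nat (D * nat b) * f i \<in> \<int>" if "i \<in> insert x A" for i
  proof (cases "i = x")
    case True
    have "of_nat (D * nat b) * f i = of_int (int D * a)" using ab True by simp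
    then show ?thesis by (simp only: Ints_of_int)
  next
    case False
    then have "of_nat D * f i \<in> \<int>" using D that by auto
    then have "of_nat (nat b) * (of_nat D * f i) \<in> \<int>" by (rule Ints_mult[OF Ints_of_nat])
    then show ?thesis by (simp add: mult_ac)
  qed
  then show ?case using D ab by (intro exI[of _ "D * nat b"]) auto
qed auto

lemma D_num: "D_num n r > 0" "of_nat (D_num n r) * coeff (X_poly n r) i \<in> \<int>"
proof -
  obtain D :: nat where D: "D > 0" "\<forall>i\<in>{..r}. of_nat D * coeff (X_poly n r) i \<in> \<int>"
    using ex_common_denominator[of "{..r}"] by blast
  have "of_nat D * coeff (X_poly n r) i \<in> \<int>" for i
    using D(2) degree_X_poly[of n r] by (cases "i \<le> r") (auto simp: coeff_eq_0)
  then have "\<exists>D. D > 0 \<and> (\<forall>i. coeff (smult (of_nat D) (X_poly n r)) i \<in> \<int>)" using D(1) by auto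
  from LeastI_ex[OF this] show "D_num n r > 0" "of_nat (D_num n r) * coeff (X_poly n r) i \<in> \<int>"
    unfolding D_num_def[symmetric] by auto
qed

lemma pcompose_Ints:
  fixes p q :: "rat poly"
  assumes "\<And>i. coeff p i \<in> \<int>" "\<And>i. coeff q i \<in> \<int>"
  shows "coeff (pcompose p q) i \<in> \<int>"
  using assms(1)
proof (induction p arbitrary: i)
  case (pCons a p)
  have "coeff p i \<in> \<int>" for i using pCons.prems[of "Suc i"] by simp
  then have IH: "coeff (pcompose p q) i \<in> \<int>" for i using pCons.IH by blast
  have "a \<in> \<int>" using pCons.prems[of 0] by simp
  then show ?case
    by (auto simp: pcompose_pCons coeff_mult coeff_pCons intro!: Ints_sum Ints_mult Ints_add IH assms(2) split: nat.split)
qed auto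

definition shifted_X_poly :: "nat \<Rightarrow> nat \<Rightarrow> nat \<Rightarrow> rat poly" where
  "shifted_X_poly d n r = pcompose (X_poly n r) [:1, - of_nat d:]"

lemma shifted_X_poly_0:
  assumes "n \<ge> 2"
  shows "of_rat (coeff (shifted_X_poly d n r) 0) = (\<Sum>k\<le>r. hyp_coeff (1 / real n) r k)"
    and "coeff (shifted_X_poly d n r) 0 > 0"
proof -
  have "coeff (shifted_X_poly d n r) 0 = poly (X_poly n r) 1"
    by (simp add: shifted_X_poly_def poly_0_coeff_0[symmetric] poly_pcompose)
  also have "\<dots> = (\<Sum>i\<le>r. coeff (X_poly n r) i)"
    using poly_altdef_le[OF degree_X_poly, of n r 1] by simp
  finally show *: "of_rat (coeff (shifted_X_poly d n r) 0) = (\<Sum>k\<le>r. hyp_coeff (1 / real n) r k)"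
    by (simp add: of_rat_sum of_rat_coeff_X_poly)
  have "1 \<le> (\<Sum>k\<le>r. hyp_coeff (1 / real n) r k)" using assms by (intro sum_hyp_coeff) auto
  then have "(of_rat (coeff (shifted_X_poly d n r) 0) :: real) > 0" unfolding * by linarith
  then show "coeff (shifted_X_poly d n r) 0 > 0" by simp
qed

text \<open>Write a coefficient in lowest terms as a/b. Since D a/b is an integer, b divides D, so D
  a/b is an integer multiple of a, and \<open>N_num\<close> divides a. Positivity holds because the
  constant coefficient, the value at 1, is not 0.\<close>

lemma N_num:
  assumes "n \<ge> 2"
  shows "N_num d n r > 0"
    and "\<exists>e. of_nat (D_num n r) * coeff (shifted_X_poly d n r) i = of_int (N_num d n r * e)"
proof -
  let ?P = "shifted_X_poly d n r"
  have N: "N_num d n r = Gcd ((\<lambda>i. fst (quotient_of (coeff ?P i))) ` {..degree ?P})"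
    by (simp add: N_num_def shifted_X_poly_def Let_def)
  have "fst (quotient_of (coeff ?P 0)) \<noteq> 0"
    using shifted_X_poly_0(2)[OF assms, of d r] quotient_of_div[of "coeff ?P 0"]
    by (cases "quotient_of (coeff ?P 0)") auto
  then have "N_num d n r \<noteq> 0" unfolding N Gcd_0_iff by auto
  moreover have "N_num d n r \<ge> 0" unfolding N by simp
  ultimately show "N_num d n r > 0" by simp
  have int: "of_nat (D_num n r) * coeff ?P i \<in> \<int>"
  proof -
    have "coeff (pcompose (smult (of_nat (D_num n r)) (X_poly n r)) [:1, - of_nat d:]) i \<in> \<int>"
      by (rule pcompose_Ints) (auto simp: D_num coeff_pCons split: nat.split)
    then show ?thesis by (simp add: pcompose_smult shifted_X_poly_def)
  qed
  show "\<exists>e. of_nat (D_num n r) * coeff ?P i = of_int (N_num d n r * e)"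
  proof (cases "i \<le> degree ?P")
    case False
    then show ?thesis by (intro exI[of _ 0]) (simp add: coeff_eq_0)
  next
    case True
    obtain a b where ab: "quotient_of (coeff ?P i) = (a, b)" by (cases "quotient_of (coeff ?P i)")
    have b: "b > 0" "coprime a b" "coeff ?P i = of_int a / of_int b"
      using quotient_of_denom_pos[OF ab] quotient_of_coprime[OF ab] quotient_of_div[OF ab] by auto
    have "N_num d n r dvd a" unfolding N using True ab by (intro Gcd_dvd) (auto intro!: image_eqI[of _ _ i])
    then obtain e where e: "a = N_num d n r * e" by (elim dvdE)
    obtain k where k: "of_nat (D_num n r) * coeff ?P i = of_int k" using int by (elim Ints_cases)
    then have "of_int (int (D_num n r) * a) = (of_int (k * b) :: rat)" using b by (simp add: field_simps)
    then have "int (D_num n r) * a = k * b" by (simp only: of_int_eq_iff)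
    then have "b dvd int (D_num n r) * a" by simp
    then have "b dvd int (D_num n r)" using b(2) by (simp add: coprime_commute coprime_dvd_mult_left_iff)
    then obtain m where m: "int (D_num n r) = b * m" by (elim dvdE)
    have "(of_nat (D_num n r) :: rat) = of_int (int (D_num n r))" by simp
    then have "of_nat (D_num n r) * coeff ?P i = of_int (N_num d n r * (e * m))"
      using b(1) unfolding b(3) m e by simp
    then show ?thesis by blast
  qed
qed

section \<open>Integrality of the scaled hypergeometric values\<close>

definition scale_factor :: "nat \<Rightarrow> nat \<Rightarrow> nat \<Rightarrow> real" where
  "scale_factor d n r = real (D_num n r) / real_of_int (N_num d n r)"

lemma scale_factor_pos: "n \<ge> 2 \<Longrightarrow> scale_factor d n r > 0"
  using N_num(1)[of n d r] D_num(1)[of n r] by (simp add: scale_factor_def)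

text \<open>The scaled constant coefficient of the shifted polynomial is a positive integer, hence
  at least 1, while the unscaled one is at most \<open>lead_const\<close> times 4^r.\<close>

lemma scale_factor_lower_bound:
  assumes "n \<ge> 2"
  shows "lead_const (1 / real n) r * scale_factor d n r \<ge> 1 / 4 ^ r"
proof -
  let ?c = "coeff (shifted_X_poly d n r) 0"
  obtain e where e: "of_nat (D_num n r) * ?c = of_int (N_num d n r * e)"
    using N_num(2)[OF assms] by blast
  have "(of_nat (D_num n r) :: rat) * ?c > 0" using D_num(1) shifted_X_poly_0(2)[OF assms] by simp
  then have "N_num d n r * e > 0" unfolding e by (simp only: of_int_0_less_iff)
  then have "e \<ge> 1" using N_num(1)[OF assms, of d r] by (simp add: zero_less_mult_iff)
  then have "1 \<le> (of_int e :: real)" by simp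
  also have "\<dots> = scale_factor d n r * of_rat ?c"
  proof -
    have "of_rat (of_nat (D_num n r) * ?c) = (of_rat (of_int (N_num d n r * e)) :: real)" unfolding e ..
    then have "real (D_num n r) * of_rat ?c = real_of_int (N_num d n r) * of_int e" by (simp add: of_rat_mult)
    then show ?thesis using N_num(1)[OF assms, of d r] by (simp add: scale_factor_def field_simps)
  qed
  also have "\<dots> \<le> scale_factor d n r * (lead_const (1 / real n) r * 4 ^ r)"
    unfolding shifted_X_poly_0(1)[OF assms] using assms scale_factor_pos[OF assms, of d r]
    by (intro mult_left_mono sum_hyp_coeff) auto
  finally show ?thesis by (simp add: field_simps)
qed

text \<open>With v/u = 1 - d (w/u) and w = (u - v)/d, the value is an expansion in powers of w/u
  whose scaled coefficients are integers. Multiplication by (u/g)^r homogenises it into a polynomial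
  in u/g and (u - v)/(d g).\<close>

lemma scaled_hypX_algebraic_int:
  fixes u v g :: complex
  assumes n: "n \<ge> 2" and d: "d > 0" and u: "u \<noteq> 0" and g: "g \<noteq> 0"
    and int: "algebraic_int (u / g)" "algebraic_int ((u - v) / (of_nat d * g))"
  shows "algebraic_int (of_real (scale_factor d n r) * (u / g) ^ r * hypX (1 / real n) r (v / u))"
proof -
  define w where "w = (u - v) / of_nat d"
  let ?P = "shifted_X_poly d n r"
  obtain e where e: "\<And>i. of_nat (D_num n r) * coeff ?P i = of_int (N_num d n r * e i)"
    using N_num(2)[OF n, of r d] by metis
  have N: "N_num d n r > 0" by (rule N_num(1)[OF n])
  have ee: "of_real (scale_factor d n r) * of_rat (coeff ?P i) = (of_int (e i) :: complex)" for i
  proof -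
    have "of_rat (of_nat (D_num n r) * coeff ?P i) = (of_rat (of_int (N_num d n r * e i)) :: complex)"
      unfolding e ..
    then have "of_nat (D_num n r) * of_rat (coeff ?P i) = (of_int (N_num d n r) * of_int (e i) :: complex)"
      by (simp add: of_rat_mult)
    then show ?thesis using N by (simp add: scale_factor_def field_simps)
  qed
  have deg: "degree (map_poly (of_rat :: rat \<Rightarrow> complex) ?P) \<le> r"
  proof (rule order_trans[OF degree_map_poly_le])
    have "degree ?P \<le> degree (X_poly n r) * degree [:1 :: rat, - of_nat d:]"
      unfolding shifted_X_poly_def by (rule degree_pcompose_le)
    also have "\<dots> \<le> r * 1" by (intro mult_mono degree_X_poly) auto
    finally show "degree ?P \<le> r" by simp
  qed
  have "v / u = 1 - of_nat d * (w / u)" using d u by (simp add: w_def field_simps)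
  moreover have "map_poly of_rat [:1, - of_nat d:] = [:1 :: complex, - of_nat d:]"
    by (rule poly_eqI) (simp add: coeff_map_poly coeff_pCons of_rat_minus split: nat.split)
  ultimately have "hypX (1 / real n) r (v / u) = poly (map_poly of_rat (X_poly n r)) (poly (map_poly of_rat [:1, - of_nat d:]) (w / u))"
    unfolding poly_X_poly by (simp add: mult.commute)
  also have "\<dots> = poly (map_poly of_rat ?P) (w / u)"
    by (simp add: shifted_X_poly_def of_rat_hom.map_poly_pcompose poly_pcompose)
  also have "\<dots> = (\<Sum>i\<le>r. of_rat (coeff ?P i) * (w / u) ^ i)"
    by (simp add: poly_altdef_le[OF deg] coeff_map_poly)
  finally have "of_real (scale_factor d n r) * (u / g) ^ r * hypX (1 / real n) r (v / u)
     = (\<Sum>i\<le>r. (of_real (scale_factor d n r) * of_rat (coeff ?P i)) * ((u / g) ^ r * (w / u) ^ i))"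
    by (simp add: sum_distrib_left mult_ac)
  also have "\<dots> = (\<Sum>i\<le>r. of_int (e i) * ((u / g) ^ (r - i) * ((u - v) / (of_nat d * g)) ^ i))"
  proof (intro sum.cong refl)
    fix i assume "i \<in> {..r}"
    then have "(u / g) ^ r = (u / g) ^ (r - i) * (u / g) ^ i" by (simp add: power_add[symmetric])
    moreover have "(u / g) ^ i * (w / u) ^ i = ((u - v) / (of_nat d * g)) ^ i"
      unfolding power_mult_distrib[symmetric] using u by (simp add: w_def mult.commute)
    ultimately show "(of_real (scale_factor d n r) * of_rat (coeff ?P i)) * ((u / g) ^ r * (w / u) ^ i)
       = of_int (e i) * ((u / g) ^ (r - i) * ((u - v) / (of_nat d * g)) ^ i)"
      by (simp only: ee mult.assoc)
  qed
  also have "algebraic_int \<dots>"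
    by (intro algebraic_int_sum algebraic_int_mult algebraic_int_power int int_imp_algebraic_int) auto
  finally show ?thesis .
qed

lemma hypY_reverse:
  assumes "z \<noteq> 0"
  shows "hypY \<nu> r z = z ^ r * hypX \<nu> r (1 / z)"
proof -
  have "hypY \<nu> r z = (\<Sum>k\<le>r. of_real (hyp_coeff \<nu> r k) * z ^ (r - k))"
    unfolding hypY_def by (rule sum.reindex_bij_witness[of _ "\<lambda>k. r - k" "\<lambda>k. r - k"]) auto
  also have "\<dots> = (\<Sum>k\<le>r. z ^ r * (of_real (hyp_coeff \<nu> r k) * (1 / z) ^ k))"
    by (intro sum.cong refl) (use assms in \<open>auto simp: power_diff power_divide\<close>)
  finally show ?thesis by (simp add: hypX_def sum_distrib_left)
qed

text \<open>Reversal of the polynomial exchanges the roles of \<open>u\<close> and \<open>v\<close>,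
  which reduces the claim to \<open>hypX\<close>.\<close>

lemma scaled_hypY_algebraic_int:
  fixes u v g :: complex
  assumes n: "n \<ge> 2" and d: "d > 0" and u: "u \<noteq> 0" "v \<noteq> 0" and g: "g \<noteq> 0"
    and int: "algebraic_int (v / g)" "algebraic_int ((u - v) / (of_nat d * g))"
  shows "algebraic_int (of_real (scale_factor d n r) * (u / g) ^ r * hypY (1 / real n) r (v / u))"
proof -
  have "(v - u) / (of_nat d * g) = - ((u - v) / (of_nat d * g))"
    by (metis minus_diff_eq minus_divide_left)
  then have "algebraic_int ((v - u) / (of_nat d * g))" using int(2) by simp
  then have "algebraic_int (of_real (scale_factor d n r) * (v / g) ^ r * hypX (1 / real n) r (u / v))"
    by (rule scaled_hypX_algebraic_int[OF n d u(2) g int(1)])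
  moreover have "(u / g) ^ r * hypY (1 / real n) r (v / u) = (v / g) ^ r * hypX (1 / real n) r (u / v)"
    using u by (simp add: hypY_reverse power_divide)
  ultimately show ?thesis by (simp add: mult.assoc)
qed

section \<open>The irrationality measure\<close>

text \<open>Otherwise the powers tend to 0. The lemma removes the fixed factor \<open>C\<close> from
  an estimate valid for all powers.\<close>

lemma ge_1_if_powers_bounded_below:
  fixes t C :: real
  assumes "t \<ge> 0" "\<And>r. C * t ^ r \<ge> 1"
  shows "t \<ge> 1"
proof (rule ccontr)
  assume "\<not> t \<ge> 1"
  then have "(\<lambda>r. C * t ^ r) \<longlonglongrightarrow> C * 0" using assms(1) by (intro tendsto_mult LIMSEQ_realpow_zero) auto
  then have "eventually (\<lambda>r. C * t ^ r < 1) sequentially" by (rule order_tendstoD) simp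
  then obtain r where "C * t ^ r < 1" by (auto simp: eventually_sequentially)
  with assms(2)[of r] show False by simp
qed

text \<open>If Q < 1, then \<open>q r\<close> tends to 0, and with it \<open>p r\<close>. By the gap
  below 1 both eventually vanish, contrary to \<open>det\<close>. The conclusion makes \<kappa>
  non-negative.\<close>

lemma approximation_growth:
  fixes p q :: "nat \<Rightarrow> complex" and A :: complex and k0 l0 Q E :: real
  assumes Q: "Q > 0" and E: "E > 1"
    and q: "\<And>r. cmod (q r) \<le> k0 * Q ^ r" and rem: "\<And>r. cmod (q r * A - p r) \<le> l0 / E ^ r"
    and det: "\<And>r. p r * q (Suc r) \<noteq> p (Suc r) * q r"
    and p1: "\<And>r. p r \<noteq> 0 \<Longrightarrow> cmod (p r) \<ge> 1" and q1: "\<And>r. q r \<noteq> 0 \<Longrightarrow> cmod (q r) \<ge> 1"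
  shows "Q \<ge> 1"
proof (rule ccontr)
  assume "\<not> Q \<ge> 1"
  then have "(\<lambda>r. k0 * Q ^ r) \<longlonglongrightarrow> k0 * 0" using Q by (intro tendsto_mult LIMSEQ_realpow_zero) auto
  then have q0: "q \<longlonglongrightarrow> 0"
    by (simp add: Lim_null_comparison[OF always_eventually, of q "\<lambda>r. k0 * Q ^ r"] q)
  have "(\<lambda>r. l0 * (1 / E) ^ r) \<longlonglongrightarrow> l0 * 0" using E by (intro tendsto_mult LIMSEQ_realpow_zero) auto
  then have "(\<lambda>r. l0 / E ^ r) \<longlonglongrightarrow> 0" by (simp add: power_divide)
  then have e0: "(\<lambda>r. q r * A - p r) \<longlonglongrightarrow> 0"
    by (rule Lim_null_comparison[OF always_eventually, rotated]) (use rem in auto)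
  have "(\<lambda>r. q r * A - (q r * A - p r)) \<longlonglongrightarrow> 0 * A - 0" by (intro tendsto_intros q0 e0)
  then have p0: "p \<longlonglongrightarrow> 0" by simp
  have "eventually (\<lambda>r. cmod (p r) < 1) sequentially" "eventually (\<lambda>r. cmod (q r) < 1) sequentially"
    using tendstoD[OF p0, of 1] tendstoD[OF q0, of 1] by simp_all
  then have "eventually (\<lambda>r. p r = 0 \<and> q r = 0) sequentially"
    by eventually_elim (use p1 q1 in force)
  then obtain r where "p r = 0 \<and> q r = 0" by (auto simp: eventually_sequentially)
  with det[of r] show False by simp
qed

lemma approximation_lower_bound:
  fixes p q :: "nat \<Rightarrow> complex" and A p0 q0 :: complex and k0 l0 Q E :: real
  assumes Q: "Q \<ge> 1" and E: "E > 1" and k0: "k0 > 0" and l0: "l0 \<ge> 0"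
    and q: "\<And>r. cmod (q r) < k0 * Q ^ r" and rem: "\<And>r. cmod (q r * A - p r) \<le> l0 / E ^ r"
    and det: "\<And>r. p r * q (Suc r) \<noteq> p (Suc r) * q r"
    and int: "\<And>r. q0 * p r - p0 * q r \<noteq> 0 \<Longrightarrow> cmod (q0 * p r - p0 * q r) \<ge> 1"
    and q0: "cmod q0 \<ge> 1"
  defines "\<kappa> \<equiv> ln Q / ln E"
  shows "cmod (A - p0 / q0) > 1 / (2 * k0 * Q * max 1 (2 * l0 * E) powr \<kappa> * cmod q0 powr (\<kappa> + 1))"
proof -
  have \<kappa>: "\<kappa> \<ge> 0" using Q E by (simp add: \<kappa>_def)
  have QE: "Q = E powr \<kappa>" using Q E by (simp add: \<kappa>_def powr_def)
  define M where "M = max 1 (2 * l0 * E)"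
  have M: "M \<ge> 1" by (simp add: M_def)
  have nz: "q0 \<noteq> 0" using q0 by auto
  have "\<exists>r. 2 * l0 * cmod q0 < E ^ r" by (rule real_arch_pow[OF E])
  then obtain r1 where "2 * l0 * cmod q0 \<le> E ^ r1" by (auto intro: less_imp_le)
  \<comment> \<open>Minimality gives E^(r0 - 1) < 2 l0 |q0|, so E^r0 is at most 2 l0 E |q0|. If r0 =
    0 there is no predecessor, and the 1 in the maximum takes over.\<close>
  define r0 where "r0 = (LEAST r. 2 * l0 * cmod q0 \<le> E ^ r)"
  have r0: "2 * l0 * cmod q0 \<le> E ^ r0" unfolding r0_def by (rule LeastI) fact
  have "E ^ r0 \<le> M * cmod q0"
  proof (cases r0)
    case 0
    have "1 * 1 \<le> M * cmod q0" using M q0 by (intro mult_mono) auto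
    then show ?thesis using 0 by simp
  next
    case (Suc s)
    have "\<not> 2 * l0 * cmod q0 \<le> E ^ s" unfolding r0_def[symmetric]
      by (rule not_less_Least) (use Suc in \<open>simp add: r0_def[symmetric]\<close>)
    then have "E ^ r0 \<le> (2 * l0 * E) * cmod q0" using Suc E by (simp add: mult_ac)
    also have "\<dots> \<le> M * cmod q0" by (intro mult_right_mono) (auto simp: M_def)
    finally show ?thesis .
  qed
  then have "(E ^ r0) powr \<kappa> \<le> (M * cmod q0) powr \<kappa>" using E \<kappa> by (intro powr_mono2) auto
  also have "(E ^ r0) powr \<kappa> = Q ^ r0"
    using E by (simp add: QE powr_realpow[symmetric] powr_powr mult.commute)
  also have "(M * cmod q0) powr \<kappa> = M powr \<kappa> * cmod q0 powr \<kappa>" using M by (simp add: powr_mult)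
  finally have Qr0: "Q ^ r0 \<le> M powr \<kappa> * cmod q0 powr \<kappa>" .
  have "\<exists>r\<in>{r0, Suc r0}. q0 * p r - p0 * q r \<noteq> 0"
  proof (rule ccontr)
    assume "\<not> ?thesis"
    then have a: "q0 * p r0 = p0 * q r0" "q0 * p (Suc r0) = p0 * q (Suc r0)" by auto
    have "q0 * (p r0 * q (Suc r0)) = (q0 * p (Suc r0)) * q r0" using a by (metis mult.assoc mult.commute)
    then have "p r0 * q (Suc r0) = p (Suc r0) * q r0" using nz by (simp add: mult.assoc)
    with det[of r0] show False by blast
  qed
  then obtain r where r: "r = r0 \<or> r = Suc r0" "q0 * p r - p0 * q r \<noteq> 0" by auto
  have "1 \<le> cmod (q0 * p r - p0 * q r)" by (rule int[OF r(2)])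
  also have "q0 * p r - p0 * q r = q r * (q0 * (A - p0 / q0)) - q0 * (q r * A - p r)"
    using nz by (simp add: field_simps)
  also have "cmod \<dots> \<le> cmod (q r) * (cmod q0 * cmod (A - p0 / q0)) + cmod q0 * cmod (q r * A - p r)"
    by (rule order_trans[OF norm_triangle_ineq4]) (simp add: norm_mult)
  also have "cmod q0 * cmod (q r * A - p r) \<le> cmod q0 * (l0 / E ^ r)" by (intro mult_left_mono rem) auto
  also have "\<dots> \<le> cmod q0 * (l0 / E ^ r0)"
    using r(1) E l0 by (intro mult_left_mono divide_left_mono power_increasing) (auto intro: power_increasing)
  also have "\<dots> \<le> 1 / 2" using r0 E by (simp add: field_simps)
  finally have half: "1 / 2 \<le> cmod (q r) * (cmod q0 * cmod (A - p0 / q0))" by simp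
  then have pos: "cmod (A - p0 / q0) > 0" by (cases "A - p0 / q0 = 0") auto
  have "cmod (q r) < k0 * Q ^ r" by (rule q)
  \<comment> \<open>The usable index may be r0 + 1; this is the origin of the extra factor Q in the
    bound.\<close>
  also have "k0 * Q ^ r \<le> k0 * Q ^ Suc r0"
    using r(1) Q k0 by (intro mult_left_mono power_increasing) auto
  also have "\<dots> \<le> k0 * (Q * (M powr \<kappa> * cmod q0 powr \<kappa>))"
    using Q k0 Qr0 by (simp add: mult_left_mono)
  finally have "cmod (q r) * (cmod q0 * cmod (A - p0 / q0)) < k0 * (Q * (M powr \<kappa> * cmod q0 powr \<kappa>)) * (cmod q0 * cmod (A - p0 / q0))"
    using pos nz by (intro mult_strict_right_mono) auto
  with half have "1 < 2 * k0 * Q * M powr \<kappa> * (cmod q0 powr \<kappa> * cmod q0) * cmod (A - p0 / q0)"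
    by (simp add: mult_ac)
  also have "cmod q0 powr \<kappa> * cmod q0 = cmod q0 powr (\<kappa> + 1)" using nz by (simp add: powr_add)
  finally have *: "1 < 2 * k0 * Q * M powr \<kappa> * cmod q0 powr (\<kappa> + 1) * cmod (A - p0 / q0)" .
  have "2 * k0 * Q * M powr \<kappa> * cmod q0 powr (\<kappa> + 1) > 0" using k0 Q M nz by simp
  with * show ?thesis unfolding M_def[symmetric] by (simp add: field_simps)
qed

text \<open>Identifies an entry of the maximum in the growth hypothesis with the constant that
  bounds \<open>hypX\<close> and \<open>hypY\<close>; its companion does so for the remainder
  constant \<open>rem_const\<close> divided by \<nu>.\<close>

lemma lead_const_Gamma:
  assumes "n \<ge> 2"
  shows "Gamma (1 - 1 / real n) * fact r / Gamma (real r + 1 - 1 / real n) = lead_const (1 / real n) r"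
proof -
  have pos: "1 - 1 / real n > 0" using assms by (simp add: field_simps)
  then have "1 - 1 / real n \<notin> \<int>\<^sub>\<le>\<^sub>0" using nonpos_Ints_nonpos[of "1 - 1 / real n"] by linarith
  then have "pochhammer (1 - 1 / real n) r = Gamma (1 - 1 / real n + real r) / Gamma (1 - 1 / real n)"
    by (rule pochhammer_Gamma)
  moreover have "1 - 1 / real n + real r = real r + 1 - 1 / real n" by simp
  moreover have "Gamma (1 - 1 / real n) > 0" using pos by (rule Gamma_real_pos)
  ultimately show ?thesis by (simp add: lead_const_def)
qed

lemma rem_const_Gamma:
  assumes "n \<ge> 2"
  shows "real n * Gamma (real r + 1 + 1 / real n) / (Gamma (1 / real n) * fact r)
     = rem_const (1 / real n) r / (1 / real n)"
proof -
  have pos: "1 / real n > 0" using assms by simp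
  then have "1 / real n \<notin> \<int>\<^sub>\<le>\<^sub>0" using nonpos_Ints_nonpos[of "1 / real n"] by linarith
  then have "pochhammer (1 / real n) (Suc r) = Gamma (1 / real n + real (Suc r)) / Gamma (1 / real n)"
    by (rule pochhammer_Gamma)
  also have "1 / real n + real (Suc r) = real r + 1 + 1 / real n" by simp
  finally show ?thesis by (simp add: rem_const_def)
qed

text \<open>U^r X(Z/U) and U^r Y(Z/U) are forms of degree r in Z and U that are exchanged when the
  variables are; replacing Z, U by -U, -Z therefore swaps them up to (-1)^r. The difference in
  \<open>V\<close> is thus conjugate to -(-1)^r V, and the norm is V^2 up to sign.\<close>

lemma (in conj_relation) square_approximant_in_K:
  assumes b: "R b1 b2" "R b2 b1" and a: "R a b" "R b a" and ZU: "R Z (- U)" "R U (- Z)"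
    and U: "U \<noteq> 0" and k: "k0 \<in> K" "k1 \<in> K" "k2 \<in> K"
    and V: "V = k2 * U ^ r * ((k1 * b1 - k0) * a * hypX (1 / real n) r (Z / U) - (k1 * b2 - k0) * b * hypY (1 / real n) r (Z / U))"
  shows "V * V \<in> K"
proof -
  define c where "c k = complex_of_real (hyp_coeff (1 / real n) r k)" for k
  have cK: "c k \<in> K" if "k \<le> r" for k
  proof -
    have "c k = of_rat (coeff (X_poly n r) k)" using that by (simp add: c_def of_rat_coeff_X_poly_complex)
    then show ?thesis using Rats_subset_subfield[OF subfield_K] by auto
  qed
  have Ur: "U ^ r * (e * (Z / U) ^ k) = e * (Z ^ k * U ^ (r - k))" if "k \<le> r" for e k
  proof -
    have "U ^ r = U ^ (r - k) * U ^ k" using that by (simp add: power_add[symmetric])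
    then show ?thesis using U by (simp add: power_divide)
  qed
  define FX FY where "FX = (\<Sum>k\<le>r. c k * (Z ^ k * U ^ (r - k)))" and "FY = (\<Sum>k\<le>r. c k * (U ^ k * Z ^ (r - k)))"
  have FX: "U ^ r * hypX (1 / real n) r (Z / U) = FX"
    unfolding FX_def hypX_def sum_distrib_left c_def[symmetric]
    by (intro sum.cong refl Ur) simp
  have FY: "U ^ r * hypY (1 / real n) r (Z / U) = FY"
  proof -
    have "U ^ r * hypY (1 / real n) r (Z / U) = (\<Sum>k\<le>r. c (r - k) * (Z ^ k * U ^ (r - k)))"
      unfolding hypY_def sum_distrib_left c_def[symmetric]
      by (intro sum.cong refl Ur) simp
    also have "\<dots> = FY" unfolding FY_def
      by (rule sum.reindex_bij_witness[of _ "\<lambda>k. r - k" "\<lambda>k. r - k"]) auto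
    finally show ?thesis .
  qed
  have RFX: "R FX ((-1) ^ r * FY)"
  proof -
    have "R FX (\<Sum>k\<le>r. c k * ((- U) ^ k * (- Z) ^ (r - k)))"
      unfolding FX_def by (intro R_sum R_mult R_power ZU R_const cK) auto
    also have "(\<Sum>k\<le>r. c k * ((- U) ^ k * (- Z) ^ (r - k))) = (-1) ^ r * FY"
      unfolding FY_def sum_distrib_left
    proof (intro sum.cong refl)
      fix k assume "k \<in> {..r}"
      then have "(-1 :: complex) ^ r = (-1) ^ k * (-1) ^ (r - k)" by (simp add: power_add[symmetric])
      then show "c k * ((- U) ^ k * (- Z) ^ (r - k)) = (-1) ^ r * (c k * (U ^ k * Z ^ (r - k)))"
        by (simp add: power_minus[of U] power_minus[of Z] mult_ac)
    qed
    finally show ?thesis .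
  qed
  have RFY: "R FY ((-1) ^ r * FX)"
  proof -
    have "R FY (\<Sum>k\<le>r. c k * ((- Z) ^ k * (- U) ^ (r - k)))"
      unfolding FY_def by (intro R_sum R_mult R_power ZU R_const cK) auto
    also have "(\<Sum>k\<le>r. c k * ((- Z) ^ k * (- U) ^ (r - k))) = (-1) ^ r * FX"
      unfolding FX_def sum_distrib_left
    proof (intro sum.cong refl)
      fix k assume "k \<in> {..r}"
      then have "(-1 :: complex) ^ r = (-1) ^ k * (-1) ^ (r - k)" by (simp add: power_add[symmetric])
      then show "c k * ((- Z) ^ k * (- U) ^ (r - k)) = (-1) ^ r * (c k * (Z ^ k * U ^ (r - k)))"
        by (simp add: power_minus[of U] power_minus[of Z] mult_ac)
    qed
    finally show ?thesis .
  qed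
  have V': "V = k2 * ((k1 * b1 - k0) * a * FX - (k1 * b2 - k0) * b * FY)"
    unfolding V FX[symmetric] FY[symmetric] by (simp add: algebra_simps)
  have "R V (k2 * ((k1 * b2 - k0) * b * ((-1) ^ r * FY) - (k1 * b1 - k0) * a * ((-1) ^ r * FX)))"
    unfolding V' by (intro R_mult R_diff R_const k b a RFX RFY)
  also have "k2 * ((k1 * b2 - k0) * b * ((-1) ^ r * FY) - (k1 * b1 - k0) * a * ((-1) ^ r * FX)) = - ((-1) ^ r * V)"
    by (simp add: V' algebra_simps)
  finally have "V * - ((-1) ^ r * V) \<in> K" by (rule R_norm)
  moreover have "V * - ((-1) ^ r * V) = V * V \<or> V * - ((-1) ^ r * V) = - (V * V)"
    by (cases "even r") auto
  ultimately show ?thesis using subfield_complexD(5)[OF subfield_K, of "- (V * V)"] by auto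
qed

theorem theorem2p1:
  fixes K :: "complex set"
    and \<beta>\<^sub>1 \<beta>\<^sub>2 \<gamma>\<^sub>1 \<gamma>\<^sub>2 \<tau> x g :: complex
    and n d :: nat
    and h_seq :: "nat \<Rightarrow> complex"
    and h Cn Dn :: real
    and U Z W A :: complex
    and E Q \<kappa> c :: real
  assumes K: "K = \<rat> \<or> imaginary_quadratic K"
    and \<beta>\<^sub>1: "algebraic_int \<beta>\<^sub>1" "\<exists>m\<le>2. ext_degree K (adjoin K \<beta>\<^sub>1) m"
    and \<tau>: "if K = \<rat> \<or> adjoin K \<beta>\<^sub>1 = K then \<tau> = 1
            else algebraic_int \<tau> \<and> \<tau> \<in> K \<and> adjoin K \<beta>\<^sub>1 = adjoin K (csqrt \<tau>)"
    and deg1: "\<beta>\<^sub>1 \<in> K \<Longrightarrow>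
            \<beta>\<^sub>2 \<in> K \<and> \<gamma>\<^sub>1 \<in> K \<and> \<gamma>\<^sub>2 \<in> K \<and> \<gamma>\<^sub>1 \<noteq> 0 \<and> \<gamma>\<^sub>2 \<noteq> 0 \<and> \<beta>\<^sub>2 \<noteq> \<beta>\<^sub>1 \<and> algebraic_int \<beta>\<^sub>2"
    and deg2: "ext_degree K (adjoin K \<beta>\<^sub>1) 2 \<Longrightarrow>
            conjugate_over K \<beta>\<^sub>1 \<beta>\<^sub>2 \<and> \<gamma>\<^sub>1 \<in> adjoin K \<beta>\<^sub>1 \<and> conjugate_over K \<gamma>\<^sub>1 \<gamma>\<^sub>2"
    and x: "algebraic_int x" "x \<in> K"
    and n: "n \<ge> 3"
    and U_def: "U = - \<gamma>\<^sub>2 * (x - \<beta>\<^sub>2) ^ n"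
    and Z_def: "Z = \<gamma>\<^sub>1 * (x - \<beta>\<^sub>1) ^ n"
    and W_def: "W = Z / U"
    and A_def: "A = (\<beta>\<^sub>1 * (x - \<beta>\<^sub>2) * croot n W - \<beta>\<^sub>2 * (x - \<beta>\<^sub>1)) /
               ((x - \<beta>\<^sub>2) * croot n W - (x - \<beta>\<^sub>1))"
    and nondegenerate: "U \<noteq> 0" "U \<noteq> Z" "(x - \<beta>\<^sub>2) * croot n W - (x - \<beta>\<^sub>1) \<noteq> 0"
    and g: "algebraic g" "g \<noteq> 0" "algebraic_int (U / g)" "algebraic_int (Z / g)"
    and h: "h > 0"
           "\<And>r. h_seq r \<noteq> 0 \<and> algebraic_int (h_seq r) \<and> h_seq r / g ^ r \<in> K \<and> cmod (h_seq r) \<le> h"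
    and d: "d > 0" "algebraic_int ((U - Z) / (of_nat d * g))"
           "\<And>d'. d' > 0 \<Longrightarrow> algebraic_int ((U - Z) / (of_nat d' * g)) \<Longrightarrow> d' \<le> d"
    and CD: "Cn > 0" "Dn > 0"
            "\<And>r::nat. max 1 (max (Gamma (1 - 1 / real n) * fact r / Gamma (real r + 1 - 1 / real n))
                               (real n * Gamma (real r + 1 + 1 / real n) / (Gamma (1 / real n) * fact r)))
                  * (real (D_num n r) / real_of_int (N_num d n r))
                < Cn * (Dn / N_cal d n) ^ r"
    and E_def: "E = cmod g * N_cal d n / Dn *
               (min (cmod (csqrt U - csqrt Z)) (cmod (csqrt U + csqrt Z))) powi (-2)"
    and Q_def: "Q = Dn / (cmod g * N_cal d n) *
               (max (cmod (csqrt U - csqrt Z)) (cmod (csqrt U + csqrt Z))) ^ 2"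
    and kappa_def: "\<kappa> = ln Q / ln E"
    and c_def: "c = 4 * h * cmod (csqrt \<tau>) * (cmod (x - \<beta>\<^sub>1) + cmod (x - \<beta>\<^sub>2)) * Cn * Q *
               (max 1 (5 * h * cmod (csqrt \<tau>) * cmod (1 - croot n W) * cmod (x - \<beta>\<^sub>2) *
                       cmod (A - \<beta>\<^sub>1) * Cn * E)) powr \<kappa>"
    and E: "E > 1"
    and W: "(W \<in> \<real> \<and> 0 < Re W \<and> Re W < 1) \<or> (cmod W = 1 \<and> W \<noteq> -1)"
  shows "\<forall>p q. algebraic_int p \<and> p \<in> K \<and> algebraic_int q \<and> q \<in> K \<and> q \<noteq> 0 \<longrightarrow>
           cmod (A - p / q) > 1 / (c * cmod q powr (\<kappa> + 1))"
proof (intro allI impI)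
  fix p0 q0 :: complex
  assume "algebraic_int p0 \<and> p0 \<in> K \<and> algebraic_int q0 \<and> q0 \<in> K \<and> q0 \<noteq> 0"
  then have p0: "algebraic_int p0" "p0 \<in> K" and q0: "algebraic_int q0" "q0 \<in> K" "q0 \<noteq> 0" by auto
  have subK: "subfield K complex_field"
    using K subfield_Rats by (auto simp: imaginary_quadratic_def)
  obtain R where R: "conj_relation K R" "algebraic_int \<beta>\<^sub>2" "\<beta>\<^sub>2 \<noteq> \<beta>\<^sub>1"
    and R\<beta>: "R \<beta>\<^sub>1 \<beta>\<^sub>2" "R \<beta>\<^sub>2 \<beta>\<^sub>1" and R\<gamma>: "R \<gamma>\<^sub>1 \<gamma>\<^sub>2" "R \<gamma>\<^sub>2 \<gamma>\<^sub>1"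
    by (rule conjugation_relation[OF subK \<beta>\<^sub>1 deg1 deg2])
  interpret conj_relation K R by (rule R(1))
  define \<nu> where "\<nu> = 1 / real n"
  have \<nu>: "0 < \<nu>" "\<nu> \<le> 1 / 3" "\<nu> < 1" and n2: "n \<ge> 2"
    using n by (auto simp: \<nu>_def field_simps)
  define a b where "a = x - \<beta>\<^sub>2" and "b = x - \<beta>\<^sub>1"
  have ab_int: "algebraic_int a" "algebraic_int b"
    unfolding a_def b_def using x \<beta>\<^sub>1(1) R(2) by (auto intro: algebraic_int_diff)
  have W0: "W \<noteq> 0" using W by auto
  then have Z0: "Z \<noteq> 0" by (auto simp: W_def)
  have W1: "W \<noteq> 1" using nondegenerate(1,2) by (auto simp: W_def)
  have a0: "a \<noteq> 0" and b0: "b \<noteq> 0"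
    using nondegenerate(1) Z0 n by (auto simp: U_def Z_def a_def b_def power_0_left)
  have Rab: "R a b" "R b a"
    unfolding a_def b_def by (intro R_diff R_const x R\<beta>)+
  have RZU: "R Z (- U)" "R U (- Z)"
  proof -
    have "R (\<gamma>\<^sub>1 * b ^ n) (\<gamma>\<^sub>2 * a ^ n)" "R (- (\<gamma>\<^sub>2 * a ^ n)) (- (\<gamma>\<^sub>1 * b ^ n))"
      by (intro R_mult R_power R_minus R\<gamma> Rab)+
    then show "R Z (- U)" "R U (- Z)" by (simp_all add: U_def Z_def a_def b_def)
  qed

  \<comment> \<open>Principal roots of W and the form of E and Q\<close>
  define L where "L = Ln W"
  have eL: "exp L = W" using W0 by (simp add: L_def)
  have L: "admissible_log L"
    using W
  proof
    assume *: "W \<in> \<real> \<and> 0 < Re W \<and> Re W < 1"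
    then have "W = of_real (Re W)" by (simp add: complex_eq_iff complex_is_Real_iff)
    then have "L = of_real (ln (Re W))" unfolding L_def using * Ln_of_real[of "Re W"] by simp
    then show ?thesis using * by (simp add: admissible_log_def)
  next
    assume "cmod W = 1 \<and> W \<noteq> -1"
    then show ?thesis using W0 mpi_less_Im_Ln[of W] Im_Ln_le_pi[of W]
      by (simp add: admissible_log_def L_def abs_le_iff)
  qed
  define y where "y = exp (L / 2)"
  define w where "w = exp (of_real \<nu> * L)"
  have w: "croot n W = w"
    using n W0 by (simp add: croot_eq_powr powr_def w_def L_def \<nu>_def)
  have y2: "y\<^sup>2 = W" by (simp add: y_def eL[symmetric] power2_eq_square exp_add[symmetric])
  have Re_y: "Re y \<ge> 0"
    using L by (auto simp: y_def Re_exp admissible_log_def intro!: mult_nonneg_nonneg cos_ge_zero)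
  have y1: "y \<noteq> 1" using y2 W1 by auto
  have norm_y: "cmod (1 - y) \<le> cmod (1 + y)" "cmod (1 - y) > 0" "cmod (1 + y) > 0"
  proof -
    show "cmod (1 - y) \<le> cmod (1 + y)" using Re_y by (simp add: cmod_def power2_eq_square algebra_simps)
    show 1: "cmod (1 - y) > 0" using y1 by simp
    show "cmod (1 + y) > 0" using 1 \<open>cmod (1 - y) \<le> cmod (1 + y)\<close> by linarith
  qed

  have minmax: "min (cmod (csqrt U - csqrt Z)) (cmod (csqrt U + csqrt Z)) = cmod (csqrt U) * cmod (1 - y)"
    "max (cmod (csqrt U - csqrt Z)) (cmod (csqrt U + csqrt Z)) = cmod (csqrt U) * cmod (1 + y)"
  proof -
    have "(csqrt Z)\<^sup>2 = (y * csqrt U)\<^sup>2"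
      using nondegenerate(1) by (simp add: power_mult_distrib y2 W_def)
    \<comment> \<open>The principal roots of U and Z determine their quotient only up to sign
      relative to \<open>y\<close>. The minimum and maximum absorb the sign, and Re y \<ge> 0
      assigns 1 - y to the minimum.\<close>
    then have "csqrt Z = y * csqrt U \<or> csqrt Z = - (y * csqrt U)" by (rule iffD1[OF power2_eq_iff])
    then have "(csqrt U - csqrt Z = csqrt U * (1 - y) \<and> csqrt U + csqrt Z = csqrt U * (1 + y)) \<or>
       (csqrt U - csqrt Z = csqrt U * (1 + y) \<and> csqrt U + csqrt Z = csqrt U * (1 - y))"
      by (auto simp: algebra_simps)
    moreover have "cmod (csqrt U) * cmod (1 - y) \<le> cmod (csqrt U) * cmod (1 + y)"
      using norm_y(1) by (intro mult_left_mono) auto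
    ultimately show "min (cmod (csqrt U - csqrt Z)) (cmod (csqrt U + csqrt Z)) = cmod (csqrt U) * cmod (1 - y)"
      "max (cmod (csqrt U - csqrt Z)) (cmod (csqrt U + csqrt Z)) = cmod (csqrt U) * cmod (1 + y)"
      by (auto simp: norm_mult)
  qed
  have sqU: "(cmod (csqrt U))\<^sup>2 = cmod U" by (simp add: norm_power[symmetric])
  have Nc: "N_cal d n > 0"
    unfolding N_cal_def by (intro prod_pos) (auto dest: prime_gt_0_nat in_prime_factors_imp_prime)
  define \<Delta> where "\<Delta> = Dn / N_cal d n"
  have \<Delta>: "\<Delta> > 0" using Nc CD by (simp add: \<Delta>_def)
  define u where "u = cmod (U / g)"
  have u: "u > 0" using nondegenerate(1) g(2) by (simp add: u_def)
  \<comment> \<open>Q and 1/E have the same shape, with 1 + y and 1 - y; their r-th powers collect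
    the scale factor, (U/g)^r and the analytic bounds.\<close>
  have Q': "Q = \<Delta> * u * (cmod (1 + y))\<^sup>2"
    unfolding Q_def minmax(2) power_mult_distrib sqU by (simp add: \<Delta>_def u_def norm_divide mult_ac)
  have E': "1 / E = \<Delta> * u * (cmod (1 - y))\<^sup>2"
    unfolding E_def minmax(1) power_int_minus using Nc CD(2) g(2)
    by (simp add: power_mult_distrib sqU \<Delta>_def u_def norm_divide field_simps)
  have Q0: "Q > 0" unfolding Q' using \<Delta> u norm_y by simp

  \<comment> \<open>Scale factors and the growth hypothesis\<close>
  define S where "S r = scale_factor d n r" for r
  have S: "S r > 0" for r unfolding S_def by (rule scale_factor_pos[OF n2])
  have lead: "lead_const \<nu> r * S r < Cn * \<Delta> ^ r" and remc: "rem_const \<nu> r / \<nu> * S r < Cn * \<Delta> ^ r" for r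
  proof -
    have "lead_const \<nu> r * S r \<le> max 1 (max (lead_const \<nu> r) (rem_const \<nu> r / \<nu>)) * S r"
      using S[of r] by (intro mult_right_mono) auto
    moreover have "rem_const \<nu> r / \<nu> * S r \<le> max 1 (max (lead_const \<nu> r) (rem_const \<nu> r / \<nu>)) * S r"
      using S[of r] by (intro mult_right_mono) auto
    moreover have "max 1 (max (lead_const \<nu> r) (rem_const \<nu> r / \<nu>)) * S r < Cn * \<Delta> ^ r"
      using CD(3)[of r] unfolding lead_const_Gamma[OF n2] rem_const_Gamma[OF n2]
      by (simp add: \<nu>_def S_def scale_factor_def \<Delta>_def)
    ultimately show "lead_const \<nu> r * S r < Cn * \<Delta> ^ r" "rem_const \<nu> r / \<nu> * S r < Cn * \<Delta> ^ r" by linarith+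
  qed
  \<comment> \<open>The growth hypothesis bounds the scaled leading constant from above, integrality
    bounds it below by 4^(-r); letting r grow removes \<open>Cn\<close>.\<close>
  have \<Delta>4: "\<Delta> \<ge> 1 / 4"
  proof -
    have "4 * \<Delta> \<ge> 1"
    proof (rule ge_1_if_powers_bounded_below)
      fix r
      have "1 / 4 ^ r \<le> Cn * \<Delta> ^ r"
        using scale_factor_lower_bound[OF n2, of r d] lead[of r] by (simp add: S_def \<nu>_def)
      then show "Cn * (4 * \<Delta>) ^ r \<ge> 1" by (simp add: field_simps)
    qed (use \<Delta> in simp)
    then show ?thesis by simp
  qed
  have int1: "cmod z \<ge> 1" if "algebraic_int z" "z * z \<in> K" "z \<noteq> 0" for z
    by (rule algebraic_int_norm_ge_1_square[OF K that])

  text \<open>For \<open>0 < W < 1\<close>, the number \<open>Z U / g\<^sup>2\<close> has modulus at least \<open>1\<close>; together with \<open>E > 1\<close> this keeps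
    \<open>W\<close> away from \<open>0\<close>, where the bound for \<open>hypY\<close> would fail.\<close>
  have y6: "1 / 6 \<le> exp (Re L / 2)" if ImL: "Im L = 0"
  proof -
    define s where "s = exp (Re L / 2)"
    have s0: "s > 0" by (simp add: s_def)
    have ys: "y = of_real s"
      using ImL by (simp add: y_def s_def exp_of_real[symmetric] complex_eq_iff Re_exp Im_exp)
    have ZUK: "Z * U \<in> K"
      using R_norm[OF RZU(1)] subfield_complexD(5)[OF subK, of "Z * - U"] by simp
    have "cmod (Z / g * (U / g)) \<ge> 1"
    proof (rule ge_1_if_powers_bounded_below)
      fix r
      \<comment> \<open>Z U / g^2 itself need not lie in \<open>K\<close>, but its r-th power times
        h_r^2 does. The loss is at most h^2, independently of r.\<close>
      define t where "t = h_seq r * h_seq r * (Z / g * (U / g)) ^ r"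
      have "t = (h_seq r / g ^ r) * (h_seq r / g ^ r) * (Z * U) ^ r"
        using g(2) by (simp add: t_def power_divide power_mult_distrib field_simps)
      also have "\<dots> \<in> K"
      proof -
        have "(Z * U) ^ r \<in> K" by (induction r) (auto intro: ZUK subfield_complexD[OF subK])
        then show ?thesis using h(2)[of r] by (intro subfield_complexD(4)[OF subK]) auto
      qed
      finally have "t \<in> K" .
      moreover have "algebraic_int t"
        unfolding t_def using h(2)[of r] by (intro algebraic_int_mult algebraic_int_power g) auto
      moreover have "t \<noteq> 0" using h(2)[of r] Z0 nondegenerate(1) g(2) by (simp add: t_def)
      ultimately have "1 \<le> cmod t" by (intro algebraic_int_norm_ge_1[OF K])
      also have "\<dots> = cmod (h_seq r) * cmod (h_seq r) * cmod (Z / g * (U / g)) ^ r"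
        by (simp add: t_def norm_mult norm_power)
      also have "\<dots> \<le> h * h * cmod (Z / g * (U / g)) ^ r"
        using h(2)[of r] h(1) by (intro mult_right_mono mult_mono) auto
      finally show "h * h * cmod (Z / g * (U / g)) ^ r \<ge> 1" .
    qed simp
    also have "cmod (Z / g * (U / g)) = (u * s)\<^sup>2"
    proof -
      have "Z = y\<^sup>2 * U" using nondegenerate(1) by (simp add: y2 W_def)
      then have "Z / g * (U / g) = (y * (U / g))\<^sup>2" by (simp add: power2_eq_square)
      then show ?thesis using s0 by (simp add: ys u_def norm_mult norm_power norm_divide mult.commute)
    qed
    finally have us: "1 \<le> u * s" using u s0 by (simp add: power2_nonneg_ge_1_iff)
    have n1: "cmod (1 - y) = \<bar>1 - s\<bar>"
    proof -
      have "1 - y = of_real (1 - s)" by (simp add: ys)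
      then show ?thesis by (simp only: norm_of_real)
    qed
    have "1 / E < 1" using E by simp
    then have "\<Delta> * u * (1 - s)\<^sup>2 < 1" unfolding E' n1 power2_abs .
    moreover have "1 / 4 * u * (1 - s)\<^sup>2 \<le> \<Delta> * u * (1 - s)\<^sup>2"
      using \<Delta>4 u by (intro mult_right_mono) auto
    ultimately have "u * (1 - s)\<^sup>2 < 4" by linarith
    then have "s * (u * (1 - s)\<^sup>2) < s * 4" using s0 by (rule mult_strict_left_mono)
    moreover have "1 * (1 - s)\<^sup>2 \<le> (u * s) * (1 - s)\<^sup>2" using us by (intro mult_right_mono) auto
    ultimately have *: "(1 - s)\<^sup>2 < 4 * s" by (simp add: mult_ac)
    show "1 / 6 \<le> exp (Re L / 2)"
    proof (rule ccontr)
      assume "\<not> 1 / 6 \<le> exp (Re L / 2)"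
      then have s6: "s < 1 / 6" by (simp add: s_def)
      \<comment> \<open>(5/6)^2 = 25/36 exceeds 4/6. The threshold 1/6 is also half of 1/3, the
        largest possible \<nu>, as the bound for \<open>hypY\<close> requires.\<close>
      then have "(5 / 6)\<^sup>2 \<le> (1 - s)\<^sup>2" by (intro power_mono) auto
      with * s6 show False by (simp add: power2_eq_square)
    qed
  qed

  define Xv where "Xv r = hypX \<nu> r W" for r
  define Yv where "Yv r = hypY \<nu> r W" for r
  have XY_le: "cmod (Xv r) \<le> 2 * lead_const \<nu> r * cmod (1 + y) ^ (2 * r)"
    "cmod (Yv r) \<le> 2 * lead_const \<nu> r * cmod (1 + y) ^ (2 * r)" for r
  proof -
    have "\<nu> \<le> 2 * exp (Re L / 2)" if "Im L = 0" using y6[OF that] \<nu> by linarith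
    then show "cmod (Xv r) \<le> 2 * lead_const \<nu> r * cmod (1 + y) ^ (2 * r)"
      "cmod (Yv r) \<le> 2 * lead_const \<nu> r * cmod (1 + y) ^ (2 * r)"
      using hyp_norm_le[OF \<nu>(1,3) L, of r] by (simp_all add: eL Xv_def Yv_def y_def)
  qed
  have rem_le: "cmod (Xv r - w * Yv r) \<le> 5 / 2 * (rem_const \<nu> r / \<nu>) * cmod (1 - w) * cmod (1 - y) ^ (2 * r)" for r
    using hyp_remainder_le[OF \<nu>(1,2) L y6, of r] by (simp add: eL Xv_def Yv_def y_def w_def)

  \<comment> \<open>The approximants: integrality, conjugation and remainder\<close>
  define m where "m r = h_seq r * of_real (S r) * (U / g) ^ r" for r
  define p where "p r = m r * (\<beta>\<^sub>1 * a * Xv r - \<beta>\<^sub>2 * b * Yv r)" for r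
  define q where "q r = m r * (a * Xv r - b * Yv r)" for r
  have m0: "m r \<noteq> 0" for r
    using h(2)[of r] S[of r] nondegenerate(1) g(2) by (simp add: m_def)
  have norm_m: "cmod (m r) \<le> h * S r * u ^ r" for r
    unfolding m_def norm_mult norm_power u_def using h(2)[of r] S[of r]
    by (intro mult_right_mono) (auto simp: less_imp_le)

  have combination: "algebraic_int (k1 * p r - k0 * q r)" "(k1 * p r - k0 * q r) * (k1 * p r - k0 * q r) \<in> K"
    if k: "algebraic_int k0" "k0 \<in> K" "algebraic_int k1" "k1 \<in> K" for k0 k1 r
  proof -
    have V: "k1 * p r - k0 * q r = m r * ((k1 * \<beta>\<^sub>1 - k0) * a * Xv r - (k1 * \<beta>\<^sub>2 - k0) * b * Yv r)"
      by (simp add: p_def q_def algebra_simps)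
    have comb: "algebraic_int (h_seq r * ((k1 * \<beta>\<^sub>1 - k0) * a * s - (k1 * \<beta>\<^sub>2 - k0) * b * t))"
      if "algebraic_int s" "algebraic_int t" for s t
      using h(2)[of r] k \<beta>\<^sub>1(1) R(2) ab_int that by (intro algebraic_int_mult algebraic_int_diff) auto
    have iX: "algebraic_int (of_real (S r) * (U / g) ^ r * Xv r)"
      unfolding S_def Xv_def W_def \<nu>_def
      by (rule scaled_hypX_algebraic_int[OF n2 d(1) nondegenerate(1) g(2,3) d(2)])
    have iY: "algebraic_int (of_real (S r) * (U / g) ^ r * Yv r)"
      unfolding S_def Yv_def W_def \<nu>_def
      by (rule scaled_hypY_algebraic_int[OF n2 d(1) nondegenerate(1) Z0 g(2,4) d(2)])
    show "algebraic_int (k1 * p r - k0 * q r)"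
      using comb[OF iX iY] unfolding V m_def by (simp add: algebra_simps)
    \<comment> \<open>The power of g is moved from U to \<open>h_seq r\<close>, so that m_r becomes
      an element of \<open>K\<close> times U^r.\<close>
    have kK: "(h_seq r / g ^ r) * of_real (S r) \<in> K"
    proof -
      have "complex_of_real (S r) = of_nat (D_num n r) / of_int (N_num d n r)"
        by (simp add: S_def scale_factor_def)
      also have "\<dots> \<in> K" using Rats_subset_subfield[OF subK] by (intro subfield_complexD(8)[OF subK]) auto
      finally show ?thesis using h(2)[of r] by (intro subfield_complexD(4)[OF subK]) auto
    qed
    show "(k1 * p r - k0 * q r) * (k1 * p r - k0 * q r) \<in> K"
      by (rule square_approximant_in_K[OF R\<beta> Rab RZU nondegenerate(1) k(2,4) kK, where n = n and r = r])
         (simp add: V m_def Xv_def Yv_def W_def \<nu>_def power_divide)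
  qed
  have int_ge_1: "cmod (k1 * p r - k0 * q r) \<ge> 1"
    if "algebraic_int k0" "k0 \<in> K" "algebraic_int k1" "k1 \<in> K" "k1 * p r - k0 * q r \<noteq> 0" for k0 k1 r
    using int1[OF combination[OF that(1-4)] that(5)] .

  have A_minus: "A - \<beta>\<^sub>1 = b * (\<beta>\<^sub>1 - \<beta>\<^sub>2) / (a * w - b)" and den: "a * w - b \<noteq> 0"
    and A': "A * (a * w - b) = \<beta>\<^sub>1 * a * w - \<beta>\<^sub>2 * b"
  proof -
    show den: "a * w - b \<noteq> 0" using nondegenerate(3) by (simp add: w a_def b_def)
    have A: "A = (\<beta>\<^sub>1 * a * w - \<beta>\<^sub>2 * b) / (a * w - b)" unfolding A_def w a_def b_def ..
    show "A * (a * w - b) = \<beta>\<^sub>1 * a * w - \<beta>\<^sub>2 * b" using den by (simp add: A)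
    show "A - \<beta>\<^sub>1 = b * (\<beta>\<^sub>1 - \<beta>\<^sub>2) / (a * w - b)" using den by (simp add: A field_simps)
  qed
  \<comment> \<open>Clearing the denominator a w - b of \<open>A\<close> cancels everything except X
    - w Y. The factors \<open>a\<close> and \<open>A - \<beta>\<^sub>1\<close> are those that appear
    inside the maximum in \<open>c\<close>.\<close>
  have remainder: "q r * A - p r = m r * a * (A - \<beta>\<^sub>1) * (Xv r - w * Yv r)" for r
  proof -
    have "(q r * A - p r) * (a * w - b) = m r * ((a * Xv r - b * Yv r) * (A * (a * w - b)) - (\<beta>\<^sub>1 * a * Xv r - \<beta>\<^sub>2 * b * Yv r) * (a * w - b))"
      by (simp add: p_def q_def algebra_simps)
    also have "\<dots> = m r * (a * b * (\<beta>\<^sub>1 - \<beta>\<^sub>2) * (Xv r - w * Yv r))"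
      unfolding A' by (simp add: algebra_simps)
    finally show ?thesis using den by (simp add: A_minus field_simps)
  qed

  \<comment> \<open>Estimates for the approximants\<close>
  define k0 where "k0 = 2 * h * (cmod b + cmod a) * Cn"
  define l0 where "l0 = 5 / 2 * h * cmod (1 - w) * cmod a * cmod (A - \<beta>\<^sub>1) * Cn"
  have k0: "k0 > 0" using h(1) CD(1) a0 by (simp add: k0_def add_nonneg_pos)
  have l0: "l0 \<ge> 0" using h(1) CD(1) by (simp add: l0_def)
  have q_le: "cmod (q r) < k0 * Q ^ r" for r
  proof -
    have "cmod (a * Xv r - b * Yv r) \<le> cmod a * cmod (Xv r) + cmod b * cmod (Yv r)"
      unfolding norm_mult[symmetric] by (rule norm_triangle_ineq4)
    also have "\<dots> \<le> cmod a * (2 * lead_const \<nu> r * cmod (1 + y) ^ (2 * r)) + cmod b * (2 * lead_const \<nu> r * cmod (1 + y) ^ (2 * r))"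
      by (intro add_mono mult_left_mono XY_le) auto
    finally have "cmod (q r) \<le> (h * S r * u ^ r) * (cmod a * (2 * lead_const \<nu> r * cmod (1 + y) ^ (2 * r)) + cmod b * (2 * lead_const \<nu> r * cmod (1 + y) ^ (2 * r)))"
      unfolding q_def norm_mult[of "m r"] using h(1) S[of r] u by (intro mult_mono norm_m) auto
    also have "\<dots> = (2 * h * (cmod b + cmod a) * u ^ r * cmod (1 + y) ^ (2 * r)) * (lead_const \<nu> r * S r)"
      by (simp add: algebra_simps)
    also have "\<dots> < (2 * h * (cmod b + cmod a) * u ^ r * cmod (1 + y) ^ (2 * r)) * (Cn * \<Delta> ^ r)"
      using h(1) a0 u norm_y by (intro mult_strict_left_mono lead) (simp add: add_nonneg_pos)
    also have "\<dots> = k0 * Q ^ r"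
      by (simp add: k0_def Q' power_mult_distrib algebra_simps flip: power_mult)
    finally show ?thesis .
  qed
  have rem: "cmod (q r * A - p r) \<le> l0 / E ^ r" for r
  proof -
    have "cmod (q r * A - p r) = cmod (m r) * (cmod a * cmod (A - \<beta>\<^sub>1) * cmod (Xv r - w * Yv r))"
      by (simp add: remainder norm_mult)
    also have "\<dots> \<le> (h * S r * u ^ r) * (cmod a * cmod (A - \<beta>\<^sub>1) * (5 / 2 * (rem_const \<nu> r / \<nu>) * cmod (1 - w) * cmod (1 - y) ^ (2 * r)))"
      using h(1) S[of r] u by (intro mult_mono norm_m mult_left_mono rem_le) auto
    also have "\<dots> = (5 / 2 * h * u ^ r * cmod a * cmod (A - \<beta>\<^sub>1) * cmod (1 - w) * cmod (1 - y) ^ (2 * r)) * (rem_const \<nu> r / \<nu> * S r)"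
      by (simp add: mult_ac)
    also have "\<dots> \<le> (5 / 2 * h * u ^ r * cmod a * cmod (A - \<beta>\<^sub>1) * cmod (1 - w) * cmod (1 - y) ^ (2 * r)) * (Cn * \<Delta> ^ r)"
      using h(1) u remc[of r] by (intro mult_left_mono) (auto simp: less_imp_le)
    also have "\<dots> = l0 * (1 / E) ^ r"
      unfolding E' by (simp add: l0_def power_mult_distrib mult_ac flip: power_mult)
    finally show ?thesis by (simp add: power_divide)
  qed
  have det: "p r * q (Suc r) \<noteq> p (Suc r) * q r" for r
  proof -
    have "p r * q (Suc r) - p (Suc r) * q r = m r * m (Suc r) * (a * b * (\<beta>\<^sub>2 - \<beta>\<^sub>1) * (Xv r * Yv (Suc r) - Xv (Suc r) * Yv r))"
      by (simp add: p_def q_def algebra_simps)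
    moreover have "Xv r * Yv (Suc r) \<noteq> Xv (Suc r) * Yv r"
      unfolding Xv_def Yv_def by (rule hyp_det_nonzero[OF \<nu>(1,3) W1])
    ultimately have "p r * q (Suc r) - p (Suc r) * q r \<noteq> 0" using m0 a0 b0 R(3) by simp
    then show ?thesis by simp
  qed
  have K01: "(0::complex) \<in> K" "1 \<in> K" "-1 \<in> K" using subfield_complexD(1,2,5)[OF subK] by auto
  have p1: "cmod (p r) \<ge> 1" if "p r \<noteq> 0" for r
    using int_ge_1[of 0 1 r] that K01 by (simp add: int_imp_algebraic_int)
  have q1: "cmod (q r) \<ge> 1" if "q r \<noteq> 0" for r
    using int_ge_1[of "-1" 0 r] that K01 by (simp add: int_imp_algebraic_int)
  have Q1: "Q \<ge> 1"
    by (rule approximation_growth[OF Q0 E _ rem det p1 q1]) (use q_le in \<open>auto intro: less_imp_le\<close>)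
  have q0_1: "cmod q0 \<ge> 1" by (rule algebraic_int_norm_ge_1[OF K q0])

  \<comment> \<open>Comparison with the constant c\<close>
  have \<kappa>0: "\<kappa> \<ge> 0" using Q1 E by (simp add: kappa_def)
  define T where "T = cmod (csqrt \<tau>)"
  have T: "T \<ge> 1"
  proof (cases "K = \<rat> \<or> adjoin K \<beta>\<^sub>1 = K")
    case True
    then show ?thesis using \<tau> by (simp add: T_def)
  next
    case False
    then have t: "algebraic_int \<tau>" "\<tau> \<in> K" "adjoin K \<beta>\<^sub>1 = adjoin K (csqrt \<tau>)" using \<tau> by auto
    have "\<tau> \<noteq> 0"
    proof
      assume "\<tau> = 0"
      then have "adjoin K \<beta>\<^sub>1 \<subseteq> K" using t(3) K01 adjoin_minimal[OF subK, of K 0] by simp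
      then show False using False subfield_adjoin(2)[of K \<beta>\<^sub>1] by auto
    qed
    then have "cmod (csqrt \<tau>) \<ge> 1"
      by (intro int1 algebraic_int_csqrt t) (use t in \<open>auto simp flip: power2_eq_square\<close>)
    then show ?thesis by (simp add: T_def)
  qed
  define c' where "c' = 2 * k0 * Q * max 1 (2 * l0 * E) powr \<kappa>"
  have c': "c' > 0" using k0 Q0 by (auto simp: c'_def intro!: mult_pos_pos)
  have "c' \<le> c"
  proof -
    have c: "c = (2 * k0 * T * Q) * max 1 (2 * l0 * T * E) powr \<kappa>"
      by (simp add: c_def k0_def l0_def w a_def b_def T_def mult_ac)
    have "2 * k0 * 1 * Q \<le> 2 * k0 * T * Q" using k0 Q0 T by (intro mult_right_mono mult_left_mono) auto
    then have le1: "2 * k0 * Q \<le> 2 * k0 * T * Q" by simp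
    have le2: "max 1 (2 * l0 * E) powr \<kappa> \<le> max 1 (2 * l0 * T * E) powr \<kappa>"
    proof (rule powr_mono2[OF \<kappa>0])
      have "2 * l0 * 1 * E \<le> 2 * l0 * T * E" using l0 T E by (intro mult_right_mono mult_left_mono) auto
      then show "max 1 (2 * l0 * E) \<le> max 1 (2 * l0 * T * E)" by auto
    qed simp
    show ?thesis unfolding c c'_def by (rule mult_mono[OF le1 le2]) (use k0 Q0 T in auto)
  qed
  then have "1 / (c * cmod q0 powr (\<kappa> + 1)) \<le> 1 / (c' * cmod q0 powr (\<kappa> + 1))"
    using c' q0(3) by (intro divide_left_mono mult_right_mono mult_pos_pos) auto
  also have "\<dots> < cmod (A - p0 / q0)"
    unfolding c'_def kappa_def
    by (rule approximation_lower_bound[OF Q1 E k0 l0 q_le rem det _ q0_1])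
       (rule int_ge_1[OF p0 q0(1,2)])
  finally show "cmod (A - p0 / q0) > 1 / (c * cmod q0 powr (\<kappa> + 1))" .
qed

end
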